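(* Let $\mathcal H$ be a separable complex Hilbert space, let $\Omega\subseteq\mathbb C$ be open and connected, and let $A:\Omega\to\mathcal B(\mathcal H)$ be analytic with $A(z)\in\Phi(\mathcal H)$ for all $z\in\Omega$. Let $z_0\in\Omega$ be a pole of $A(\cdot)^{-1}$. Let $\widetilde P_1$ be any projection in $\mathcal H$ onto $\ker(A(z_0))$ and let $\widetilde Q_1=I_{\mathcal H}-\widetilde P_1$. Then $$A(z)=\widetilde A_1(z)\big[\widetilde Q_1-(z-z_0)\widetilde P_1\big],\quad z\in\Omega,$$ where: (a) $\widetilde A_1(\cdot)$ is analytic on $\Omega$; (b) $\widetilde A_1(z)\in\Phi(\mathcal H)$ for all $z\in\Omega$; (c) $\operatorname{def}(\widetilde A_1(z_0))\le\operatorname{def}(A(z_0))$; (d) $\operatorname{ind}(A(z))=\operatorname{ind}(\widetilde A_1(z))=0$ for $z\in\Omega$ with $|z-z_0|$ sufficiently small. If $z_0$ is a pole of $A(\cdot)^{-1}$ of order $n_0\in\mathbb N$, then $z_0$ is a pole of $\widetilde A_1(\cdot)^{-1}$ of order $n_0-1$. Finally, $[I_{\mathcal H}-A(\cdot)]\in\mathcal F(\mathcal H)$ (resp., $\mathcal B_p(\mathcal H)$ for some $1\le p\le\infty$) if and only if $[I_{\mathcal H}-\widetilde A_1(\cdot)]\in\mathcal F(\mathcal H)$ (resp., $\mathcal B_p(\mathcal H)$, with the same $p$), where membership of such an operator-valued function means membership of its value at every $z\in\Omega$.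
   Context: $\mathcal B(\mathcal H)$ denotes the bounded linear operators on $\mathcal H$; $\mathcal F(\mathcal H)$ the finite rank operators; $\mathcal B_p(\mathcal H)$, $1\le p<\infty$, the Schatten--von Neumann ideals; $\mathcal B_\infty(\mathcal H)$ the compact operators. $\Phi(\mathcal H)$ is the set of bounded Fredholm operators ($\dim\ker(T)<\infty$, $\operatorname{ran}(T)$ closed, $\dim\ker(T^* )<\infty$) and $\operatorname{ind}(T)=\dim\ker(T)-\dim\ker(T^* )$. For an operator $S$ with closed range, $\operatorname{def}(S)=\dim(\operatorname{ran}(S)^\perp)$. A projection is a bounded idempotent, not necessarily orthogonal. That $z_0$ is a pole of $A(\cdot)^{-1}$ entails that $A(z)$ is boundedly invertible for some $z\in\Omega$, so that by the analytic Fredholm theorem $A(\cdot)^{-1}$ is meromorphic on $\Omega$; the order of the pole refers to the norm convergent Laurent expansion of $A(z)^{-1}$ about $z_0$. A "pole of order $0$" means that the function has no pole at $z_0$, i.e. it extends analytically to $z_0$. *)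

theory Defs
  imports "HOL-Analysis.Analysis"
begin

section \<open>Complex Hilbert spaces\<close>

class scaleC =
  fixes scaleC :: "complex \<Rightarrow> 'a \<Rightarrow> 'a"  (infixr \<open>*\<^sub>C\<close> 75)

class complex_normed_vector = real_normed_vector + scaleC +
  assumes scaleC_add_right: "c *\<^sub>C (x + y) = c *\<^sub>C x + c *\<^sub>C y"
    and scaleC_add_left: "(c + d) *\<^sub>C x = c *\<^sub>C x + d *\<^sub>C x"
    and scaleC_scaleC: "c *\<^sub>C d *\<^sub>C x = (c * d) *\<^sub>C x"
    and scaleC_of_real: "complex_of_real r *\<^sub>C x = r *\<^sub>R x"
    and norm_scaleC: "norm (c *\<^sub>C x) = cmod c * norm x"

text \<open>
  The inner product is linear in the second argument.  Its real part is the real inner product of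
  the superclass, which is positive definite and induces the norm.
\<close>

class complex_inner = complex_normed_vector + real_inner +
  fixes cinner :: "'a \<Rightarrow> 'a \<Rightarrow> complex"
  assumes cinner_commute: "cinner x y = cnj (cinner y x)"
    and cinner_add_right: "cinner x (y + z) = cinner x y + cinner x z"
    and cinner_scaleC_right: "cinner x (c *\<^sub>C y) = c * cinner x y"
    and Re_cinner: "Re (cinner x y) = inner x y"

class complex_hilbert = complex_inner + complete_space

global_interpretation complex_vector: vector_space
    "scaleC :: complex \<Rightarrow> 'a \<Rightarrow> 'a :: complex_normed_vector"
  defines cspan = complex_vector.span
    and cdim = complex_vector.dim
proof
  show "1 *\<^sub>C x = x" for x :: 'a
    using scaleC_of_real[of 1 x] by simp
qed (simp_all add: scaleC_add_right scaleC_add_left scaleC_scaleC)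

text \<open>\<^const>\<open>cdim\<close> is \<open>0\<close> on infinite-dimensional spaces, so finiteness is always required separately.\<close>

definition finite_cdim :: "'a::complex_normed_vector set \<Rightarrow> bool" where
  "finite_cdim V \<longleftrightarrow> (\<exists>B. finite B \<and> V \<subseteq> cspan B)"

definition ortho_compl :: "'a::complex_inner set \<Rightarrow> 'a set" where
  "ortho_compl S = {y. \<forall>x\<in>S. cinner x y = 0}"


section \<open>Bounded operators\<close>

text \<open>The type \<open>'a \<Rightarrow>\<^sub>L 'a\<close> consists of the bounded real-linear maps; it is normed by the operator norm.\<close>

instantiation blinfun :: (real_normed_vector, complex_normed_vector) complex_normed_vector
begin

lift_definition scaleC_blinfun :: "complex \<Rightarrow> 'a \<Rightarrow>\<^sub>L 'b \<Rightarrow> 'a \<Rightarrow>\<^sub>L 'b" is "\<lambda>c f x. c *\<^sub>C f x"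
proof -
  fix c :: complex and f :: "'a \<Rightarrow> 'b"
  assume f: "bounded_linear f"
  have lin: "bounded_linear (\<lambda>y::'b. c *\<^sub>C y)"
  proof (rule bounded_linear_intro[where K = "cmod c"])
    show "c *\<^sub>C (r *\<^sub>R y) = r *\<^sub>R (c *\<^sub>C y)" for r and y :: 'b
      by (metis scaleC_of_real scaleC_scaleC mult.commute)
  qed (simp_all add: scaleC_add_right norm_scaleC mult.commute)
  show "bounded_linear (\<lambda>x. c *\<^sub>C f x)"
    by (rule bounded_linear_compose[OF lin f])
qed

instance
proof
  fix c d :: complex and r :: real and S T :: "'a \<Rightarrow>\<^sub>L 'b"
  show "c *\<^sub>C (S + T) = c *\<^sub>C S + c *\<^sub>C T"
    by transfer (simp add: scaleC_add_right)
  show "(c + d) *\<^sub>C T = c *\<^sub>C T + d *\<^sub>C T"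
    by transfer (simp add: scaleC_add_left)
  show "c *\<^sub>C d *\<^sub>C T = (c * d) *\<^sub>C T"
    by transfer (simp add: scaleC_scaleC)
  show "complex_of_real r *\<^sub>C T = r *\<^sub>R T"
    by transfer (simp add: scaleC_of_real)
  show "norm (c *\<^sub>C T) = cmod c * norm T"
  proof (rule antisym)
    show le: "norm (c *\<^sub>C T) \<le> cmod c * norm T" for c and T :: "'a \<Rightarrow>\<^sub>L 'b"
    proof (rule norm_blinfun_bound)
      show "norm (blinfun_apply (c *\<^sub>C T) x) \<le> cmod c * norm T * norm x" for x
        using mult_left_mono[OF norm_blinfun[of T x], of "cmod c"]
        by (simp add: scaleC_blinfun.rep_eq norm_scaleC mult.assoc)
    qed simp
    show "cmod c * norm T \<le> norm (c *\<^sub>C T)"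
    proof (cases "c = 0")
      case False
      have "inverse c *\<^sub>C (c *\<^sub>C T) = T"
        by (rule blinfun_eqI) (simp add: False scaleC_blinfun.rep_eq)
      with le[of "inverse c" "c *\<^sub>C T"] False show ?thesis
        by (simp add: norm_divide field_simps)
    qed simp
  qed
qed

end

definition bounded_ops :: "('a::complex_normed_vector \<Rightarrow>\<^sub>L 'a) set" where
  "bounded_ops = {T. \<forall>c x. blinfun_apply T (c *\<^sub>C x) = c *\<^sub>C blinfun_apply T x}"

definition op_ker :: "('a::complex_normed_vector \<Rightarrow>\<^sub>L 'a) \<Rightarrow> 'a set" where
  "op_ker T = {x. blinfun_apply T x = 0}"

definition op_ran :: "('a::complex_normed_vector \<Rightarrow>\<^sub>L 'a) \<Rightarrow> 'a set" where
  "op_ran T = range (blinfun_apply T)"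

definition adj :: "('a::complex_hilbert \<Rightarrow>\<^sub>L 'a) \<Rightarrow> ('a \<Rightarrow>\<^sub>L 'a)" where
  "adj T = (THE S. \<forall>x y. cinner (blinfun_apply T x) y = cinner x (blinfun_apply S y))"

definition invertible_op :: "('a::complex_normed_vector \<Rightarrow>\<^sub>L 'a) \<Rightarrow> bool" where
  "invertible_op T \<longleftrightarrow>
     (\<exists>S\<in>bounded_ops. S o\<^sub>L T = id_blinfun \<and> T o\<^sub>L S = id_blinfun)"

definition op_inverse :: "('a::complex_normed_vector \<Rightarrow>\<^sub>L 'a) \<Rightarrow> ('a \<Rightarrow>\<^sub>L 'a)" where
  "op_inverse T =
     (THE S. S \<in> bounded_ops \<and> S o\<^sub>L T = id_blinfun \<and> T o\<^sub>L S = id_blinfun)"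

text \<open>Idempotent, not necessarily self-adjoint.\<close>

definition projection_onto :: "('a::complex_normed_vector \<Rightarrow>\<^sub>L 'a) \<Rightarrow> 'a set \<Rightarrow> bool" where
  "projection_onto P V \<longleftrightarrow> P \<in> bounded_ops \<and> P o\<^sub>L P = P \<and> op_ran P = V"


section \<open>Fredholm operators\<close>

definition fredholm_ops :: "('a::complex_hilbert \<Rightarrow>\<^sub>L 'a) set" where
  "fredholm_ops = {T\<in>bounded_ops.
     finite_cdim (op_ker T) \<and> closed (op_ran T) \<and> finite_cdim (op_ker (adj T))}"

definition ind :: "('a::complex_hilbert \<Rightarrow>\<^sub>L 'a) \<Rightarrow> int" where
  "ind T = int (cdim (op_ker T)) - int (cdim (op_ker (adj T)))"

text \<open>The defect; only meaningful if the orthogonal complement of the range is finite-dimensional.\<close>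

definition def_op :: "('a::complex_hilbert \<Rightarrow>\<^sub>L 'a) \<Rightarrow> nat" where
  "def_op T = cdim (ortho_compl (op_ran T))"


section \<open>Operator ideals\<close>

definition finite_rank_ops :: "('a::complex_hilbert \<Rightarrow>\<^sub>L 'a) set" where
  "finite_rank_ops = {T\<in>bounded_ops. finite_cdim (op_ran T)}"

definition compact_ops :: "('a::complex_hilbert \<Rightarrow>\<^sub>L 'a) set" where
  "compact_ops = {T\<in>bounded_ops. compact (closure (blinfun_apply T ` cball 0 1))}"

text \<open>
  The singular values of \<open>T\<close> are the positive \<open>s\<close> such that \<open>s\<^sup>2\<close> is an eigenvalue of
  \<open>T\<^sup>* T\<close>, counted with the dimension of the eigenspace (finite if \<open>T\<close> is compact).
\<close>

definition singular_space :: "('a::complex_hilbert \<Rightarrow>\<^sub>L 'a) \<Rightarrow> real \<Rightarrow> 'a set" where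
  "singular_space T s = {x. blinfun_apply (adj T o\<^sub>L T) x = s\<^sup>2 *\<^sub>R x}"

definition singular_values :: "('a::complex_hilbert \<Rightarrow>\<^sub>L 'a) \<Rightarrow> real set" where
  "singular_values T = {s. 0 < s \<and> (\<exists>x\<in>singular_space T s. x \<noteq> 0)}"

text \<open>The ideals with finite exponent; for exponent infinity the ideal is \<^const>\<open>compact_ops\<close>.\<close>

definition schatten_ops :: "real \<Rightarrow> ('a::complex_hilbert \<Rightarrow>\<^sub>L 'a) set" where
  "schatten_ops p = {T\<in>compact_ops.
     (\<lambda>s. real (cdim (singular_space T s)) * s powr p) summable_on singular_values T}"


section \<open>Analytic functions and poles\<close>

text \<open>
  Intended for open \<open>S\<close>.  The difference quotient converges in norm, which for functions with values
  in the bounded operators is the operator norm.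
\<close>

definition analytic_fun :: "(complex \<Rightarrow> 'b::complex_normed_vector) \<Rightarrow> complex set \<Rightarrow> bool" where
  "analytic_fun f S \<longleftrightarrow>
     (\<forall>z\<in>S. \<exists>D. ((\<lambda>w. inverse (w - z) *\<^sub>C (f w - f z)) \<longlongrightarrow> D) (at z))"

text \<open>
  For positive order: the Laurent expansion about \<open>z0\<close> is
  \<open>f z = (\<Sum>k. (z - z0) powi (k - n) *\<^sub>C C k)\<close> with \<open>C 0 \<noteq> 0\<close>.  Order \<open>0\<close> means that \<open>f\<close> extends
  analytically to \<open>z0\<close>.  The value of \<open>f\<close> at \<open>z0\<close> is irrelevant.
\<close>

definition pole_of_order :: "(complex \<Rightarrow> 'b::complex_normed_vector) \<Rightarrow> complex \<Rightarrow> nat \<Rightarrow> bool" where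
  "pole_of_order f z0 n \<longleftrightarrow>
     (if n = 0 then
        \<exists>r>0. \<exists>g. analytic_fun g (ball z0 r) \<and> (\<forall>z\<in>ball z0 r - {z0}. g z = f z)
      else
        \<exists>r>0. \<exists>C. C 0 \<noteq> 0 \<and>
          (\<forall>z\<in>ball z0 r - {z0}. (\<lambda>k. (z - z0) powi (int k - int n) *\<^sub>C C k) sums f z))"

text \<open>
  \<^const>\<open>op_inverse\<close> is unspecified on non-invertible operators, hence invertibility in a punctured
  neighbourhood of \<open>z0\<close> is part of the definition.
\<close>

definition inverse_pole_of_order ::
    "(complex \<Rightarrow> ('a::complex_normed_vector \<Rightarrow>\<^sub>L 'a)) \<Rightarrow> complex \<Rightarrow> nat \<Rightarrow> bool" where
  "inverse_pole_of_order A z0 n \<longleftrightarrow>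
     (\<forall>\<^sub>F z in at z0. invertible_op (A z)) \<and> pole_of_order (\<lambda>z. op_inverse (A z)) z0 n"

definition inverse_has_pole ::
    "(complex \<Rightarrow> ('a::complex_normed_vector \<Rightarrow>\<^sub>L 'a)) \<Rightarrow> complex \<Rightarrow> bool" where
  "inverse_has_pole A z0 \<longleftrightarrow> (\<exists>n\<ge>1. inverse_pole_of_order A z0 n)"

end

theory Submission
  imports Defs "HOL-Complex_Analysis.Cauchy_Integral_Formula"
begin

text \<open>
  With \<open>q\<close> the difference quotient of \<open>A\<close> at \<open>z0\<close>, extended by \<open>A'(z0)\<close>, put
  \<open>A1 = A Q1 - q P1\<close>; since \<open>A(z0) P1 = 0\<close>, this is \<open>A(z) (Q1 - (z - z0)\<^sup>-\<^sup>1 P1)\<close> away from \<open>z0\<close>.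
  The operator \<open>A1(z0) = A(z0) - A'(z0) P1\<close> has range \<open>ran A(z0) + A'(z0) (ker A(z0))\<close>, and its
  kernel is mapped by \<open>P1\<close> bijectively onto the \<open>u\<close> in \<open>ker A(z0)\<close> with \<open>A'(z0) u\<close> in
  \<open>ran A(z0)\<close>. Hence defect and nullity drop by the same amount, so \<open>A1(z0)\<close> is Fredholm with the
  index of \<open>A(z0)\<close>. Comparing Laurent coefficients of \<open>(Q1 - (z - z0) P1) A(z)\<^sup>-\<^sup>1\<close> shows that the
  order of the pole drops by exactly one; after finitely many steps the operator at \<open>z0\<close> is
  invertible, so all the indices vanish without any appeal to the stability of the index. Finally
  \<open>A - A1\<close> has finite rank pointwise, and a perturbation of rank \<open>r\<close> increases the number of
  singular values above any level by at most \<open>r\<close>.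
\<close>

section \<open>Complex inner products\<close>

\<comment> \<open>Analyticity is available only as norm differentiability at each point, so the
  first obstacle is that \<open>q\<close> is differentiable at \<open>z0\<close>: this is a
  second-order expansion of \<open>A\<close> in operator norm. Scalar Cauchy estimates for the
  matrix elements supply it, because their constants depend only on a disc and on a norm bound
  there. The order of the pole cannot drop by more than one because the leading Laurent coefficient
  \<open>C 0\<close> of the inverse takes its values in the kernel of \<open>A z0\<close>; the new
  leading coefficient \<open>G 0\<close> therefore satisfies \<open>P G 0 = - C 0\<close>. In the
  Schatten ideals, singular values are given through eigenspaces of \<open>T* T\<close> and not as a
  decreasing sequence. The perturbation bound is hence proved for counting functions: too large a
  count for the perturbed operator would force an eigenvector missing from the count for the
  original one. Weighted sums are then recovered from counts.\<close>
subclass (in complex_hilbert) banach ..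

global_interpretation complex_vector_pair: vector_space_pair
    "scaleC :: complex \<Rightarrow> 'a \<Rightarrow> 'a :: complex_normed_vector"
    "scaleC :: complex \<Rightarrow> 'b \<Rightarrow> 'b :: complex_normed_vector"
  ..

lemma scaleR_scaleC_commute: "r *\<^sub>R c *\<^sub>C x = c *\<^sub>C r *\<^sub>R (x::'a::complex_normed_vector)"
  by (metis scaleC_of_real scaleC_scaleC mult.commute)

lemma bounded_bilinear_scaleC:
  "bounded_bilinear (scaleC :: complex \<Rightarrow> 'a \<Rightarrow> 'a::complex_normed_vector)"
proof
  show "\<exists>K. \<forall>c (x::'a). norm (c *\<^sub>C x) \<le> norm c * norm x * K"
    by (rule exI[of _ 1]) (simp add: norm_scaleC)
  show "(r *\<^sub>R c) *\<^sub>C x = r *\<^sub>R c *\<^sub>C x" for r c and x :: 'a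
    by (metis scaleC_of_real scaleC_scaleC scaleR_conv_of_real)
qed (simp_all add: scaleC_add_right scaleC_add_left scaleR_scaleC_commute)

lemmas tendsto_scaleC = bounded_bilinear.tendsto[OF bounded_bilinear_scaleC]

lemma cinner_add_left: "cinner (x + y) z = cinner x z + cinner y z"
  by (metis cinner_add_right cinner_commute complex_cnj_add)

lemma cinner_scaleC_left: "cinner (c *\<^sub>C x) y = cnj c * cinner x y"
  by (metis cinner_commute cinner_scaleC_right complex_cnj_mult)

lemma cinner_scaleR_right: "cinner x (r *\<^sub>R y) = of_real r * cinner x y"
  by (metis cinner_scaleC_right scaleC_of_real)

lemma cinner_scaleR_left: "cinner (r *\<^sub>R x) y = of_real r * cinner x y"
  by (metis cinner_commute cinner_scaleR_right complex_cnj_complex_of_real complex_cnj_mult)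

lemma cinner_self: "cinner x x = of_real ((norm x)\<^sup>2)"
proof (rule complex_eqI)
  show "Im (cinner x x) = Im (of_real ((norm x)\<^sup>2))"
    using arg_cong[OF cinner_commute[of x x], of Im] by simp
qed (simp add: Re_cinner power2_norm_eq_inner)

lemma cmod_cinner_le: "cmod (cinner x y) \<le> norm x * norm y"
proof (cases "cinner x y = 0")
  case False
  \<comment> \<open>Multiplying \<open>y\<close> by the phase \<open>u\<close> makes the inner
    product real and nonnegative, so the real Cauchy-Schwarz inequality applies.\<close>
  define u where "u = cnj (cinner x y) / cmod (cinner x y)"
  have "cinner x (u *\<^sub>C y) = of_real (cmod (cinner x y))"
    using False by (simp add: u_def cinner_scaleC_right mult.commute[of "cnj _"]
        complex_norm_square[symmetric] power2_eq_square)
  then have "cmod (cinner x y) = inner x (u *\<^sub>C y)"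
    by (metis Re_cinner Re_complex_of_real)
  also have "\<dots> \<le> norm x * norm (u *\<^sub>C y)" by (rule norm_cauchy_schwarz)
  also have "norm (u *\<^sub>C y) = norm y"
    using False by (simp add: u_def norm_scaleC norm_divide)
  finally show ?thesis .
qed simp

lemma bounded_bilinear_cinner:
  "bounded_bilinear (cinner :: 'a \<Rightarrow> 'a \<Rightarrow> complex)" for dummy :: "'a::complex_inner"
proof
  show "\<exists>K. \<forall>x (y::'a). norm (cinner x y) \<le> norm x * norm y * K"
    by (rule exI[of _ 1]) (simp add: cmod_cinner_le)
qed (simp_all add: cinner_add_left cinner_add_right cinner_scaleR_left cinner_scaleR_right
    scaleR_conv_of_real)

lemmas bounded_linear_cinner_right = bounded_bilinear.bounded_linear_right[OF bounded_bilinear_cinner]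
lemmas cinner_zero_left = bounded_bilinear.zero_left[OF bounded_bilinear_cinner]
lemmas cinner_zero_right = bounded_bilinear.zero_right[OF bounded_bilinear_cinner]
lemmas cinner_diff_left = bounded_bilinear.diff_left[OF bounded_bilinear_cinner]
lemmas cinner_diff_right = bounded_bilinear.diff_right[OF bounded_bilinear_cinner]
lemmas cinner_sum_left = bounded_bilinear.sum_left[OF bounded_bilinear_cinner]
lemmas cinner_sum_right = bounded_bilinear.sum_right[OF bounded_bilinear_cinner]

lemma cinner_eq_zero_commute: "cinner x y = 0 \<longleftrightarrow> cinner y x = 0"
  by (metis cinner_commute complex_cnj_zero)

lemma cinner_ext: "(\<And>z. cinner z x = cinner z y) \<Longrightarrow> x = y"
  using cinner_self[of "x - y"] by (simp add: cinner_diff_right)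

text \<open>Testing with the normalised \<open>v\<close> recovers its norm. This is the step by
  which scalar estimates become norm estimates.\<close>

lemma norm_le_cinner_bound:
  fixes v :: "'a::complex_inner"
  assumes "\<And>x. norm x \<le> 1 \<Longrightarrow> cmod (cinner x v) \<le> K"
  shows "norm v \<le> K"
proof (cases "v = 0")
  case True
  then show ?thesis using assms[of 0] by (simp add: cinner_zero_left)
next
  case False
  have "cinner (inverse (norm v) *\<^sub>R v) v = of_real (norm v)"
    using False by (simp add: cinner_scaleR_left cinner_self power2_eq_square field_simps)
  moreover have "norm (inverse (norm v) *\<^sub>R v) \<le> 1" using False by simp
  ultimately show ?thesis using assms[of "inverse (norm v) *\<^sub>R v"] by simp
qed

section \<open>Minimisation on closed subspaces and its consequences\<close>

text \<open>
  The minimiser of \<open>x \<mapsto> \<parallel>x\<parallel>\<^sup>2 - 2 g x\<close> on a closed subspace yields both the Riesz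
  representation theorem and the orthogonal decomposition of the space.
\<close>

lemma closed_subspace_representer:
  fixes V :: "'a::complex_hilbert set" and g :: "'a \<Rightarrow> real"
  assumes V: "closed V" "complex_vector.subspace V" and g: "bounded_linear g"
  obtains v where "v \<in> V" "\<And>h. h \<in> V \<Longrightarrow> inner v h = g h"
proof -
  interpret g: bounded_linear g by fact
  have VR: "r *\<^sub>R x \<in> V" if "x \<in> V" for r x
    using complex_vector.subspace_scale[OF V(2) that, of "of_real r"] by (simp add: scaleC_of_real)
  have V0: "0 \<in> V" and Vadd: "\<And>x y. x \<in> V \<Longrightarrow> y \<in> V \<Longrightarrow> x + y \<in> V"
    using V(2) by (auto simp: complex_vector.subspace_0 complex_vector.subspace_add)
  define J where "J = (\<lambda>x. (norm x)\<^sup>2 - 2 * g x)"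
  obtain K where K: "\<And>x. norm (g x) \<le> norm x * K" "K > 0"
    using g.pos_bounded by blast
  \<comment> \<open>Completing the square: \<open>J x\<close> is at least
    \<open>(norm x - K)^2 - K^2\<close>.\<close>
  have lower: "- K\<^sup>2 \<le> J x" for x
  proof -
    have "0 \<le> (norm x - K)\<^sup>2" by simp
    with K(1)[of x] show ?thesis by (simp add: J_def power2_eq_square algebra_simps)
  qed
  have bdd: "bdd_below (J ` V)" using lower by (intro bdd_belowI2)
  define m where "m = Inf (J ` V)"
  have m_le: "m \<le> J x" if "x \<in> V" for x
    unfolding m_def by (rule cInf_lower[OF _ bdd]) (use that in auto)
  have "\<exists>x\<in>V. J x < m + 1 / real (Suc n)" for n
    using cInf_lessD[of "J ` V" "m + 1 / real (Suc n)"] V0 by (auto simp: m_def)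
  then obtain X where X: "\<And>n. X n \<in> V" "\<And>n. J (X n) < m + 1 / real (Suc n)" by metis
  \<comment> \<open>Parallelogram law: the midpoint stays in \<open>V\<close>, so \<open>J\<close>
    is at least \<open>m\<close> there, and the linear part of \<open>J\<close> cancels. Minimising
    sequences are therefore Cauchy.\<close>
  have mid: "(norm (x - y))\<^sup>2 \<le> 2 * (J x - m) + 2 * (J y - m)" if "x \<in> V" "y \<in> V" for x y
  proof -
    have "4 * J ((1/2) *\<^sub>R (x + y)) = 2 * J x + 2 * J y - (norm (x - y))\<^sup>2"
      by (simp add: J_def power2_norm_eq_inner g.scaleR g.add inner_commute algebra_simps
          inner_add_left inner_add_right inner_diff_left inner_diff_right)
    moreover have "m \<le> J ((1/2) *\<^sub>R (x + y))"
      using that by (intro m_le VR Vadd)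
    ultimately show ?thesis by simp
  qed
  have "Cauchy X"
  proof (rule metric_CauchyI)
    fix e :: real assume "e > 0"
    then obtain N where N: "4 / e\<^sup>2 < real N" using reals_Archimedean2 by blast
    have small: "J (X n) - m < e\<^sup>2 / 4" if "n \<ge> N" for n
    proof -
      have pos: "0 < 4 / e\<^sup>2" using \<open>e > 0\<close> by simp
      have "4 / e\<^sup>2 < real (Suc n)" using N that by simp
      then have "1 / real (Suc n) < e\<^sup>2 / 4" using \<open>e > 0\<close> by (simp add: field_simps)
      with X(2)[of n] show ?thesis by linarith
    qed
    have "dist (X i) (X j) < e" if "i \<ge> N" "j \<ge> N" for i j
    proof -
      have "(norm (X i - X j))\<^sup>2 < e\<^sup>2"
        using mid[OF X(1)[of i] X(1)[of j]] small[OF that(1)] small[OF that(2)] by simp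
      then show ?thesis using \<open>e > 0\<close> by (simp add: dist_norm power2_less_imp_less)
    qed
    then show "\<exists>N. \<forall>i\<ge>N. \<forall>j\<ge>N. dist (X i) (X j) < e" by blast
  qed
  then obtain v where v: "X \<longlonglongrightarrow> v" using Cauchy_convergent_iff convergent_def by blast
  have vV: "v \<in> V" using closed_sequentially[OF V(1)] X(1) v by blast
  have "(\<lambda>n. J (X n)) \<longlonglongrightarrow> J v"
    unfolding J_def by (intro tendsto_intros v g.tendsto)
  moreover have "(\<lambda>n. m + 1 / real (Suc n)) \<longlonglongrightarrow> m + 0"
    by (intro tendsto_intros LIMSEQ_Suc lim_const_over_n)
  ultimately have Jv: "J v \<le> m"
    using X(2) by (intro LIMSEQ_le[of _ "J v"]) (auto intro: less_imp_le)
  have "inner v h = g h" if h: "h \<in> V" for h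
  proof -
    define b where "b = inner v h - g h"
    \<comment> \<open>First variation: minimality at \<open>v\<close> makes this quadratic in
      \<open>t\<close> nonnegative, which forces its linear coefficient \<open>b\<close> to
      vanish.\<close>
    have ineq: "0 \<le> t\<^sup>2 * (norm h)\<^sup>2 + 2 * t * b" for t
    proof -
      have "J (v + t *\<^sub>R h) = J v + t\<^sup>2 * (norm h)\<^sup>2 + 2 * t * b"
        by (simp add: J_def b_def power2_norm_eq_inner g.scaleR g.add inner_commute algebra_simps
            inner_add_left inner_add_right power2_eq_square[of t])
      moreover have "m \<le> J (v + t *\<^sub>R h)" using vV h by (intro m_le VR Vadd)
      ultimately show ?thesis using Jv by simp
    qed
    have "b = 0"
    proof (rule ccontr)
      assume b: "b \<noteq> 0"
      define N where "N = (norm h)\<^sup>2"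
      have N: "N \<ge> 0" by (simp add: N_def)
      \<comment> \<open>The test value is \<open>t = - b / q\<close>. Adding \<open>1\<close> keeps
        \<open>q\<close> positive when \<open>h = 0\<close>, and \<open>N - 2 * q = - N - 2\<close>
        is negative.\<close>
      define q where "q = N + 1"
      have q: "q > 0" "N - 2 * q < 0" using N by (simp_all add: q_def)
      have "(- b / q)\<^sup>2 * N + 2 * (- b / q) * b = b\<^sup>2 / q\<^sup>2 * (N - 2 * q)"
        using q(1) by (simp add: right_diff_distrib power_divide) (simp add: power2_eq_square)
      also have "\<dots> < 0"
        using b q by (intro mult_pos_neg) simp_all
      finally show False using ineq[of "- b / q"] by (simp add: N_def)
    qed
    then show ?thesis by (simp add: b_def)
  qed
  with vV show ?thesis by (rule that)
qed

lemma riesz_representation: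
  fixes f :: "'a::complex_hilbert \<Rightarrow> complex"
  assumes f: "bounded_linear f" "\<And>c x. f (c *\<^sub>C x) = c * f x"
  obtains v where "\<And>x. f x = cinner v x"
proof -
  obtain v where v: "\<And>h. inner v h = Re (f h)"
    using closed_subspace_representer[of "UNIV :: 'a set" "\<lambda>x. Re (f x)"]
      bounded_linear_compose[OF bounded_linear_Re f(1)] by auto
  \<comment> \<open>The real part determines a complex linear functional: the real part of
    \<open>f (\<i> *\<^sub>C x)\<close> is \<open>- Im (f x)\<close>.\<close>
  have "Im (f x) = Im (cinner v x)" for x
    using v[of "\<i> *\<^sub>C x"] by (simp add: Re_cinner[symmetric] f(2) cinner_scaleC_right)
  then show ?thesis using v by (intro that[of v] complex_eqI) (simp_all add: Re_cinner)
qed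

lemma subspace_ortho_compl: "complex_vector.subspace (ortho_compl S)"
  by (auto simp: ortho_compl_def complex_vector.subspace_def cinner_add_right cinner_scaleC_right
      cinner_zero_right)

lemma orthogonal_decomposition:
  fixes V :: "'a::complex_hilbert set"
  assumes V: "closed V" "complex_vector.subspace V"
  obtains v where "v \<in> V" "x - v \<in> ortho_compl V"
proof -
  obtain v where v: "v \<in> V" "\<And>h. h \<in> V \<Longrightarrow> inner v h = inner x h"
    using closed_subspace_representer[OF V bounded_linear_inner_right[of x]] by auto
  have "cinner h (x - v) = 0" if h: "h \<in> V" for h
  proof (rule complex_eqI)
    show "Re (cinner h (x - v)) = Re 0"
      using v(2)[OF h] by (simp add: Re_cinner inner_diff_right inner_commute)
    \<comment> \<open>The representer gives only real orthogonality; testing with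
      \<open>\<i> *\<^sub>C h\<close>, which also lies in \<open>V\<close>, yields the imaginary
      part.\<close>
    have "inner (x - v) (\<i> *\<^sub>C h) = 0"
      using v(2)[OF complex_vector.subspace_scale[OF V(2) h]] by (simp add: inner_diff_left)
    then show "Im (cinner h (x - v)) = Im 0"
      by (simp add: cinner_commute[of h] Re_cinner[symmetric] cinner_scaleC_right)
  qed
  with v(1) show ?thesis by (intro that) (auto simp: ortho_compl_def)
qed

section \<open>Bounded complex linear operators\<close>

lemma bounded_opsD: "T \<in> bounded_ops \<Longrightarrow> blinfun_apply T (c *\<^sub>C x) = c *\<^sub>C blinfun_apply T x"
  by (simp add: bounded_ops_def)

lemma bounded_ops_id [intro, simp]: "id_blinfun \<in> bounded_ops"
  by (simp add: bounded_ops_def)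

lemma bounded_ops_add [intro]: "S \<in> bounded_ops \<Longrightarrow> T \<in> bounded_ops \<Longrightarrow> S + T \<in> bounded_ops"
  by (simp add: bounded_ops_def blinfun.add_left scaleC_add_right)

lemma bounded_ops_diff [intro]: "S \<in> bounded_ops \<Longrightarrow> T \<in> bounded_ops \<Longrightarrow> S - T \<in> bounded_ops"
  by (simp add: bounded_ops_def blinfun.diff_left complex_vector.scale_right_diff_distrib)

lemma bounded_ops_uminus [intro]: "T \<in> bounded_ops \<Longrightarrow> - T \<in> bounded_ops"
  by (simp add: bounded_ops_def blinfun.minus_left)

lemma bounded_ops_scaleC [intro]: "T \<in> bounded_ops \<Longrightarrow> c *\<^sub>C T \<in> bounded_ops"
  by (simp add: bounded_ops_def scaleC_blinfun.rep_eq mult.commute)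

lemma bounded_ops_compose [intro]:
  "S \<in> bounded_ops \<Longrightarrow> T \<in> bounded_ops \<Longrightarrow> S o\<^sub>L T \<in> bounded_ops"
  by (simp add: bounded_ops_def)

lemma bounded_ops_linear:
  "T \<in> bounded_ops \<Longrightarrow> Vector_Spaces.linear scaleC scaleC (blinfun_apply T)"
  unfolding Vector_Spaces.linear_iff using complex_vector.vector_space_axioms
  by (auto simp: bounded_opsD blinfun.add_right)

text \<open>Derivatives and limits of inverses arise as norm limits inside a space of real linear
  maps; closedness keeps them complex linear.\<close>

lemma closed_bounded_ops: "closed (bounded_ops :: ('a::complex_normed_vector \<Rightarrow>\<^sub>L 'a) set)"
  unfolding bounded_ops_def
  by (intro closed_Collect_all closed_Collect_eq continuous_intros
      bounded_bilinear.continuous_on[OF bounded_bilinear_scaleC])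

lemma op_compose_scaleC_left: "(c *\<^sub>C S) o\<^sub>L T = c *\<^sub>C (S o\<^sub>L T)"
  by (rule blinfun_eqI) (simp add: scaleC_blinfun.rep_eq)

lemma op_compose_scaleC_right: "S \<in> bounded_ops \<Longrightarrow> S o\<^sub>L (c *\<^sub>C T) = c *\<^sub>C (S o\<^sub>L T)"
  by (rule blinfun_eqI) (simp add: scaleC_blinfun.rep_eq bounded_opsD)

lemmas op_compose_distribs =
  bounded_bilinear.add_left[OF bounded_bilinear_blinfun_compose]
  bounded_bilinear.add_right[OF bounded_bilinear_blinfun_compose]
  bounded_bilinear.diff_left[OF bounded_bilinear_blinfun_compose]
  bounded_bilinear.diff_right[OF bounded_bilinear_blinfun_compose]
  bounded_bilinear.minus_left[OF bounded_bilinear_blinfun_compose]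
  bounded_bilinear.minus_right[OF bounded_bilinear_blinfun_compose]
  bounded_bilinear.zero_left[OF bounded_bilinear_blinfun_compose]
  bounded_bilinear.zero_right[OF bounded_bilinear_blinfun_compose]

lemma op_compose_id [simp]: "id_blinfun o\<^sub>L T = T" "T o\<^sub>L id_blinfun = T"
  by (rule blinfun_eqI, simp)+

text \<open>Since \<open>adj\<close> is a definite description, existence and uniqueness of the
  adjoint have to be supplied here. Existence is the Riesz representation of
  \<open>\<lambda>x. cinner y (blinfun_apply T x)\<close> for each fixed \<open>y\<close>.\<close>

lemma cinner_adj:
  fixes T :: "'a::complex_hilbert \<Rightarrow>\<^sub>L 'a"
  assumes T: "T \<in> bounded_ops"
  shows "cinner (blinfun_apply T x) y = cinner x (blinfun_apply (adj T) y)"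
proof -
  have "\<exists>v. \<forall>x. cinner y (blinfun_apply T x) = cinner v x" for y
  proof -
    have "bounded_linear (\<lambda>x. cinner y (blinfun_apply T x))"
      by (rule bounded_linear_compose[OF bounded_linear_cinner_right blinfun.bounded_linear_right])
    from riesz_representation[OF this] show ?thesis
      by (metis T bounded_opsD cinner_scaleC_right)
  qed
  then obtain s where s: "\<And>y x. cinner y (blinfun_apply T x) = cinner (s y) x" by metis
  then have s': "cinner (blinfun_apply T x) y = cinner x (s y)" for x y
    by (metis cinner_commute)
  have "bounded_linear s"
  proof (rule bounded_linear_intro)
    show "s (x + y) = s x + s y" for x y
      by (rule cinner_ext) (simp add: s'[symmetric] cinner_add_right)
    show "s (r *\<^sub>R x) = r *\<^sub>R s x" for r x
      by (rule cinner_ext) (simp add: s'[symmetric] cinner_scaleR_right)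
    show "norm (s y) \<le> norm y * norm T" for y
    proof (rule norm_le_cinner_bound)
      fix x :: 'a assume x: "norm x \<le> 1"
      have "cmod (cinner x (s y)) \<le> norm (blinfun_apply T x) * norm y"
        unfolding s'[symmetric] by (rule cmod_cinner_le)
      also have "\<dots> \<le> (norm T * norm x) * norm y"
        by (intro mult_right_mono norm_blinfun) simp
      also have "\<dots> \<le> (norm T * 1) * norm y"
        using x by (intro mult_right_mono mult_left_mono) simp_all
      finally show "cmod (cinner x (s y)) \<le> norm y * norm T" by (simp add: mult.commute)
    qed
  qed
  then have ex: "\<forall>x y. cinner (blinfun_apply T x) y = cinner x (blinfun_apply (Blinfun s) y)"
    by (simp add: s' bounded_linear_Blinfun_apply)
  have "\<exists>!S. \<forall>x y. cinner (blinfun_apply T x) y = cinner x (blinfun_apply S y)"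
  proof (rule ex1I)
    show "S = Blinfun s"
      if "\<forall>x y. cinner (blinfun_apply T x) y = cinner x (blinfun_apply S y)" for S
    proof (intro blinfun_eqI cinner_ext)
      show "cinner x (blinfun_apply S y) = cinner x (blinfun_apply (Blinfun s) y)" for x y
        using that[rule_format, of x y] ex[rule_format, of x y] by simp
    qed
  qed (use ex in blast)
  from theI'[OF this] show ?thesis unfolding adj_def by blast
qed

text \<open>Removes \<open>adj\<close> from the Fredholm conditions and from the index: the nullity
  of the adjoint becomes the defect, and all later index counts concern only \<open>op_ker\<close>
  and \<open>op_ran\<close>.\<close>

lemma op_ker_adj:
  fixes T :: "'a::complex_hilbert \<Rightarrow>\<^sub>L 'a"
  assumes "T \<in> bounded_ops"
  shows "op_ker (adj T) = ortho_compl (op_ran T)"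
proof -
  have "blinfun_apply (adj T) y = 0 \<longleftrightarrow> (\<forall>x. cinner (blinfun_apply T x) y = 0)" for y
    unfolding cinner_adj[OF assms] by (metis cinner_ext cinner_zero_right)
  then show ?thesis by (auto simp: op_ker_def ortho_compl_def op_ran_def)
qed

lemma bounded_ops_adj:
  fixes T :: "'a::complex_hilbert \<Rightarrow>\<^sub>L 'a"
  assumes "T \<in> bounded_ops"
  shows "adj T \<in> bounded_ops"
  unfolding bounded_ops_def
  by (intro CollectI allI cinner_ext)
    (simp add: cinner_adj[OF assms, symmetric] cinner_scaleC_right)

lemma fredholm_ops_iff:
  "T \<in> fredholm_ops \<longleftrightarrow> T \<in> bounded_ops \<and> finite_cdim (op_ker T) \<and> closed (op_ran T)
     \<and> finite_cdim (ortho_compl (op_ran T))"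
  by (auto simp: fredholm_ops_def op_ker_adj)

lemma ind_eq: "T \<in> bounded_ops \<Longrightarrow> ind T = int (cdim (op_ker T)) - int (def_op T)"
  by (simp add: ind_def def_op_def op_ker_adj)

lemma subspace_op_ker: "T \<in> bounded_ops \<Longrightarrow> complex_vector.subspace (op_ker T)"
  unfolding op_ker_def by (rule complex_vector_pair.linear_subspace_kernel[OF bounded_ops_linear])

lemma subspace_op_ran: "T \<in> bounded_ops \<Longrightarrow> complex_vector.subspace (op_ran T)"
  unfolding op_ran_def
  by (rule complex_vector_pair.linear_subspace_image[OF bounded_ops_linear]) simp_all

section \<open>Orthonormal bases and dimension\<close>

definition orthonormal :: "'a::complex_inner set \<Rightarrow> bool" where
  "orthonormal B \<longleftrightarrow> (\<forall>x\<in>B. \<forall>y\<in>B. cinner x y = (if x = y then 1 else 0))"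

text \<open>Orthogonal projection onto \<open>cspan B\<close> when \<open>B\<close> is finite and
  orthonormal. For infinite \<open>B\<close> the sum is \<open>0\<close> by convention, so linearity
  and boundedness hold for every \<open>B\<close>.\<close>

definition ortho_proj :: "'a::complex_inner set \<Rightarrow> 'a \<Rightarrow> 'a" where
  "ortho_proj B x = (\<Sum>b\<in>B. cinner b x *\<^sub>C b)"

lemma orthonormal_subset: "orthonormal B \<Longrightarrow> C \<subseteq> B \<Longrightarrow> orthonormal C"
  unfolding orthonormal_def by (meson subsetD)

lemma orthonormal_norm:
  assumes "orthonormal B" "b \<in> B"
  shows "norm b = 1"
proof -
  have "cinner b b = 1" using assms by (simp add: orthonormal_def)
  then have "complex_of_real ((norm b)\<^sup>2) = of_real 1" by (simp add: cinner_self)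
  then have "(norm b)\<^sup>2 = 1" by (simp only: of_real_eq_iff)
  then show ?thesis using norm_ge_zero[of b] by (simp add: power2_eq_1_iff)
qed

lemma linear_ortho_proj: "Vector_Spaces.linear scaleC scaleC (ortho_proj B)"
  unfolding Vector_Spaces.linear_iff ortho_proj_def
  using complex_vector.vector_space_axioms
  by (auto simp: cinner_add_right cinner_scaleC_right scaleC_add_left sum.distrib
      complex_vector.scale_sum_right scaleC_scaleC)

lemma ortho_proj_in_span: "ortho_proj B x \<in> cspan B"
  unfolding ortho_proj_def
  by (intro complex_vector.span_sum complex_vector.span_scale complex_vector.span_base)

lemma bounded_linear_ortho_proj: "bounded_linear (ortho_proj B)"
  unfolding ortho_proj_def
  by (intro bounded_linear_sum bounded_linear_cinner_right
      bounded_linear_compose[OF bounded_bilinear.bounded_linear_left[OF bounded_bilinear_scaleC]])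

lemma cinner_ortho_proj:
  assumes "orthonormal B" "finite B" "b \<in> B"
  shows "cinner b (ortho_proj B x) = cinner b x"
proof -
  have "cinner b (ortho_proj B x) = (\<Sum>c\<in>B. if c = b then cinner b x else 0)"
    using assms(1,3) unfolding ortho_proj_def cinner_sum_right
    by (intro sum.cong) (auto simp: orthonormal_def cinner_scaleC_right)
  then show ?thesis using assms by simp
qed

lemma ortho_proj_id:
  assumes "orthonormal B" "finite B" "x \<in> cspan B"
  shows "ortho_proj B x = x"
proof -
  obtain u where u: "x = (\<Sum>c\<in>B. u c *\<^sub>C c)"
    using assms(3) unfolding complex_vector.span_finite[OF assms(2)] by blast
  have "cinner b x = u b" if "b \<in> B" for b
  proof -
    have "cinner b x = (\<Sum>c\<in>B. if c = b then u b else 0)"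
      using assms(1) that unfolding u cinner_sum_right
      by (intro sum.cong) (auto simp: orthonormal_def cinner_scaleC_right)
    then show ?thesis using assms that by simp
  qed
  then show ?thesis unfolding ortho_proj_def u by (intro sum.cong) simp_all
qed

lemma ortho_proj_eq_0_iff:
  assumes "orthonormal B" "finite B"
  shows "ortho_proj B x = 0 \<longleftrightarrow> x \<in> ortho_compl B"
  using cinner_ortho_proj[OF assms, of _ x]
  by (auto simp: ortho_compl_def cinner_zero_right ortho_proj_def)

lemma diff_ortho_proj:
  assumes "orthonormal B" "finite B"
  shows "x - ortho_proj B x \<in> ortho_compl B"
  using cinner_ortho_proj[OF assms, of _ x] by (auto simp: ortho_compl_def cinner_diff_right)

lemma subset_ortho_compl_commute: "A \<subseteq> ortho_compl B \<longleftrightarrow> B \<subseteq> ortho_compl A"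
  unfolding ortho_compl_def using cinner_eq_zero_commute by blast

lemma ortho_compl_cspan: "ortho_compl (cspan B) = ortho_compl B"
proof
  show "ortho_compl (cspan B) \<subseteq> ortho_compl B"
    using complex_vector.span_superset by (auto simp: ortho_compl_def)
  show "ortho_compl B \<subseteq> ortho_compl (cspan B)"
  proof
    fix y assume y: "y \<in> ortho_compl B"
    have "B \<subseteq> ortho_compl {y}"
      using y subset_ortho_compl_commute[of B "{y}"] by simp
    then have "cspan B \<subseteq> ortho_compl {y}"
      by (rule complex_vector.span_minimal[OF _ subspace_ortho_compl])
    then show "y \<in> ortho_compl (cspan B)"
      using subset_ortho_compl_commute[of "cspan B" "{y}"] by simp
  qed
qed

lemma orthonormal_independent:
  assumes "orthonormal B"
  shows "complex_vector.independent B"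
  unfolding complex_vector.independent_explicit_module
proof (intro allI impI)
  fix t u v assume t: "finite t" "t \<subseteq> B" "(\<Sum>v\<in>t. u v *\<^sub>C v) = 0" "v \<in> t"
  have "0 = cinner v (\<Sum>w\<in>t. u w *\<^sub>C w)" by (simp add: t(3) cinner_zero_right)
  also have "\<dots> = (\<Sum>w\<in>t. if w = v then u v else 0)"
    using assms t(2,4) unfolding cinner_sum_right
    by (intro sum.cong) (auto simp: orthonormal_def cinner_scaleC_right subset_iff)
  also have "\<dots> = u v" using t by simp
  finally show "u v = 0" by simp
qed

lemma cdim_cspan_orthonormal: "orthonormal B \<Longrightarrow> cdim (cspan B) = card B"
  by (intro complex_vector.dim_span_eq_card_independent orthonormal_independent)

text \<open>One Gram-Schmidt step: the part of a missing vector orthogonal to \<open>B\<close> is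
  nonzero and remains in \<open>V\<close>.\<close>

lemma orthonormal_extend_one:
  assumes V: "complex_vector.subspace V" "B \<subseteq> V" and B: "orthonormal B" "finite B"
    and "\<not> V \<subseteq> cspan B"
  obtains e where "e \<in> V" "e \<notin> B" "orthonormal (insert e B)"
proof -
  obtain x where x: "x \<in> V" "x \<notin> cspan B" using assms by blast
  define y where "y = x - ortho_proj B x"
  have spanV: "cspan B \<subseteq> V" by (rule complex_vector.span_minimal[OF V(2,1)])
  have yV: "y \<in> V"
    using x spanV ortho_proj_in_span[of B x] unfolding y_def
    by (intro complex_vector.subspace_diff[OF V(1)]) auto
  have y0: "y \<noteq> 0"
    using x ortho_proj_in_span[of B x] by (auto simp: y_def)
  have yB: "cinner b y = 0" if "b \<in> B" for b
    using diff_ortho_proj[OF B, of x] that by (auto simp: y_def ortho_compl_def)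
  define e where "e = complex_of_real (inverse (norm y)) *\<^sub>C y"
  have ee: "cinner e e = 1"
    using y0 by (simp add: cinner_self e_def norm_scaleC norm_inverse)
  have eB: "cinner b e = 0" if "b \<in> B" for b
    using yB[OF that] by (simp add: e_def cinner_scaleC_right)
  have "e \<notin> B" using ee eB by force
  moreover have "orthonormal (insert e B)"
    using B(1) ee eB cinner_eq_zero_commute[of e] unfolding orthonormal_def by (metis insert_iff)
  moreover have "e \<in> V" unfolding e_def by (rule complex_vector.subspace_scale[OF V(1) yV])
  ultimately show ?thesis using that by blast
qed

text \<open>An orthonormal set of greatest cardinality spans, since otherwise a Gram-Schmidt step
  would enlarge it. Only the sizes of orthonormal sets are bounded in advance, so the lemma also
  serves to prove finite dimensionality, for instance of eigenspaces of compact operators.\<close>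

lemma orthonormal_basis_extend_bounded:
  assumes V: "complex_vector.subspace V" "B0 \<subseteq> V" and B0: "orthonormal B0" "finite B0"
    and bound: "\<And>B. finite B \<Longrightarrow> B \<subseteq> V \<Longrightarrow> orthonormal B \<Longrightarrow> card B \<le> k"
  obtains B where "finite B" "B0 \<subseteq> B" "orthonormal B" "V = cspan B"
proof -
  define P where "P B \<longleftrightarrow> finite B \<and> B0 \<subseteq> B \<and> B \<subseteq> V \<and> orthonormal B" for B
  have "P B0" using assms by (simp add: P_def)
  moreover have "\<And>B. P B \<Longrightarrow> card B \<le> k" using bound by (auto simp: P_def)
  ultimately obtain B where B: "P B" "\<And>C. P C \<Longrightarrow> card C \<le> card B"
    using ex_has_greatest_nat[of P B0 card "Suc k"] by (auto simp: less_Suc_eq_le)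
  have "V \<subseteq> cspan B"
  proof (rule ccontr)
    assume "\<not> V \<subseteq> cspan B"
    then obtain e where "e \<in> V" "e \<notin> B" "orthonormal (insert e B)"
      using orthonormal_extend_one[OF V(1), of B] B(1) unfolding P_def by metis
    then have "P (insert e B)" "card (insert e B) = Suc (card B)"
      using B(1) by (auto simp: P_def)
    then show False using B(2) by fastforce
  qed
  moreover have "cspan B \<subseteq> V"
    using B(1) complex_vector.span_minimal[OF _ V(1)] by (auto simp: P_def)
  ultimately show ?thesis using B(1) that by (auto simp: P_def)
qed

lemma independent_card_bounded:
  assumes "finite_cdim V"
  obtains k where "\<And>B. B \<subseteq> V \<Longrightarrow> complex_vector.independent B \<Longrightarrow> finite B \<and> card B \<le> k"
proof -
  obtain C where C: "finite C" "V \<subseteq> cspan C" using assms by (auto simp: finite_cdim_def)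
  then have "finite B \<and> card B \<le> card C" if "B \<subseteq> V" "complex_vector.independent B" for B
    using complex_vector.independent_span_bound[of C B] that by blast
  then show ?thesis by (rule that)
qed

lemma orthonormal_basis_extend:
  assumes V: "complex_vector.subspace V" "finite_cdim V" "B0 \<subseteq> V" and B0: "orthonormal B0"
  obtains B where "finite B" "B0 \<subseteq> B" "orthonormal B" "V = cspan B" "card B = cdim V"
proof -
  obtain k where k: "\<And>B. B \<subseteq> V \<Longrightarrow> complex_vector.independent B \<Longrightarrow> finite B \<and> card B \<le> k"
    using independent_card_bounded[OF V(2)] by blast
  obtain B where "finite B" "B0 \<subseteq> B" "orthonormal B" "V = cspan B"
    using orthonormal_basis_extend_bounded[OF V(1,3) B0, of k] k
      orthonormal_independent B0 V(3) by metis
  then show ?thesis using that[of B] cdim_cspan_orthonormal[of B] by metis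
qed

lemma orthonormal_basis:
  assumes V: "complex_vector.subspace V" "finite_cdim V"
  obtains B where "finite B" "orthonormal B" "V = cspan B" "card B = cdim V"
  using orthonormal_basis_extend[OF assms, of "{}"] by (auto simp: orthonormal_def)

section \<open>Finite dimension and dimension counts\<close>

lemma finite_cdim_subset: "finite_cdim W \<Longrightarrow> V \<subseteq> W \<Longrightarrow> finite_cdim V"
  unfolding finite_cdim_def by (meson order_trans)

lemma finite_cdim_cspan: "finite B \<Longrightarrow> finite_cdim (cspan B)"
  unfolding finite_cdim_def by blast

lemma cdim_subset:
  assumes "finite_cdim W" "complex_vector.subspace W" "V \<subseteq> W"
  shows "cdim V \<le> cdim (W :: 'a::complex_inner set)"
  using orthonormal_basis[OF assms(2,1)] assms(3) complex_vector.dim_le_card by metis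

lemma finite_cdim_image:
  assumes "Vector_Spaces.linear scaleC scaleC L" "finite_cdim V"
  shows "finite_cdim (L ` V)"
proof -
  obtain C where C: "finite C" "V \<subseteq> cspan C" using assms by (auto simp: finite_cdim_def)
  then have "L ` V \<subseteq> cspan (L ` C)"
    using complex_vector_pair.linear_spans_image[OF assms(1)] by blast
  with C show ?thesis by (auto simp: finite_cdim_def)
qed

text \<open>An orthonormal set in \<open>V\<close> has an independent image of the same size, and
  \<open>fin\<close> bounds the size of independent sets in the image.\<close>

lemma finite_cdim_inj_image:
  fixes L :: "'a::complex_inner \<Rightarrow> 'b::complex_normed_vector"
  assumes L: "Vector_Spaces.linear scaleC scaleC L"
    and V: "complex_vector.subspace V" and fin: "finite_cdim (L ` V)"
    and inj: "\<And>x. x \<in> V \<Longrightarrow> L x = 0 \<Longrightarrow> x = 0"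
  shows "finite_cdim V"
proof -
  obtain k where k: "\<And>B. B \<subseteq> L ` V \<Longrightarrow> complex_vector.independent B \<Longrightarrow> finite B \<and> card B \<le> k"
    using independent_card_bounded[OF fin] by blast
  have "card B \<le> k" if B: "finite B" "B \<subseteq> V" "orthonormal B" for B
  proof -
    have span: "cspan B \<subseteq> V" by (rule complex_vector.span_minimal[OF B(2) V])
    then have inj_on: "inj_on L (cspan B)"
      using inj by (subst complex_vector_pair.linear_inj_on_iff_eq_0[OF L]) auto
    have "complex_vector.independent (L ` B)"
      by (rule complex_vector_pair.linear_independent_injective_image[OF L
            orthonormal_independent[OF B(3)] inj_on])
    moreover have "card (L ` B) = card B"
      by (rule card_image[OF inj_on_subset[OF inj_on complex_vector.span_superset]])
    ultimately show ?thesis using k[of "L ` B"] B by auto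
  qed
  then obtain B where "finite B" "V = cspan B"
    using orthonormal_basis_extend_bounded[OF V, of "{}" k] by (auto simp: orthonormal_def)
  then show ?thesis by (simp add: finite_cdim_cspan)
qed

text \<open>Extend an orthonormal basis \<open>B1\<close> of the kernel to one of \<open>V\<close>.
  The added vectors \<open>C\<close> are orthogonal to \<open>B1\<close>, so a kernel vector in
  \<open>cspan C\<close> is \<open>0\<close>; hence \<open>L\<close> maps \<open>C\<close>
  injectively to a basis of the image.\<close>

lemma rank_nullity:
  fixes L :: "'a::complex_inner \<Rightarrow> 'b::complex_normed_vector"
  assumes L: "Vector_Spaces.linear scaleC scaleC L"
    and V: "complex_vector.subspace V" "finite_cdim V"
  shows "cdim V = cdim (V \<inter> {x. L x = 0}) + cdim (L ` V)"
proof -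
  let ?K = "V \<inter> {x. L x = 0}"
  have K: "complex_vector.subspace ?K"
    by (intro complex_vector.subspace_inter V complex_vector_pair.linear_subspace_kernel[OF L])
  obtain B1 where B1: "finite B1" "orthonormal B1" "?K = cspan B1" "card B1 = cdim ?K"
    using orthonormal_basis[OF K finite_cdim_subset[OF V(2)]] by auto
  have "B1 \<subseteq> ?K" unfolding B1(3) by (rule complex_vector.span_superset)
  then obtain B where B: "finite B" "B1 \<subseteq> B" "orthonormal B" "V = cspan B" "card B = cdim V"
    using orthonormal_basis_extend[OF V _ B1(2)] by auto
  define C where "C = B - B1"
  have inj: "x = 0" if x: "x \<in> cspan C" "L x = 0" for x
  proof -
    have "x \<in> V" using x complex_vector.span_mono[of C B] B(4) by (auto simp: C_def)
    then have xB1: "x \<in> cspan B1" using x B1(3) by auto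
    have "C \<subseteq> ortho_compl B1"
      using B(2,3) by (auto simp: C_def ortho_compl_def orthonormal_def)
    then have "cspan C \<subseteq> ortho_compl B1"
      by (rule complex_vector.span_minimal[OF _ subspace_ortho_compl])
    then have "ortho_proj B1 x = 0" using x ortho_proj_eq_0_iff B1 by blast
    then show ?thesis using ortho_proj_id[OF B1(2,1) xB1] by simp
  qed
  then have inj_on: "inj_on L (cspan C)"
    by (subst complex_vector_pair.linear_inj_on_iff_eq_0[OF L]) auto
  have ind: "complex_vector.independent (L ` C)"
    by (rule complex_vector_pair.linear_independent_injective_image[OF L _ inj_on])
      (use B(3) orthonormal_independent orthonormal_subset[of B C] in \<open>auto simp: C_def\<close>)
  have card: "card (L ` C) = card C"
    by (rule card_image[OF inj_on_subset[OF inj_on complex_vector.span_superset]])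
  have "L ` B \<subseteq> cspan (L ` C)"
  proof
    fix y assume "y \<in> L ` B"
    then obtain b where b: "b \<in> B" "y = L b" by blast
    show "y \<in> cspan (L ` C)"
    proof (cases "b \<in> B1")
      case True
      then have "y = 0" using \<open>B1 \<subseteq> ?K\<close> b by auto
      then show ?thesis by (simp add: complex_vector.span_zero)
    next
      case False
      then show ?thesis using b by (auto simp: C_def intro: complex_vector.span_base)
    qed
  qed
  then have "cspan (L ` B) \<subseteq> cspan (L ` C)"
    by (rule complex_vector.span_minimal) simp
  then have "L ` V \<subseteq> cspan (L ` C)"
    unfolding B(4) complex_vector_pair.linear_span_image[OF L] .
  moreover have "L ` C \<subseteq> L ` V"
    using B(4) complex_vector.span_superset by (auto simp: C_def)
  ultimately have "cdim (L ` V) = card C"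
    using complex_vector.basis_card_eq_dim[of "L ` C" "L ` V"] ind card by simp
  moreover have "card B = card B1 + card C"
    using B B1 card_mono[OF B(1,2)] by (simp add: C_def card_Diff_subset)
  ultimately show ?thesis using B B1 by simp
qed

text \<open>Rank-nullity for the orthogonal projection onto \<open>M\<close> restricted to
  \<open>N\<close>: the image is \<open>M\<close>, the kernel is the orthogonal complement of
  \<open>M\<close> in \<open>N\<close>.\<close>

lemma cdim_orthogonal_split:
  fixes N :: "'a::complex_inner set"
  assumes N: "complex_vector.subspace N" "finite_cdim N"
    and M: "complex_vector.subspace M" "M \<subseteq> N"
  shows "cdim N = cdim M + cdim (N \<inter> ortho_compl M)"
proof -
  obtain R where R: "finite R" "orthonormal R" "M = cspan R"
    using orthonormal_basis[OF M(1) finite_cdim_subset[OF N(2) M(2)]] by metis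
  have "ortho_proj R ` N = M"
  proof
    show "ortho_proj R ` N \<subseteq> M" using R(3) ortho_proj_in_span by blast
    show "M \<subseteq> ortho_proj R ` N"
      using ortho_proj_id[OF R(2,1)] M(2) R(3) by (metis image_eqI subsetD subsetI)
  qed
  moreover have "{x. ortho_proj R x = 0} = ortho_compl M"
    using ortho_proj_eq_0_iff[OF R(2,1)] R(3) ortho_compl_cspan by auto
  ultimately show ?thesis using rank_nullity[OF linear_ortho_proj N, of R] by simp
qed

text \<open>\<open>W\<close> exceeds \<open>V\<close> only by its finite-dimensional part orthogonal
  to \<open>V\<close>. Subtracting the projection onto that part is continuous and pulls
  \<open>V\<close> back to \<open>W\<close>. This gives the closed range of the perturbed
  operator.\<close>

lemma closed_superspace:
  fixes V :: "'a::complex_hilbert set"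
  assumes V: "closed V" "complex_vector.subspace V" "finite_cdim (ortho_compl V)"
    and W: "complex_vector.subspace W" "V \<subseteq> W"
  shows "closed W"
proof -
  let ?N = "W \<inter> ortho_compl V"
  have "complex_vector.subspace ?N"
    by (intro complex_vector.subspace_inter W subspace_ortho_compl)
  moreover have "finite_cdim ?N" by (rule finite_cdim_subset[OF V(3)]) simp
  ultimately obtain R where R: "finite R" "orthonormal R" "?N = cspan R"
    using orthonormal_basis by metis
  have RV: "V \<subseteq> ortho_compl R"
    using R(3) complex_vector.span_superset[of R] subset_ortho_compl_commute[of R V] by auto
  have "W = (\<lambda>w. w - ortho_proj R w) -` V"
  proof (intro set_eqI iffI)
    fix w assume w: "w \<in> W"
    obtain p where p: "p \<in> V" "w - p \<in> ortho_compl V"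
      using orthogonal_decomposition[OF V(1,2)] by blast
    have "w - p \<in> cspan R"
      using w p W complex_vector.subspace_diff[OF W(1), of w p] R(3) by auto
    then have "w - p = ortho_proj R (w - p)" using ortho_proj_id R by metis
    also have "\<dots> = ortho_proj R w - ortho_proj R p"
      by (rule complex_vector_pair.linear_diff[OF linear_ortho_proj])
    also have "ortho_proj R p = 0" using p RV ortho_proj_eq_0_iff R by blast
    finally have "w - ortho_proj R w = p" by (simp add: algebra_simps)
    then show "w \<in> (\<lambda>w. w - ortho_proj R w) -` V" using p by simp
  next
    fix w assume w: "w \<in> (\<lambda>w. w - ortho_proj R w) -` V"
    have "ortho_proj R w \<in> W" using ortho_proj_in_span[of R w] R(3) by auto
    then show "w \<in> W"
      using w W complex_vector.subspace_add[OF W(1), of "w - ortho_proj R w" "ortho_proj R w"]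
      by auto
  qed
  moreover have "closed ((\<lambda>w. w - ortho_proj R w) -` V)"
    by (intro continuous_closed_vimage V(1) continuous_intros
        linear_continuous_at bounded_linear_ortho_proj)
  ultimately show ?thesis by simp
qed

text \<open>The projection is prescribed only for the first factor; the descent on the order of the
  pole needs one for each later kernel.\<close>

lemma projection_onto_exists:
  fixes V :: "'a::complex_inner set"
  assumes "complex_vector.subspace V" "finite_cdim V"
  obtains P where "projection_onto P V"
proof -
  obtain B where B: "finite B" "orthonormal B" "V = cspan B"
    using orthonormal_basis[OF assms] by metis
  define P where "P = Blinfun (ortho_proj B)"
  have P: "blinfun_apply P = ortho_proj B"
    unfolding P_def by (rule bounded_linear_Blinfun_apply[OF bounded_linear_ortho_proj])
  have "projection_onto P V"
    unfolding projection_onto_def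
  proof (intro conjI)
    show "P \<in> bounded_ops"
      by (simp add: bounded_ops_def P complex_vector_pair.linear_scale[OF linear_ortho_proj])
    show "P o\<^sub>L P = P"
      by (rule blinfun_eqI) (simp add: P ortho_proj_id[OF B(2,1) ortho_proj_in_span])
    show "op_ran P = V"
    proof
      show "op_ran P \<subseteq> V" using ortho_proj_in_span[of B] B(3) by (auto simp: op_ran_def P)
      show "V \<subseteq> op_ran P"
        using ortho_proj_id[OF B(2,1)] B(3) unfolding op_ran_def P by (metis rangeI subsetI)
    qed
  qed
  then show ?thesis by (rule that)
qed

section \<open>Perturbation of a Fredholm operator on its kernel\<close>

lemma projection_ontoD:
  assumes "projection_onto P V"
  shows "P \<in> bounded_ops" "blinfun_apply P x \<in> V" "x \<in> V \<Longrightarrow> blinfun_apply P x = x"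
proof -
  show "P \<in> bounded_ops" "blinfun_apply P x \<in> V"
    using assms by (auto simp: projection_onto_def op_ran_def)
  assume "x \<in> V"
  then obtain y where "x = blinfun_apply P y"
    using assms by (auto simp: projection_onto_def op_ran_def)
  moreover have "blinfun_apply (P o\<^sub>L P) y = blinfun_apply P y"
    using assms by (simp add: projection_onto_def)
  ultimately show "blinfun_apply P x = x" by simp
qed

text \<open>The compression \<open>L\<close> of \<open>D\<close> to a map from
  \<open>op_ker T\<close> into the orthogonal complement of the range governs both counts: nullity
  and defect each drop by its rank. No property of \<open>D\<close> beyond complex linearity and
  boundedness enters; the application takes the derivative at \<open>z0\<close>.\<close>

lemma fredholm_perturb_on_kernel:
  fixes T D P :: "'a::complex_hilbert \<Rightarrow>\<^sub>L 'a"
  assumes T: "T \<in> fredholm_ops" and D: "D \<in> bounded_ops" and P: "projection_onto P (op_ker T)"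
  shows "T - (D o\<^sub>L P) \<in> fredholm_ops"
    and "def_op (T - (D o\<^sub>L P)) \<le> def_op T"
    and "ind (T - (D o\<^sub>L P)) = ind T"
proof -
  let ?S = "T - (D o\<^sub>L P)"
  let ?K = "op_ker T" and ?V = "op_ran T"
  let ?N = "ortho_compl ?V"
  have Tb: "T \<in> bounded_ops" and finK: "finite_cdim ?K" and clV: "closed ?V"
    and finN: "finite_cdim ?N"
    using T by (auto simp: fredholm_ops_iff)
  have Sb: "?S \<in> bounded_ops"
    using Tb D projection_ontoD(1)[OF P] by blast
  have S: "blinfun_apply ?S x = blinfun_apply T x - blinfun_apply D (blinfun_apply P x)" for x
    by (simp add: blinfun.diff_left)
  have subK: "complex_vector.subspace ?K" and subV: "complex_vector.subspace ?V"
    and subN: "complex_vector.subspace ?N"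
    using subspace_op_ker[OF Tb] subspace_op_ran[OF Tb] subspace_ortho_compl by auto
  obtain R where R: "finite R" "orthonormal R" "?N = cspan R"
    using orthonormal_basis[OF subN finN] by metis
  define L where "L = (\<lambda>u. ortho_proj R (blinfun_apply D u))"
  have L: "Vector_Spaces.linear scaleC scaleC L"
    using Vector_Spaces.linear_compose[OF bounded_ops_linear[OF D] linear_ortho_proj[of R]]
    by (simp add: L_def o_def)
  have PT: "blinfun_apply T (blinfun_apply P x) = 0" for x
    using projection_ontoD(2)[OF P, of x] by (simp add: op_ker_def)
  \<comment> \<open>Split \<open>D u\<close> into \<open>p\<close> in the range and a remainder
    orthogonal to it; the remainder is \<open>L u\<close>.\<close>
  have L0: "L u = 0 \<longleftrightarrow> blinfun_apply D u \<in> ?V" for u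
  proof -
    obtain p where p: "p \<in> ?V" "blinfun_apply D u - p \<in> ?N"
      using orthogonal_decomposition[OF clV subV] by blast
    have "p \<in> ortho_compl R"
      using p R(3) complex_vector.span_superset[of R] subset_ortho_compl_commute[of R ?V] by auto
    then have "ortho_proj R p = 0" using ortho_proj_eq_0_iff R by blast
    moreover have "ortho_proj R (blinfun_apply D u - p) = blinfun_apply D u - p"
      using ortho_proj_id[OF R(2,1)] p R(3) by simp
    ultimately have Lu: "L u = blinfun_apply D u - p"
      by (simp add: L_def complex_vector_pair.linear_diff[OF linear_ortho_proj])
    show ?thesis
    proof
      assume "blinfun_apply D u \<in> ?V"
      then have "L u \<in> ?V \<inter> ?N" using Lu p complex_vector.subspace_diff[OF subV] by auto
      then have "cinner (L u) (L u) = 0" by (auto simp: ortho_compl_def)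
      then show "L u = 0" by (simp add: cinner_self)
    qed (use Lu p in auto)
  qed
  have ker_inj: "x = 0" if "x \<in> op_ker ?S" "blinfun_apply P x = 0" for x
  proof -
    have "x \<in> ?K" using that by (simp add: op_ker_def blinfun.diff_left)
    then show ?thesis using projection_ontoD(3)[OF P] that(2) by simp
  qed
  have P_ker: "blinfun_apply P ` op_ker ?S = ?K \<inter> {x. L x = 0}"
  proof (intro set_eqI iffI)
    fix y assume "y \<in> blinfun_apply P ` op_ker ?S"
    then obtain x where x: "y = blinfun_apply P x" "blinfun_apply T x = blinfun_apply D y"
      by (auto simp: op_ker_def blinfun.diff_left)
    then have "blinfun_apply D y \<in> ?V" by (metis op_ran_def rangeI)
    with x L0 projection_ontoD(2)[OF P] show "y \<in> ?K \<inter> {x. L x = 0}" by auto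
  next
    fix u assume u: "u \<in> ?K \<inter> {x. L x = 0}"
    then obtain y where y: "blinfun_apply D u = blinfun_apply T y"
      using L0 by (auto simp: op_ran_def)
    \<comment> \<open>Passing from \<open>y\<close> to \<open>x\<close> changes only the component
      in the kernel of \<open>T\<close>: the value under \<open>T\<close> is kept, while
      \<open>P x\<close> becomes the prescribed \<open>u\<close>.\<close>
    define x where "x = y - blinfun_apply P y + u"
    have Pu: "blinfun_apply P u = u" using u projection_ontoD(3)[OF P] by simp
    have PP: "blinfun_apply P (blinfun_apply P y) = blinfun_apply P y"
      using projection_ontoD[OF P] by simp
    have Px: "blinfun_apply P x = u"
      by (simp add: x_def blinfun.add_right blinfun.diff_right PP Pu)
    have "blinfun_apply T x = blinfun_apply T y"
      using u by (simp add: x_def blinfun.add_right blinfun.diff_right PT op_ker_def)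
    then have "x \<in> op_ker ?S" using Px y by (simp add: op_ker_def blinfun.diff_left)
    then show "u \<in> blinfun_apply P ` op_ker ?S" using Px by blast
  qed
  have linP: "Vector_Spaces.linear scaleC scaleC (blinfun_apply P)"
    by (rule bounded_ops_linear[OF projection_ontoD(1)[OF P]])
  have subS: "complex_vector.subspace (op_ker ?S)" by (rule subspace_op_ker[OF Sb])
  have "finite_cdim (blinfun_apply P ` op_ker ?S)"
    unfolding P_ker using finite_cdim_subset[OF finK] by simp
  then have finS: "finite_cdim (op_ker ?S)"
    using finite_cdim_inj_image[OF linP subS] ker_inj by blast
  have "op_ker ?S \<inter> {x. blinfun_apply P x = 0} = {0}"
    using ker_inj by (auto simp: op_ker_def)
  then have dimker: "cdim (op_ker ?S) = cdim (?K \<inter> {x. L x = 0})"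
    using rank_nullity[OF linP subS finS] P_ker complex_vector.dim_le_card[of "{0::'a}" "{}"] by simp
  have dimK: "cdim ?K = cdim (?K \<inter> {x. L x = 0}) + cdim (L ` ?K)"
    by (rule rank_nullity[OF L subK finK])
  have V_sub: "?V \<subseteq> op_ran ?S"
  proof
    fix y assume "y \<in> ?V"
    then obtain x where x: "y = blinfun_apply T x" by (auto simp: op_ran_def)
    have PP: "blinfun_apply P (blinfun_apply P x) = blinfun_apply P x"
      using projection_ontoD[OF P] by simp
    \<comment> \<open>Subtracting \<open>P x\<close> switches the perturbation off without changing
      the value of \<open>T\<close>.\<close>
    have "y = blinfun_apply ?S (x - blinfun_apply P x)"
      by (simp add: x blinfun.diff_left blinfun.diff_right PT PP)
    then show "y \<in> op_ran ?S" by (auto simp: op_ran_def)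
  qed
  have subR: "complex_vector.subspace (op_ran ?S)" by (rule subspace_op_ran[OF Sb])
  have clS: "closed (op_ran ?S)" by (rule closed_superspace[OF clV subV finN subR V_sub])
  have NS: "ortho_compl (op_ran ?S) \<subseteq> ?N" using V_sub by (auto simp: ortho_compl_def)
  show "?S \<in> fredholm_ops"
    unfolding fredholm_ops_iff using Sb finS clS finite_cdim_subset[OF finN NS] by blast
  show "def_op ?S \<le> def_op T"
    unfolding def_op_def by (rule cdim_subset[OF finN subN NS])
  have LN: "L ` ?K \<subseteq> ?N" using R(3) ortho_proj_in_span by (auto simp: L_def)
  have cinL: "cinner (L u) q = cinner (blinfun_apply D u) q" if q: "q \<in> ?N" for u q
  proof -
    \<comment> \<open>Against vectors of \<open>?N\<close> only the component of \<open>D u\<close>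
      in \<open>?N\<close> counts, so \<open>D\<close> may be replaced by \<open>L\<close>.\<close>
    have "blinfun_apply D u - L u \<in> ortho_compl (cspan R)"
      unfolding ortho_compl_cspan L_def by (rule diff_ortho_proj[OF R(2,1)])
    then have "cinner q (blinfun_apply D u - L u) = 0"
      using q R(3) by (auto simp: ortho_compl_def)
    then have "cinner (blinfun_apply D u - L u) q = 0" using cinner_eq_zero_commute by blast
    then show ?thesis by (simp add: cinner_diff_left)
  qed
  have "ortho_compl (op_ran ?S) = ?N \<inter> ortho_compl (L ` ?K)"
  proof (intro set_eqI iffI)
    fix q assume q: "q \<in> ortho_compl (op_ran ?S)"
    have "cinner (L u) q = 0" if "u \<in> ?K" for u
    proof -
      have "blinfun_apply ?S u = - blinfun_apply D u"
        using that projection_ontoD(3)[OF P that] by (simp add: S op_ker_def)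
      then have "- blinfun_apply D u \<in> op_ran ?S" by (metis op_ran_def rangeI)
      then have "blinfun_apply D u \<in> op_ran ?S"
        using complex_vector.subspace_neg[OF subR] by fastforce
      then show ?thesis using q NS cinL by (auto simp: ortho_compl_def)
    qed
    then show "q \<in> ?N \<inter> ortho_compl (L ` ?K)" using q NS by (auto simp: ortho_compl_def)
  next
    fix q assume q: "q \<in> ?N \<inter> ortho_compl (L ` ?K)"
    have "cinner (blinfun_apply D (blinfun_apply P x)) q = 0" for x
      using q cinL[of q "blinfun_apply P x"] projection_ontoD(2)[OF P, of x]
      by (auto simp: ortho_compl_def)
    moreover have "cinner (blinfun_apply T x) q = 0" for x
      using q by (auto simp: ortho_compl_def op_ran_def)
    ultimately show "q \<in> ortho_compl (op_ran ?S)"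
      by (auto simp: ortho_compl_def op_ran_def S cinner_diff_left)
  qed
  \<comment> \<open>The defect has dropped by the rank of \<open>L\<close>, exactly as the nullity
    has by \<open>dimK\<close> and \<open>dimker\<close>.\<close>
  then have "cdim ?N = cdim (L ` ?K) + cdim (ortho_compl (op_ran ?S))"
    using cdim_orthogonal_split[OF subN finN _ LN]
      complex_vector_pair.linear_subspace_image[OF L subK] by simp
  with dimker dimK show "ind ?S = ind T"
    by (simp add: ind_eq Tb Sb def_op_def)
qed

section \<open>Analytic operator functions\<close>

abbreviation has_cderiv ::
    "(complex \<Rightarrow> 'b::complex_normed_vector) \<Rightarrow> 'b \<Rightarrow> complex \<Rightarrow> bool" where
  "has_cderiv f D z \<equiv> ((\<lambda>w. inverse (w - z) *\<^sub>C (f w - f z)) \<longlongrightarrow> D) (at z)"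

lemma analytic_funI: "(\<And>z. z \<in> S \<Longrightarrow> \<exists>D. has_cderiv f D z) \<Longrightarrow> analytic_fun f S"
  by (simp add: analytic_fun_def)

lemma analytic_funD: "analytic_fun f S \<Longrightarrow> z \<in> S \<Longrightarrow> \<exists>D. has_cderiv f D z"
  by (simp add: analytic_fun_def)

lemma has_cderiv_continuous:
  assumes "has_cderiv f D z"
  shows "(f \<longlongrightarrow> f z) (at z)"
proof -
  have "((\<lambda>w. (w - z) *\<^sub>C (inverse (w - z) *\<^sub>C (f w - f z)) + f z) \<longlongrightarrow> (z - z) *\<^sub>C D + f z) (at z)"
    by (intro tendsto_intros tendsto_scaleC assms)
  moreover have "\<forall>\<^sub>F w in at z. (w - z) *\<^sub>C (inverse (w - z) *\<^sub>C (f w - f z)) + f z = f w"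
    by (auto simp: eventually_at_filter)
  ultimately show ?thesis by (auto dest: Lim_transform_eventually)
qed

lemma has_cderiv_linear:
  assumes f: "has_cderiv f D z" and L: "bounded_linear L" "\<And>c x. L (c *\<^sub>C x) = c *\<^sub>C L x"
  shows "has_cderiv (\<lambda>w. L (f w)) (L D) z"
  using bounded_linear.tendsto[OF L(1) f]
  by (simp add: L(2) linear_diff[OF bounded_linear.linear[OF L(1)]])

lemma has_cderiv_diff:
  assumes "has_cderiv f D z" "has_cderiv g E z"
  shows "has_cderiv (\<lambda>w. f w - g w) (D - E) z"
  using tendsto_diff[OF assms]
  by (simp add: complex_vector.scale_right_diff_distrib algebra_simps)

lemma has_cderiv_const: "has_cderiv (\<lambda>w. c) 0 z"
  by simp

lemma has_cderiv_scaleC: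
  assumes \<phi>: "(\<phi> has_field_derivative d) (at z)" and f: "has_cderiv f D z"
  shows "has_cderiv (\<lambda>w. \<phi> w *\<^sub>C f w) (d *\<^sub>C f z + \<phi> z *\<^sub>C D) z"
proof -
  have "((\<lambda>w. ((\<phi> w - \<phi> z) / (w - z)) *\<^sub>C f w + \<phi> z *\<^sub>C (inverse (w - z) *\<^sub>C (f w - f z)))
      \<longlongrightarrow> d *\<^sub>C f z + \<phi> z *\<^sub>C D) (at z)"
    by (intro tendsto_add tendsto_scaleC f has_cderiv_continuous[OF f] tendsto_const)
      (use \<phi> in \<open>simp add: has_field_derivative_iff\<close>)
  moreover have "((\<phi> w - \<phi> z) / (w - z)) *\<^sub>C f w + \<phi> z *\<^sub>C (inverse (w - z) *\<^sub>C (f w - f z))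
      = inverse (w - z) *\<^sub>C (\<phi> w *\<^sub>C f w - \<phi> z *\<^sub>C f z)" for w
    by (simp add: complex_vector.scale_right_diff_distrib complex_vector.scale_left_diff_distrib
        divide_inverse scaleC_scaleC algebra_simps)
  ultimately show ?thesis by simp
qed

lemma has_cderiv_transform:
  assumes f: "has_cderiv f D z" and S: "open S" "z \<in> S" "\<And>w. w \<in> S \<Longrightarrow> f w = g w"
  shows "has_cderiv g D z"
proof -
  have "\<forall>\<^sub>F w in at z. w \<in> S"
    using S(1,2) by (auto simp: eventually_at_topological)
  then have "\<forall>\<^sub>F w in at z. inverse (w - z) *\<^sub>C (f w - f z) = inverse (w - z) *\<^sub>C (g w - g z)"
    by eventually_elim (simp add: S)
  then show ?thesis by (rule Lim_transform_eventually[OF f])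
qed

lemma bounded_ops_lim:
  assumes "(f \<longlongrightarrow> T) F" "\<forall>\<^sub>F z in F. f z \<in> bounded_ops" "F \<noteq> bot"
  shows "T \<in> bounded_ops"
  using Lim_in_closed_set[OF closed_bounded_ops assms(2,3,1)] .

section \<open>From matrix elements to the operator norm\<close>

lemma norm_op_le_cinner:
  fixes T :: "'a::complex_inner \<Rightarrow>\<^sub>L 'a"
  assumes bd: "\<And>x y. norm x \<le> 1 \<Longrightarrow> norm y \<le> 1 \<Longrightarrow> cmod (cinner x (blinfun_apply T y)) \<le> K"
  shows "norm T \<le> K"
proof (rule norm_blinfun_bound)
  have "0 \<le> cmod (cinner 0 (blinfun_apply T 0))" by simp
  also have "\<dots> \<le> K" by (rule bd) simp_all
  finally show K: "0 \<le> K" .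
  fix y
  show "norm (blinfun_apply T y) \<le> K * norm y"
  proof (cases "y = 0")
    case False
    have "norm (blinfun_apply T (inverse (norm y) *\<^sub>R y)) \<le> K"
      by (rule norm_le_cinner_bound) (use bd False in simp)
    then have "inverse (norm y) * norm (blinfun_apply T y) \<le> K"
      by (simp add: blinfun.scaleR_right)
    then show ?thesis using False by (simp add: field_simps)
  qed simp
qed

text \<open>
  A Taylor estimate for holomorphic functions with a constant depending only on the radius and on
  the bound; this uniformity transfers it from the matrix elements to the operator norm.
\<close>

lemma holomorphic_Taylor2_bound:
  fixes g :: "complex \<Rightarrow> complex"
  assumes hol: "g holomorphic_on ball z0 r" and r: "r > 0"
    and bd: "\<And>z. z \<in> ball z0 r \<Longrightarrow> cmod (g z) \<le> M" and z: "cmod (z - z0) \<le> r / 2"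
  shows "cmod (g z - (g z0 + deriv g z0 * (z - z0) + deriv (deriv g) z0 * (z - z0)\<^sup>2 / 2))
    \<le> 192 * M / r ^ 3 * cmod (z - z0) ^ 3"
proof -
  let ?S = "cball z0 (r / 2)"
  have Sub: "?S \<subseteq> ball z0 r" using r by (auto simp: cball_subset_ball_iff)
  have der: "((deriv ^^ i) g has_field_derivative (deriv ^^ Suc i) g x) (at x within ?S)"
    if "x \<in> ?S" for x i
  proof -
    have "(deriv ^^ i) g holomorphic_on ball z0 r"
      by (rule holomorphic_higher_deriv[OF hol]) simp
    then show ?thesis
      using holomorphic_derivI[of "(deriv ^^ i) g" "ball z0 r" x] Sub that
      by (auto intro: has_field_derivative_at_within)
  qed
  \<comment> \<open>Discs of radius \<open>r / 4\<close> about points of the half disc stay inside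
    the ball, so Cauchy's inequality gives the constant \<open>384 = fact 3 * 4 ^ 3\<close>.\<close>
  have b3: "cmod ((deriv ^^ Suc 2) g x) \<le> 384 * M / r ^ 3" if x: "x \<in> ?S" for x
  proof -
    have sub: "cball x (r / 4) \<subseteq> ball z0 r"
    proof
      fix y assume "y \<in> cball x (r / 4)"
      then have "dist z0 y \<le> r / 2 + r / 4" using x dist_triangle[of z0 y x] by simp
      then show "y \<in> ball z0 r" using r by simp
    qed
    have "norm ((deriv ^^ 3) g x) \<le> fact 3 * M / (r / 4) ^ 3"
    proof (rule Cauchy_inequality)
      show "g holomorphic_on ball x (r / 4)"
        using hol sub by (meson ball_subset_cball holomorphic_on_subset subset_trans)
      show "continuous_on (cball x (r / 4)) g"
        using hol sub by (meson holomorphic_on_imp_continuous_on holomorphic_on_subset)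
      show "norm (g y) \<le> M" if "norm (x - y) = r / 4" for y
        using that sub by (intro bd) (auto simp: dist_norm)
    qed (use r in simp)
    then show ?thesis
      by (simp add: numeral_3_eq_3 fact_numeral power_divide eval_nat_numeral)
  qed
  \<comment> \<open>This form of the remainder carries the factor \<open>1 / fact 2\<close>, which
    turns \<open>384\<close> into \<open>192\<close>.\<close>
  have "cmod ((deriv ^^ 0) g z - (\<Sum>i\<le>2. (deriv ^^ i) g z0 * (z - z0) ^ i / fact i))
      \<le> 384 * M / r ^ 3 * cmod (z - z0) ^ Suc 2 / fact 2"
    by (rule complex_Taylor[where S = ?S and f = "\<lambda>i. (deriv ^^ i) g"])
      (use der b3 r z in \<open>auto simp: dist_norm norm_minus_commute\<close>)
  then show ?thesis
    by (simp add: numeral_2_eq_2 numeral_3_eq_3)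
qed

text \<open>Away from \<open>z0\<close> the product rule suffices. At \<open>z0\<close> a norm limit
  of the second-order quotient \<open>H\<close> is required, with no candidate at hand. Each matrix
  element of \<open>H\<close> converges at the rate \<open>B * cmod (z - z0)\<close> with the same
  \<open>B\<close> for all vectors in the unit ball, so \<open>H\<close> satisfies a Cauchy
  condition in operator norm and completeness provides the limit.\<close>

lemma analytic_difference_quotient:
  fixes f :: "complex \<Rightarrow> ('a::complex_hilbert \<Rightarrow>\<^sub>L 'a)"
  assumes S: "open S" "z0 \<in> S" and f: "analytic_fun f S" and D: "has_cderiv f D z0"
  shows "analytic_fun (\<lambda>z. if z = z0 then D else inverse (z - z0) *\<^sub>C (f z - f z0)) S"
    (is "analytic_fun ?q S")
proof (rule analytic_funI)
  fix z1 assume z1: "z1 \<in> S"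
  show "\<exists>E. has_cderiv ?q E z1"
  proof (cases "z1 = z0")
    case False
    obtain E where E: "has_cderiv f E z1" using analytic_funD[OF f z1] by blast
    have "((\<lambda>z. inverse (z - z0)) has_field_derivative - inverse ((z1 - z0)\<^sup>2)) (at z1)"
      using False by (auto intro!: derivative_eq_intros simp: power2_eq_square)
    from has_cderiv_scaleC[OF this has_cderiv_diff[OF E has_cderiv_const[where c = "f z0"]]]
    obtain E' where "has_cderiv (\<lambda>z. inverse (z - z0) *\<^sub>C (f z - f z0)) E' z1" by blast
    from has_cderiv_transform[OF this, of "- {z0}" ?q] False show ?thesis by auto
  next
    case True
    have "\<forall>\<^sub>F z in at z0. z \<in> S" using S by (auto simp: eventually_at_topological)
    moreover have "\<forall>\<^sub>F z in at z0. norm (f z) < norm (f z0) + 1"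
      by (rule order_tendstoD[OF tendsto_norm[OF has_cderiv_continuous[OF D]]]) simp
    ultimately have "\<forall>\<^sub>F z in at z0. z \<in> S \<and> norm (f z) < norm (f z0) + 1"
      by (rule eventually_conj)
    then obtain r where r: "r > 0"
      and ev: "\<And>z. z \<noteq> z0 \<Longrightarrow> dist z z0 < r \<Longrightarrow> z \<in> S \<and> norm (f z) < norm (f z0) + 1"
      unfolding eventually_at by auto
    define M where "M = norm (f z0) + 1"
    have rS: "z \<in> S" and rM: "norm (f z) \<le> M" if "z \<in> ball z0 r" for z
      using ev[of z] that S(2) by (cases "z = z0"; auto simp: M_def dist_commute)+
    define H where "H = (\<lambda>z. inverse (z - z0) *\<^sub>C (?q z - D))"
    define B where "B = 192 * M / r ^ 3"
    have M0: "0 \<le> M" by (simp add: M_def add_nonneg_nonneg)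
    \<comment> \<open>The limit \<open>c\<close> depends on \<open>x\<close> and \<open>y\<close>,
      but \<open>B\<close> does not. That uniformity is what survives the passage to the operator
      norm.\<close>
    have near: "\<exists>c. \<forall>z. z \<noteq> z0 \<longrightarrow> cmod (z - z0) \<le> r / 2 \<longrightarrow>
        cmod (cinner x (blinfun_apply (H z) y) - c) \<le> B * cmod (z - z0)"
      if xy: "norm x \<le> 1" "norm y \<le> 1" for x y
    proof -
      define g where "g = (\<lambda>z. cinner x (blinfun_apply (f z) y))"
      have blin: "bounded_linear (\<lambda>T :: 'a \<Rightarrow>\<^sub>L 'a. cinner x (blinfun_apply T y))"
        by (rule bounded_linear_compose[OF bounded_linear_cinner_right blinfun.bounded_linear_left])
      have gder: "(g has_field_derivative cinner x (blinfun_apply E y)) (at z)"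
        if "has_cderiv f E z" for E z
        using bounded_linear.tendsto[OF blin that]
        by (simp add: has_field_derivative_iff g_def scaleC_blinfun.rep_eq cinner_scaleC_right
            blinfun.diff_left cinner_diff_right divide_inverse mult.commute)
      have hol: "g holomorphic_on ball z0 r"
        unfolding holomorphic_on_open[OF open_ball] using gder analytic_funD[OF f rS] by blast
      have gM: "cmod (g z) \<le> M" if "z \<in> ball z0 r" for z
      proof -
        have "cmod (g z) \<le> norm x * norm (blinfun_apply (f z) y)"
          unfolding g_def by (rule cmod_cinner_le)
        also have "\<dots> \<le> 1 * norm (blinfun_apply (f z) y)"
          using xy by (intro mult_right_mono) simp_all
        also have "\<dots> \<le> norm (f z) * norm y" using norm_blinfun[of "f z" y] by simp
        also have "\<dots> \<le> M * 1" using xy rM[OF that] M0 by (intro mult_mono) simp_all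
        finally show ?thesis by simp
      qed
      have dg: "deriv g z0 = cinner x (blinfun_apply D y)"
        by (rule DERIV_imp_deriv[OF gder[OF D]])
      have "cmod (cinner x (blinfun_apply (H z) y) - deriv (deriv g) z0 / 2) \<le> B * cmod (z - z0)"
        if z: "z \<noteq> z0" "cmod (z - z0) \<le> r / 2" for z
      proof -
        define t where "t = z - z0"
        have t: "t \<noteq> 0" using z by (simp add: t_def)
        have Hz: "cinner x (blinfun_apply (H z) y)
            = inverse t * (inverse t * (g z - g z0) - deriv g z0)"
          using z unfolding H_def dg
          by (simp add: scaleC_blinfun.rep_eq cinner_scaleC_right blinfun.diff_left cinner_diff_right
              g_def t_def)
        \<comment> \<open>This is the second-order Taylor remainder of \<open>g\<close> divided by
          \<open>t^2\<close>; its cubic bound leaves one factor of \<open>t\<close>.\<close>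
        have "cinner x (blinfun_apply (H z) y) - deriv (deriv g) z0 / 2
            = (g z - (g z0 + deriv g z0 * t + deriv (deriv g) z0 * t\<^sup>2 / 2)) / t\<^sup>2"
          unfolding Hz using t by (simp add: field_simps power2_eq_square)
        then have "cmod (cinner x (blinfun_apply (H z) y) - deriv (deriv g) z0 / 2)
            = cmod (g z - (g z0 + deriv g z0 * t + deriv (deriv g) z0 * t\<^sup>2 / 2)) / cmod t ^ 2"
          by (simp add: norm_divide norm_power)
        also have "\<dots> \<le> B * cmod t ^ 3 / cmod t ^ 2"
          using holomorphic_Taylor2_bound[OF hol r gM z(2)]
          by (intro divide_right_mono) (simp_all add: t_def B_def)
        also have "\<dots> = B * cmod t" using t by (simp add: power3_eq_cube power2_eq_square)
        finally show ?thesis by (simp add: t_def)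
      qed
      then show ?thesis by blast
    qed
    \<comment> \<open>Comparing two values of \<open>H\<close> eliminates the unknown
      \<open>c\<close>, so the supremum over \<open>x\<close> and \<open>y\<close> can be
      taken.\<close>
    have HH: "norm (H z - H w) \<le> B * cmod (z - z0) + B * cmod (w - z0)"
      if z: "z \<noteq> z0" "cmod (z - z0) \<le> r / 2" and w: "w \<noteq> z0" "cmod (w - z0) \<le> r / 2" for z w
    proof (rule norm_op_le_cinner)
      fix x y :: 'a assume xy: "norm x \<le> 1" "norm y \<le> 1"
      obtain c where c: "\<And>z. z \<noteq> z0 \<Longrightarrow> cmod (z - z0) \<le> r / 2 \<Longrightarrow>
          cmod (cinner x (blinfun_apply (H z) y) - c) \<le> B * cmod (z - z0)"
        using near[OF xy] by blast
      have "cinner x (blinfun_apply (H z - H w) y)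
          = (cinner x (blinfun_apply (H z) y) - c) - (cinner x (blinfun_apply (H w) y) - c)"
        by (simp add: blinfun.diff_left cinner_diff_right)
      then show "cmod (cinner x (blinfun_apply (H z - H w) y)) \<le> B * cmod (z - z0) + B * cmod (w - z0)"
        using c[OF z] c[OF w] norm_triangle_ineq4 by (smt (verit))
    qed
    \<comment> \<open>Any sequence tending to \<open>z0\<close> would do; the offset
      \<open>2\<close> keeps all its points within distance \<open>r / 2\<close>.\<close>
    define X where "X = (\<lambda>n. z0 + of_real (r / real (n + 2)))"
    have X: "X n \<noteq> z0" "cmod (X n - z0) = r / real (n + 2)" "cmod (X n - z0) \<le> r / 2" for n
      using r by (simp_all add: X_def norm_divide field_simps del: of_real_divide of_real_add)
    have B0: "B \<ge> 0" using M0 r by (simp add: B_def)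
    have lim0: "(\<lambda>n. B * (r / real (n + 2))) \<longlonglongrightarrow> B * 0"
      by (intro tendsto_intros LIMSEQ_ignore_initial_segment[OF lim_const_over_n])
    have "Cauchy (\<lambda>n. H (X n))"
    proof (rule CauchyI)
      fix e :: real assume "e > 0"
      then obtain N where N: "\<And>n. n \<ge> N \<Longrightarrow> norm (B * (r / real (n + 2)) - B * 0) < e / 2"
        using LIMSEQ_D[OF lim0, of "e / 2"] by auto
      have b: "B * (r / real (n + 2)) < e / 2" if "n \<ge> N" for n
        using N[OF that] unfolding mult_zero_right diff_0_right real_norm_def by linarith
      have "norm (H (X m) - H (X n)) < e" if "m \<ge> N" "n \<ge> N" for m n
        using HH[OF X(1,3)[of m] X(1,3)[of n]] b[OF that(1)] b[OF that(2)]
        unfolding X(2) by linarith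
      then show "\<exists>N. \<forall>m\<ge>N. \<forall>n\<ge>N. norm (H (X m) - H (X n)) < e" by blast
    qed
    then obtain L where L: "(\<lambda>n. H (X n)) \<longlonglongrightarrow> L"
      using Cauchy_convergent_iff convergent_def by blast
    have HL: "norm (H z - L) \<le> B * cmod (z - z0)" if z: "z \<noteq> z0" "cmod (z - z0) \<le> r / 2" for z
    proof -
      have "(\<lambda>n. norm (H z - H (X n))) \<longlonglongrightarrow> norm (H z - L)"
        by (intro tendsto_intros L)
      moreover have "(\<lambda>n. B * cmod (z - z0) + B * (r / real (n + 2))) \<longlonglongrightarrow> B * cmod (z - z0) + B * 0"
        by (intro tendsto_add tendsto_const lim0)
      ultimately have "norm (H z - L) \<le> B * cmod (z - z0) + B * 0"
        using HH[OF z X(1,3)] by (intro LIMSEQ_le) (auto simp: X(2))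
      then show ?thesis by simp
    qed
    have "((\<lambda>z. H z - L) \<longlongrightarrow> 0) (at z0)"
    proof (rule Lim_null_comparison)
      show "\<forall>\<^sub>F z in at z0. norm (H z - L) \<le> B * cmod (z - z0)"
        unfolding eventually_at using r HL by (intro exI[of _ "r / 2"]) (auto simp: dist_norm)
      have "((\<lambda>z. B * cmod (z - z0)) \<longlongrightarrow> B * cmod (z0 - z0)) (at z0)"
        by (intro tendsto_intros)
      then show "((\<lambda>z. B * cmod (z - z0)) \<longlongrightarrow> 0) (at z0)" by simp
    qed
    then have "(H \<longlongrightarrow> L) (at z0)" using Lim_null by blast
    then have "has_cderiv ?q L z0" by (simp add: H_def)
    then show ?thesis using True by blast
  qed
qed

section \<open>Inverses and poles\<close>

lemma op_compose_assoc: "(R o\<^sub>L S) o\<^sub>L T = R o\<^sub>L (S o\<^sub>L T)"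
  by (rule blinfun_eqI) simp

lemma op_inverse:
  assumes "invertible_op T"
  shows "op_inverse T \<in> bounded_ops" "op_inverse T o\<^sub>L T = id_blinfun"
    "T o\<^sub>L op_inverse T = id_blinfun"
proof -
  obtain S where S: "S \<in> bounded_ops \<and> S o\<^sub>L T = id_blinfun \<and> T o\<^sub>L S = id_blinfun"
    using assms by (auto simp: invertible_op_def)
  have "\<exists>!S. S \<in> bounded_ops \<and> S o\<^sub>L T = id_blinfun \<and> T o\<^sub>L S = id_blinfun"
  proof (rule ex1I)
    show "S \<in> bounded_ops \<and> S o\<^sub>L T = id_blinfun \<and> T o\<^sub>L S = id_blinfun" by (rule S)
    fix R assume "R \<in> bounded_ops \<and> R o\<^sub>L T = id_blinfun \<and> T o\<^sub>L R = id_blinfun"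
    then show "R = S" using S by (metis op_compose_assoc op_compose_id)
  qed
  from theI'[OF this]
  show "op_inverse T \<in> bounded_ops" "op_inverse T o\<^sub>L T = id_blinfun"
    "T o\<^sub>L op_inverse T = id_blinfun"
    unfolding op_inverse_def by blast+
qed

lemma op_inverse_eqI:
  assumes "S \<in> bounded_ops" "S o\<^sub>L T = id_blinfun" "T o\<^sub>L S = id_blinfun"
  shows "invertible_op T" "op_inverse T = S"
proof -
  show "invertible_op T" using assms by (auto simp: invertible_op_def)
  from op_inverse[OF this] show "op_inverse T = S"
    using assms by (metis op_compose_assoc op_compose_id)
qed

text \<open>The resolvent identity, from which both continuity and differentiability of inversion
  follow.\<close>

lemma op_inverse_diff:
  assumes "invertible_op S" "invertible_op T"
  shows "op_inverse S - op_inverse T = - (op_inverse S o\<^sub>L (S - T) o\<^sub>L op_inverse T)"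
  using op_inverse[OF assms(1)] op_inverse[OF assms(2)]
  by (simp add: op_compose_distribs op_compose_assoc)

lemmas tendsto_op_compose = bounded_bilinear.tendsto[OF bounded_bilinear_blinfun_compose]

text \<open>The nearby inverses are not known to be bounded beforehand. Once
  \<open>norm (A w - A z) * K\<close> is below \<open>1/2\<close>, the resolvent identity bounds the
  difference by half of \<open>?x\<close>, which yields \<open>?x\<close> \<le>
  \<open>2 * K\<close>; inserting this bound into the same identity gives convergence.\<close>

lemma tendsto_op_inverse:
  fixes A :: "complex \<Rightarrow> ('a::complex_normed_vector \<Rightarrow>\<^sub>L 'a)"
  assumes lim: "(A \<longlongrightarrow> A z) (at z)" and inv: "invertible_op (A z)"
    "\<forall>\<^sub>F w in at z. invertible_op (A w)"
  shows "((\<lambda>w. op_inverse (A w)) \<longlongrightarrow> op_inverse (A z)) (at z)"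
proof -
  define K where "K = norm (op_inverse (A z))"
  have lim0: "((\<lambda>w. norm (A w - A z) * K) \<longlongrightarrow> 0) (at z)"
    using tendsto_mult[OF tendsto_norm[OF tendsto_diff[OF lim tendsto_const[of "A z"]]]
        tendsto_const[of K]] by simp
  then have "\<forall>\<^sub>F w in at z. norm (A w - A z) * K < 1/2"
    by (rule order_tendstoD) simp
  with inv(2) have "\<forall>\<^sub>F w in at z.
      norm (op_inverse (A w) - op_inverse (A z)) \<le> 2 * K * (norm (A w - A z) * K)"
  proof eventually_elim
    case (elim w)
    let ?x = "norm (op_inverse (A w))"
    have le: "norm (op_inverse (A w) - op_inverse (A z)) \<le> ?x * (norm (A w - A z) * K)"
    proof -
      have "norm (op_inverse (A w) - op_inverse (A z))
          \<le> norm (op_inverse (A w) o\<^sub>L (A w - A z)) * K"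
        unfolding op_inverse_diff[OF elim(1) inv(1)] K_def norm_minus_cancel
        by (rule norm_blinfun_compose)
      also have "\<dots> \<le> (?x * norm (A w - A z)) * K"
        by (intro mult_right_mono norm_blinfun_compose) (simp add: K_def)
      finally show ?thesis by (simp add: mult.assoc)
    qed
    also have "\<dots> \<le> ?x * (1/2)" using elim by (intro mult_left_mono) simp_all
    finally have "?x \<le> 2 * K"
      using norm_triangle_sub[of "op_inverse (A w)" "op_inverse (A z)"] by (simp add: K_def)
    then have "?x * (norm (A w - A z) * K) \<le> 2 * K * (norm (A w - A z) * K)"
      by (intro mult_right_mono) (simp_all add: K_def)
    with le show ?case by linarith
  qed
  then have "((\<lambda>w. op_inverse (A w) - op_inverse (A z)) \<longlongrightarrow> 0) (at z)"
    by (rule Lim_null_comparison) (use tendsto_mult_right_zero[OF lim0] in simp)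
  then show ?thesis using Lim_null by blast
qed

lemma analytic_op_inverse:
  fixes A :: "complex \<Rightarrow> ('a::complex_normed_vector \<Rightarrow>\<^sub>L 'a)"
  assumes S: "open S" and A: "analytic_fun A S" and inv: "\<And>z. z \<in> S \<Longrightarrow> invertible_op (A z)"
  shows "analytic_fun (\<lambda>z. op_inverse (A z)) S"
proof (rule analytic_funI)
  fix z assume z: "z \<in> S"
  obtain D where D: "has_cderiv A D z" using analytic_funD[OF A z] by blast
  have ev: "\<forall>\<^sub>F w in at z. w \<in> S" using S z by (auto simp: eventually_at_topological)
  then have ev': "\<forall>\<^sub>F w in at z. invertible_op (A w)" by eventually_elim (rule inv)
  have "((\<lambda>w. - (op_inverse (A w) o\<^sub>L (inverse (w - z) *\<^sub>C (A w - A z)) o\<^sub>L op_inverse (A z)))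
      \<longlongrightarrow> - (op_inverse (A z) o\<^sub>L D o\<^sub>L op_inverse (A z))) (at z)"
    by (intro tendsto_minus tendsto_op_compose tendsto_const D
        tendsto_op_inverse has_cderiv_continuous[OF D] inv[OF z] ev')
  moreover have "\<forall>\<^sub>F w in at z.
      - (op_inverse (A w) o\<^sub>L (inverse (w - z) *\<^sub>C (A w - A z)) o\<^sub>L op_inverse (A z))
      = inverse (w - z) *\<^sub>C (op_inverse (A w) - op_inverse (A z))"
    using ev'
    by eventually_elim
      (simp add: op_inverse_diff inv[OF z] op_inverse op_compose_scaleC_right op_compose_scaleC_left)
  ultimately have "has_cderiv (\<lambda>z. op_inverse (A z))
      (- (op_inverse (A z) o\<^sub>L D o\<^sub>L op_inverse (A z))) z"
    by (rule Lim_transform_eventually)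
  then show "\<exists>D. has_cderiv (\<lambda>z. op_inverse (A z)) D z" by blast
qed

text \<open>Both inverse identities pass to the limit. This is how the descent ends: regularity of
  the inverse near \<open>z0\<close> becomes invertibility at \<open>z0\<close>.\<close>

lemma op_inverse_limit:
  fixes A :: "complex \<Rightarrow> ('a::complex_normed_vector \<Rightarrow>\<^sub>L 'a)"
  assumes A: "(A \<longlongrightarrow> A z) (at z)" and ev: "\<forall>\<^sub>F w in at z. invertible_op (A w)"
    and lim: "((\<lambda>w. op_inverse (A w)) \<longlongrightarrow> G) (at z)"
  shows "invertible_op (A z)"
proof (rule op_inverse_eqI(1))
  show "G \<in> bounded_ops"
    by (rule bounded_ops_lim[OF lim]) (use ev in \<open>auto elim: eventually_mono intro: op_inverse\<close>)
  have "((\<lambda>w. op_inverse (A w) o\<^sub>L A w) \<longlongrightarrow> G o\<^sub>L A z) (at z)"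
    by (intro tendsto_op_compose lim A)
  moreover have "\<forall>\<^sub>F w in at z. op_inverse (A w) o\<^sub>L A w = id_blinfun"
    using ev by eventually_elim (rule op_inverse)
  ultimately have "((\<lambda>w. id_blinfun) \<longlongrightarrow> G o\<^sub>L A z) (at z)"
    by (rule Lim_transform_eventually)
  then show "G o\<^sub>L A z = id_blinfun"
    by (metis tendsto_const tendsto_unique trivial_limit_at)
  have "((\<lambda>w. A w o\<^sub>L op_inverse (A w)) \<longlongrightarrow> A z o\<^sub>L G) (at z)"
    by (intro tendsto_op_compose lim A)
  moreover have "\<forall>\<^sub>F w in at z. A w o\<^sub>L op_inverse (A w) = id_blinfun"
    using ev by eventually_elim (rule op_inverse)
  ultimately have "((\<lambda>w. id_blinfun) \<longlongrightarrow> A z o\<^sub>L G) (at z)"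
    by (rule Lim_transform_eventually)
  then show "A z o\<^sub>L G = id_blinfun"
    by (metis tendsto_const tendsto_unique trivial_limit_at)
qed

text \<open>Identifies the leading Laurent coefficient as a limit, whatever value \<open>F\<close>
  has at \<open>z0\<close>. The tail of the series is dominated by a geometric one.\<close>

lemma power_series_tendsto:
  fixes C :: "nat \<Rightarrow> 'b::{complex_normed_vector,banach}"
  assumes r: "r > 0" and F: "\<And>z. z \<in> ball z0 r - {z0} \<Longrightarrow> (\<lambda>k. (z - z0) ^ k *\<^sub>C C k) sums F z"
  shows "(F \<longlongrightarrow> C 0) (at z0)"
proof -
  define \<rho> where "\<rho> = r / 2"
  have \<rho>: "\<rho> > 0" "\<rho> < r" using r by (simp_all add: \<rho>_def)
  \<comment> \<open>Convergence at this single point bounds the terms there, hence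
    \<open>norm (C k)\<close> by \<open>M / \<rho> ^ k\<close>.\<close>
  have "z0 + of_real \<rho> \<in> ball z0 r - {z0}" using \<rho> by (simp add: dist_norm)
  from summable_LIMSEQ_zero[OF sums_summable[OF F[OF this]]]
  have "(\<lambda>k. of_real \<rho> ^ k *\<^sub>C C k) \<longlonglongrightarrow> 0" by simp
  from convergent_imp_Bseq[OF convergentI[OF this]]
  obtain M where M: "M > 0" "\<And>k. norm (of_real \<rho> ^ k *\<^sub>C C k) \<le> M"
    unfolding Bseq_def by blast
  have CM: "norm (C k) \<le> M / \<rho> ^ k" for k
    using M(2)[of k] \<rho> by (simp add: norm_scaleC norm_power field_simps)
  have bound: "norm (F z - C 0) \<le> M * (cmod (z - z0) / \<rho>) * (1 / (1 - cmod (z - z0) / \<rho>))"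
    if z: "z \<noteq> z0" "cmod (z - z0) < \<rho>" for z
  proof (rule norm_sums_le)
    let ?t = "cmod (z - z0) / \<rho>"
    have "(\<lambda>k. (z - z0) ^ k *\<^sub>C C k) sums F z"
      using z \<rho> by (intro F) (auto simp: dist_norm norm_minus_commute)
    then show "(\<lambda>k. (z - z0) ^ Suc k *\<^sub>C C (Suc k)) sums (F z - C 0)"
      by (subst sums_Suc_iff) simp
    show "(\<lambda>k. M * ?t * ?t ^ k) sums (M * ?t * (1 / (1 - ?t)))"
      using z \<rho> by (intro sums_mult geometric_sums) simp
    show "norm ((z - z0) ^ Suc k *\<^sub>C C (Suc k)) \<le> M * ?t * ?t ^ k" for k
    proof -
      have "norm ((z - z0) ^ Suc k *\<^sub>C C (Suc k)) \<le> cmod (z - z0) ^ Suc k * (M / \<rho> ^ Suc k)"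
        unfolding norm_scaleC norm_power by (intro mult_left_mono CM) simp
      then show ?thesis by (simp add: power_divide mult_ac)
    qed
  qed
  have "((\<lambda>z. F z - C 0) \<longlongrightarrow> 0) (at z0)"
  proof (rule Lim_null_comparison)
    show "\<forall>\<^sub>F z in at z0. norm (F z - C 0)
        \<le> M * (cmod (z - z0) / \<rho>) * (1 / (1 - cmod (z - z0) / \<rho>))"
      unfolding eventually_at using \<rho>(1) bound by (auto simp: dist_norm)
    have "((\<lambda>z. M * (cmod (z - z0) / \<rho>) * (1 / (1 - cmod (z - z0) / \<rho>)))
        \<longlongrightarrow> M * (cmod (z0 - z0) / \<rho>) * (1 / (1 - cmod (z0 - z0) / \<rho>))) (at z0)"
      using \<rho> by (intro tendsto_intros) auto
    then show "((\<lambda>z. M * (cmod (z - z0) / \<rho>) * (1 / (1 - cmod (z - z0) / \<rho>))) \<longlongrightarrow> 0) (at z0)"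
      by simp
  qed
  then show ?thesis using Lim_null by blast
qed

text \<open>Clearing the pole replaces integer exponents by an ordinary power series whose constant
  term is the leading coefficient.\<close>

lemma pole_of_order_iff:
  assumes n: "n \<noteq> 0"
  shows "pole_of_order f z0 n \<longleftrightarrow> (\<exists>r>0. \<exists>C. C 0 \<noteq> 0 \<and>
    (\<forall>z\<in>ball z0 r - {z0}. (\<lambda>k. (z - z0) ^ k *\<^sub>C C k) sums ((z - z0) ^ n *\<^sub>C f z)))"
proof -
  have "(\<lambda>k. (z - z0) powi (int k - int n) *\<^sub>C C k) sums f z
      \<longleftrightarrow> (\<lambda>k. (z - z0) ^ k *\<^sub>C C k) sums ((z - z0) ^ n *\<^sub>C f z)"
    if z: "z \<noteq> z0" for z and C :: "nat \<Rightarrow> 'a"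
  proof -
    define t where "t = z - z0"
    have t: "t \<noteq> 0" using z by (simp add: t_def)
    have pw: "t ^ n * t powi (int k - int n) = t ^ k" "inverse (t ^ n) * t ^ k = t powi (int k - int n)" for k
      using t by (simp_all add: power_int_diff field_simps)
    have lin: "bounded_linear (\<lambda>x :: 'a. c *\<^sub>C x)" for c
      by (rule bounded_bilinear.bounded_linear_right[OF bounded_bilinear_scaleC])
    show ?thesis
      using bounded_linear.sums[OF lin[of "t ^ n"], of "\<lambda>k. t powi (int k - int n) *\<^sub>C C k" "f z"]
        bounded_linear.sums[OF lin[of "inverse (t ^ n)"], of "\<lambda>k. t ^ k *\<^sub>C C k" "t ^ n *\<^sub>C f z"]
      using t by (auto simp: scaleC_scaleC pw t_def[symmetric])
  qed
  then show ?thesis using n unfolding pole_of_order_def by simp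
qed

lemma ind_invertible:
  fixes T :: "'a::complex_hilbert \<Rightarrow>\<^sub>L 'a"
  assumes "T \<in> bounded_ops" "invertible_op T"
  shows "ind T = 0"
proof -
  have left: "blinfun_apply (op_inverse T) (blinfun_apply T x) = x"
    and right: "blinfun_apply T (blinfun_apply (op_inverse T) x) = x" for x
    using op_inverse[OF assms(2)] by (metis blinfun_apply_blinfun_compose id_blinfun.rep_eq)+
  have "op_ker T = {0}"
    using left by (auto simp: op_ker_def) (metis blinfun.zero_right)
  moreover have "op_ran T = UNIV" unfolding op_ran_def using right by (metis surjI)
  moreover have "ortho_compl UNIV = {0 :: 'a}"
    by (auto simp: ortho_compl_def cinner_zero_right) (metis cinner_ext cinner_zero_right)
  ultimately show ?thesis using assms(1) by (simp add: ind_eq def_op_def)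
qed

section \<open>Finite rank perturbations in operator ideals\<close>

lemma finite_rank_opsI:
  "T \<in> bounded_ops \<Longrightarrow> finite B \<Longrightarrow> (\<And>x. blinfun_apply T x \<in> cspan B) \<Longrightarrow> T \<in> finite_rank_ops"
  by (auto simp: finite_rank_ops_def finite_cdim_def op_ran_def)

lemma finite_rank_opsE:
  assumes "T \<in> finite_rank_ops"
  obtains B where "T \<in> bounded_ops" "finite B" "orthonormal B" "\<And>x. blinfun_apply T x \<in> cspan B"
proof -
  have T: "T \<in> bounded_ops" "finite_cdim (op_ran T)" using assms by (auto simp: finite_rank_ops_def)
  obtain B where "finite B" "orthonormal B" "op_ran T = cspan B"
    using orthonormal_basis[OF subspace_op_ran[OF T(1)] T(2)] by metis
  with T(1) show ?thesis by (intro that) (auto simp: op_ran_def)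
qed

lemma finite_rank_ops_add:
  assumes "S \<in> finite_rank_ops" "T \<in> finite_rank_ops"
  shows "S + T \<in> finite_rank_ops"
proof -
  obtain B where B: "S \<in> bounded_ops" "finite B" "\<And>x. blinfun_apply S x \<in> cspan B"
    using finite_rank_opsE[OF assms(1)] by metis
  obtain C where C: "T \<in> bounded_ops" "finite C" "\<And>x. blinfun_apply T x \<in> cspan C"
    using finite_rank_opsE[OF assms(2)] by metis
  have "blinfun_apply (S + T) x \<in> cspan (B \<union> C)" for x
    unfolding blinfun.add_left
    using B(3)[of x] C(3)[of x] complex_vector.span_mono[of B "B \<union> C"]
      complex_vector.span_mono[of C "B \<union> C"]
    by (intro complex_vector.span_add) auto
  with B C show ?thesis by (intro finite_rank_opsI[of _ "B \<union> C"]) auto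
qed

lemma finite_rank_ops_uminus:
  assumes "T \<in> finite_rank_ops"
  shows "- T \<in> finite_rank_ops"
proof -
  obtain B where B: "T \<in> bounded_ops" "finite B" "\<And>x. blinfun_apply T x \<in> cspan B"
    using finite_rank_opsE[OF assms] by metis
  then show ?thesis
    by (intro finite_rank_opsI[of _ B])
      (auto simp: blinfun.minus_left intro: complex_vector.span_neg)
qed

lemma finite_rank_ops_compose:
  fixes S P :: "'a::complex_hilbert \<Rightarrow>\<^sub>L 'a"
  assumes S: "S \<in> bounded_ops" and P: "projection_onto P V" "finite_cdim V"
  shows "S o\<^sub>L P \<in> finite_rank_ops"
proof -
  have "op_ran (S o\<^sub>L P) = blinfun_apply S ` V"
    using P(1) by (auto simp: projection_onto_def op_ran_def)
  then show ?thesis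
    using finite_cdim_image[OF bounded_ops_linear[OF S] P(2)] S projection_ontoD(1)[OF P(1)]
    by (auto simp: finite_rank_ops_def)
qed

lemma compact_closure_subset:
  fixes K :: "'a::metric_space set"
  assumes "compact K" "S \<subseteq> K"
  shows "compact (closure S)"
proof -
  have "closure S \<subseteq> K" by (rule closure_minimal[OF assms(2) compact_imp_closed[OF assms(1)]])
  then have "K \<inter> closure S = closure S" by blast
  with compact_Int_closed[OF assms(1) closed_closure, of S] show ?thesis by simp
qed

lemma compact_ops_add:
  fixes S T :: "'a::complex_hilbert \<Rightarrow>\<^sub>L 'a"
  assumes "S \<in> compact_ops" "T \<in> compact_ops"
  shows "S + T \<in> compact_ops"
proof -
  let ?K = "{x + y | x y. x \<in> closure (blinfun_apply S ` cball 0 1) \<and>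
    y \<in> closure (blinfun_apply T ` cball 0 1)}"
  have K: "compact ?K"
    using assms by (intro compact_sums) (auto simp: compact_ops_def)
  have "blinfun_apply (S + T) ` cball 0 1 \<subseteq> ?K"
  proof
    fix y assume "y \<in> blinfun_apply (S + T) ` cball 0 1"
    then obtain x where "x \<in> cball 0 1" "y = blinfun_apply S x + blinfun_apply T x"
      by (auto simp: blinfun.add_left)
    then show "y \<in> ?K"
      using closure_subset[of "blinfun_apply S ` cball 0 1"]
        closure_subset[of "blinfun_apply T ` cball 0 1"] by blast
  qed
  then have "compact (closure (blinfun_apply (S + T) ` cball 0 1))"
    by (rule compact_closure_subset[OF K])
  with assms show ?thesis by (auto simp: compact_ops_def)
qed

text \<open>A finite sum of compact discs in the directions of \<open>B\<close>. The unit ball is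
  mapped into such a set by a finite rank operator, since coefficients in an orthonormal basis are
  bounded by the norm.\<close>

lemma compact_coefficient_sums:
  fixes B :: "'a::complex_normed_vector set"
  assumes "finite B"
  shows "compact {\<Sum>b\<in>B. c b *\<^sub>C b | c. \<forall>b\<in>B. cmod (c b) \<le> M}"
  using assms
proof (induction B)
  case (insert a B)
  have "compact ((\<lambda>c. c *\<^sub>C a) ` cball 0 M)"
    by (intro compact_continuous_image linear_continuous_on
        bounded_bilinear.bounded_linear_left[OF bounded_bilinear_scaleC]) simp
  then have *: "compact {x + y | x y. x \<in> (\<lambda>c. c *\<^sub>C a) ` cball 0 M \<and>
      y \<in> {\<Sum>b\<in>B. c b *\<^sub>C b | c. \<forall>b\<in>B. cmod (c b) \<le> M}}"
    by (rule compact_sums[OF _ insert.IH])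
  have "{\<Sum>b\<in>insert a B. c b *\<^sub>C b | c. \<forall>b\<in>insert a B. cmod (c b) \<le> M}
      = {x + y | x y. x \<in> (\<lambda>c. c *\<^sub>C a) ` cball 0 M \<and>
          y \<in> {\<Sum>b\<in>B. c b *\<^sub>C b | c. \<forall>b\<in>B. cmod (c b) \<le> M}}" (is "?L = ?R")
  proof
    show "?L \<subseteq> ?R"
    proof
      fix v assume "v \<in> ?L"
      then obtain c where "v = (\<Sum>b\<in>insert a B. c b *\<^sub>C b)" "\<forall>b\<in>insert a B. cmod (c b) \<le> M"
        by blast
      then have "v = c a *\<^sub>C a + (\<Sum>b\<in>B. c b *\<^sub>C b)" "c a \<in> cball 0 M" "\<forall>b\<in>B. cmod (c b) \<le> M"
        using insert.hyps by auto
      then show "v \<in> ?R" by blast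
    qed
    show "?R \<subseteq> ?L"
    proof
      fix v assume "v \<in> ?R"
      then obtain d c where v: "v = d *\<^sub>C a + (\<Sum>b\<in>B. c b *\<^sub>C b)" "cmod d \<le> M"
        "\<forall>b\<in>B. cmod (c b) \<le> M"
        by auto
      have "(\<Sum>b\<in>B. (c(a := d)) b *\<^sub>C b) = (\<Sum>b\<in>B. c b *\<^sub>C b)"
        using insert.hyps by (intro sum.cong) auto
      then have "v = (\<Sum>b\<in>insert a B. (c(a := d)) b *\<^sub>C b)"
        using v(1) insert.hyps by simp
      moreover have "\<forall>b\<in>insert a B. cmod ((c(a := d)) b) \<le> M" using v by simp
      ultimately show "v \<in> ?L" by blast
    qed
  qed
  with * show ?case by simp
qed simp

lemma finite_rank_ops_compact:
  fixes T :: "'a::complex_hilbert \<Rightarrow>\<^sub>L 'a"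
  assumes "T \<in> finite_rank_ops"
  shows "T \<in> compact_ops"
proof -
  obtain B where B: "T \<in> bounded_ops" "finite B" "orthonormal B" "\<And>x. blinfun_apply T x \<in> cspan B"
    using finite_rank_opsE[OF assms] by metis
  let ?K = "{\<Sum>b\<in>B. c b *\<^sub>C b | c. \<forall>b\<in>B. cmod (c b) \<le> norm T}"
  have K: "compact ?K" by (rule compact_coefficient_sums[OF B(2)])
  have "blinfun_apply T ` cball 0 1 \<subseteq> ?K"
  proof
    fix y assume "y \<in> blinfun_apply T ` cball 0 1"
    then obtain x where x: "y = blinfun_apply T x" "norm x \<le> 1" by auto
    have bd: "cmod (cinner b y) \<le> norm T" if b: "b \<in> B" for b
    proof -
      have "norm b = 1" by (rule orthonormal_norm[OF B(3) b])
      then have "cmod (cinner b y) \<le> norm y" using cmod_cinner_le[of b y] by simp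
      also have "\<dots> \<le> norm T * norm x" unfolding x(1) by (rule norm_blinfun)
      also have "\<dots> \<le> norm T" using x(2) by (simp add: mult_left_le)
      finally show ?thesis .
    qed
    have y: "y = (\<Sum>b\<in>B. cinner b y *\<^sub>C b)"
      using ortho_proj_id[OF B(3,2)] B(4)[of x] x(1) unfolding ortho_proj_def by simp
    show "y \<in> ?K"
      by (intro CollectI exI[of _ "\<lambda>b. cinner b y"] conjI ballI y bd)
  qed
  then have "compact (closure (blinfun_apply T ` cball 0 1))"
    by (rule compact_closure_subset[OF K])
  with B(1) show ?thesis by (simp add: compact_ops_def)
qed

section \<open>Singular values of compact operators\<close>

lemma compact_ops_bounded: "T \<in> compact_ops \<Longrightarrow> T \<in> bounded_ops"
  by (simp add: compact_ops_def)

lemma cinner_adj_compose: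
  "T \<in> bounded_ops \<Longrightarrow>
    cinner (blinfun_apply T x) (blinfun_apply T y) = cinner x (blinfun_apply (adj T o\<^sub>L T) y)"
  by (simp add: cinner_adj)

lemma cinner_adj_compose':
  "T \<in> bounded_ops \<Longrightarrow>
    cinner (blinfun_apply (adj T o\<^sub>L T) x) y = cinner x (blinfun_apply (adj T o\<^sub>L T) y)"
  by (metis cinner_adj_compose cinner_commute)

lemma norm_singular_space:
  assumes T: "T \<in> bounded_ops" and t: "0 \<le> t" and x: "x \<in> singular_space T t"
  shows "norm (blinfun_apply T x) = t * norm x"
proof -
  have "cinner (blinfun_apply T x) (blinfun_apply T x) = of_real (t\<^sup>2) * cinner x x"
    using x unfolding cinner_adj_compose[OF T] by (simp add: singular_space_def cinner_scaleR_right)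
  then have "complex_of_real ((norm (blinfun_apply T x))\<^sup>2) = of_real ((t * norm x)\<^sup>2)"
    by (simp add: cinner_self power_mult_distrib)
  then have "(norm (blinfun_apply T x))\<^sup>2 = (t * norm x)\<^sup>2" by (simp only: of_real_eq_iff)
  then show ?thesis using t by (simp add: power2_eq_iff_nonneg)
qed

lemma subspace_singular_space:
  assumes "T \<in> bounded_ops"
  shows "complex_vector.subspace (singular_space T s)"
  using assms bounded_ops_adj[OF assms]
  by (auto simp: complex_vector.subspace_def singular_space_def blinfun.add_right bounded_opsD
      scaleR_add_right scaleR_scaleC_commute)

lemma singular_space_orthogonal:
  assumes T: "T \<in> bounded_ops" and st: "s\<^sup>2 \<noteq> t\<^sup>2"
    and x: "x \<in> singular_space T s" and y: "y \<in> singular_space T t"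
  shows "cinner x y = 0"
proof -
  have "of_real (s\<^sup>2) * cinner x y = of_real (t\<^sup>2) * cinner x y"
    using cinner_adj_compose'[OF T, of x y] x y
    by (simp add: singular_space_def cinner_scaleR_left cinner_scaleR_right)
  moreover have "complex_of_real (s\<^sup>2) \<noteq> of_real (t\<^sup>2)" using st of_real_eq_iff by blast
  ultimately show ?thesis by (metis mult_cancel_right)
qed

lemma singular_values_le_norm:
  assumes "T \<in> bounded_ops" "t \<in> singular_values T"
  shows "t \<le> norm T"
proof -
  obtain x where x: "x \<in> singular_space T t" "x \<noteq> 0" "t > 0"
    using assms(2) by (auto simp: singular_values_def)
  then have "t * norm x \<le> norm T * norm x"
    using norm_singular_space[OF assms(1) _ x(1)] norm_blinfun[of T x] by simp
  then show ?thesis using x by simp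
qed

text \<open>Distinct orthonormal vectors are at distance \<open>sqrt 2\<close>, so their images are
  more than \<open>s\<close> apart. Two images in one ball of radius \<open>s / 2\<close> would be
  closer than that, so the size of a finite cover by such balls bounds
  \<open>card B\<close>.\<close>

lemma compact_op_card_bound:
  fixes T :: "'a::complex_hilbert \<Rightarrow>\<^sub>L 'a"
  assumes T: "T \<in> compact_ops" and s: "s > 0"
  obtains k where "\<And>B. orthonormal B \<Longrightarrow>
    (\<And>x. x \<in> cspan B \<Longrightarrow> s * norm x \<le> norm (blinfun_apply T x)) \<Longrightarrow> finite B \<and> card B \<le> k"
proof -
  have "compact (closure (blinfun_apply T ` cball 0 1))" using T by (simp add: compact_ops_def)
  then obtain K where K: "finite K" "closure (blinfun_apply T ` cball 0 1) \<subseteq> (\<Union>c\<in>K. ball c (s / 2))"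
    using s unfolding compact_eq_totally_bounded by (metis half_gt_zero)
  have "finite B \<and> card B \<le> card K"
    if B: "orthonormal B" "\<And>x. x \<in> cspan B \<Longrightarrow> s * norm x \<le> norm (blinfun_apply T x)" for B
  proof -
    have "\<exists>c\<in>K. dist c (blinfun_apply T b) < s / 2" if b: "b \<in> B" for b
    proof -
      have "norm b = 1" by (rule orthonormal_norm[OF B(1) b])
      then have "blinfun_apply T b \<in> closure (blinfun_apply T ` cball 0 1)"
        using closure_subset[of "blinfun_apply T ` cball 0 1"] by auto
      then have "blinfun_apply T b \<in> (\<Union>c\<in>K. ball c (s / 2))" using K(2) by blast
      then show ?thesis by simp
    qed
    then obtain c where c: "\<And>b. b \<in> B \<Longrightarrow> c b \<in> K \<and> dist (c b) (blinfun_apply T b) < s / 2"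
      by metis
    have "inj_on c B"
    proof (rule inj_onI, rule ccontr)
      fix a b assume ab: "a \<in> B" "b \<in> B" "c a = c b" "a \<noteq> b"
      have "dist (blinfun_apply T a) (blinfun_apply T b) < s"
        using c[OF ab(1)] c[OF ab(2)] ab(3) dist_triangle_half_r by metis
      then have "norm (blinfun_apply T (a - b)) < s" by (simp add: dist_norm blinfun.diff_right)
      moreover have "a - b \<in> cspan B"
        using ab by (intro complex_vector.span_diff complex_vector.span_base)
      ultimately have "s * norm (a - b) < s" using B(2) by fastforce
      then have "norm (a - b) < 1" using s by simp
      then have "(norm (a - b))\<^sup>2 < 1" by (simp add: power_less_one_iff)
      moreover have "cinner (a - b) (a - b) = 2"
        using B(1) ab by (simp add: cinner_diff_left cinner_diff_right orthonormal_def)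
      then have "complex_of_real ((norm (a - b))\<^sup>2) = of_real 2" by (simp add: cinner_self)
      then have "(norm (a - b))\<^sup>2 = 2" by (simp only: of_real_eq_iff)
      ultimately show False by simp
    qed
    then show ?thesis
      using K(1) c by (metis card_inj_on_le image_subsetI inj_on_finite)
  qed
  then show ?thesis by (rule that)
qed

text \<open>Needed before multiplicities mean anything, as \<open>cdim\<close> is \<open>0\<close>
  on infinite-dimensional spaces. On the eigenspace \<open>T\<close> multiplies norms by
  \<open>t\<close>, so the cardinality bound applies.\<close>

lemma finite_cdim_singular_space:
  fixes T :: "'a::complex_hilbert \<Rightarrow>\<^sub>L 'a"
  assumes T: "T \<in> compact_ops" and t: "t > 0"
  shows "finite_cdim (singular_space T t)"
proof -
  note Tb = compact_ops_bounded[OF T]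
  obtain k where k: "\<And>B. orthonormal B \<Longrightarrow>
      (\<And>x. x \<in> cspan B \<Longrightarrow> t * norm x \<le> norm (blinfun_apply T x)) \<Longrightarrow> finite B \<and> card B \<le> k"
    using compact_op_card_bound[OF T t] by blast
  have card: "card B \<le> k" if B: "B \<subseteq> singular_space T t" "orthonormal B" for B
  proof -
    have "cspan B \<subseteq> singular_space T t"
      by (rule complex_vector.span_minimal[OF B(1) subspace_singular_space[OF Tb]])
    then have "t * norm x \<le> norm (blinfun_apply T x)" if "x \<in> cspan B" for x
      using norm_singular_space[OF Tb, of t x] t that by auto
    then show ?thesis using k[OF B(2)] by blast
  qed
  obtain B where "finite B" "singular_space T t = cspan B"
  proof (rule orthonormal_basis_extend_bounded[of "singular_space T t" "{}" k])
    show "complex_vector.subspace (singular_space T t)" by (rule subspace_singular_space[OF Tb])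
  qed (use card in \<open>auto simp: orthonormal_def\<close>)
  then show ?thesis by (simp add: finite_cdim_cspan)
qed

text \<open>A spectral decomposition restricted to finitely many levels. Eigenspaces at different
  positive levels are orthogonal, so their bases combine and multiplicities become cardinalities. In
  such a basis the squared norm of \<open>T x\<close> is the sum of the squared coefficients
  weighted by the squared levels, whence the lower bound.\<close>

lemma singular_orthonormal_family:
  fixes T :: "'a::complex_hilbert \<Rightarrow>\<^sub>L 'a"
  assumes T: "T \<in> compact_ops"
  obtains B where
    "\<And>t. t > 0 \<Longrightarrow> cspan (B t) = singular_space T t"
    "\<And>G. finite G \<Longrightarrow> G \<subseteq> {0<..} \<Longrightarrow> finite (\<Union>t\<in>G. B t) \<and> orthonormal (\<Union>t\<in>G. B t)
      \<and> card (\<Union>t\<in>G. B t) = (\<Sum>t\<in>G. cdim (singular_space T t))"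
    "\<And>G s x. finite G \<Longrightarrow> G \<subseteq> {s..} \<Longrightarrow> 0 < s \<Longrightarrow> x \<in> cspan (\<Union>t\<in>G. B t) \<Longrightarrow>
      s * norm x \<le> norm (blinfun_apply T x)"
proof -
  note Tb = compact_ops_bounded[OF T]
  have "\<forall>t. \<exists>B. t > 0 \<longrightarrow> finite B \<and> orthonormal B \<and> singular_space T t = cspan B
      \<and> card B = cdim (singular_space T t)"
    using orthonormal_basis[OF subspace_singular_space[OF Tb] finite_cdim_singular_space[OF T]]
    by metis
  then obtain B where B: "\<And>t. t > 0 \<Longrightarrow> finite (B t)" "\<And>t. t > 0 \<Longrightarrow> orthonormal (B t)"
      "\<And>t. t > 0 \<Longrightarrow> singular_space T t = cspan (B t)"
      "\<And>t. t > 0 \<Longrightarrow> card (B t) = cdim (singular_space T t)"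
    by metis
  have Bsub: "b \<in> singular_space T t" if "t > 0" "b \<in> B t" for t b
    using B(3)[OF that(1)] that(2) complex_vector.span_base by blast
  have orth: "cinner x y = 0" if "t > 0" "u > 0" "t \<noteq> u" "x \<in> B t" "y \<in> B u" for t u x y
    using that Bsub by (intro singular_space_orthogonal[OF Tb, of t u]) (auto simp: power2_eq_iff_nonneg)
  have B1: "cinner x x = 1" if "t > 0" "x \<in> B t" for t x
    using B(2)[OF that(1)] that(2) by (simp add: orthonormal_def)
  have G: "finite (\<Union>t\<in>G. B t) \<and> orthonormal (\<Union>t\<in>G. B t)
      \<and> card (\<Union>t\<in>G. B t) = (\<Sum>t\<in>G. cdim (singular_space T t))"
    if G: "finite G" "G \<subseteq> {0<..}" for G
  proof (intro conjI)
    show "finite (\<Union>t\<in>G. B t)" using G B(1) by auto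
    show "orthonormal (\<Union>t\<in>G. B t)"
      unfolding orthonormal_def
    proof (intro ballI)
      fix x y assume "x \<in> (\<Union>t\<in>G. B t)" "y \<in> (\<Union>t\<in>G. B t)"
      then obtain t u where tu: "t \<in> G" "u \<in> G" "x \<in> B t" "y \<in> B u" by blast
      have pos: "t > 0" "u > 0" using G tu by auto
      show "cinner x y = (if x = y then 1 else 0)"
      proof (cases "t = u")
        case True
        then show ?thesis using B(2)[OF pos(1)] tu by (simp add: orthonormal_def)
      next
        case False
        then have "cinner x y = 0" using orth pos tu by blast
        moreover from this have "x \<noteq> y" using B1[OF pos(1) tu(3)] by auto
        ultimately show ?thesis by simp
      qed
    qed
    have "B t \<inter> B u = {}" if "t \<in> G" "u \<in> G" "t \<noteq> u" for t u
    proof (rule ccontr)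
      assume "B t \<inter> B u \<noteq> {}"
      then obtain x where x: "x \<in> B t" "x \<in> B u" by blast
      have "t > 0" "u > 0" using that G by auto
      then show False using orth[OF _ _ that(3) x] B1[OF _ x(1)] by simp
    qed
    then have "card (\<Union>t\<in>G. B t) = (\<Sum>t\<in>G. card (B t))"
      using G B(1) by (intro card_UN_disjoint) auto
    also have "\<dots> = (\<Sum>t\<in>G. cdim (singular_space T t))"
      using G B(4) by (intro sum.cong) auto
    finally show "card (\<Union>t\<in>G. B t) = (\<Sum>t\<in>G. cdim (singular_space T t))" .
  qed
  have low: "s * norm x \<le> norm (blinfun_apply T x)"
    if G': "finite G" "G \<subseteq> {s..}" "0 < s" "x \<in> cspan (\<Union>t\<in>G. B t)" for G s x
  proof -
    let ?U = "\<Union>t\<in>G. B t"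
    have pos: "t > 0" if "t \<in> G" for t using G' that by force
    then have U: "finite ?U" "orthonormal ?U" using G[of G] G' by auto
    define c where "c b = cinner b x" for b
    have x: "x = (\<Sum>b\<in>?U. c b *\<^sub>C b)"
      using ortho_proj_id[OF U(2,1) G'(4)] by (simp add: ortho_proj_def c_def)
    have "\<exists>\<tau>. s \<le> \<tau> \<and> blinfun_apply (adj T o\<^sub>L T) b = of_real (\<tau>\<^sup>2) *\<^sub>C b" if b: "b \<in> ?U" for b
    proof -
      obtain t where t: "t \<in> G" "b \<in> B t" using b by blast
      then have "blinfun_apply (adj T o\<^sub>L T) b = of_real (t\<^sup>2) *\<^sub>C b"
        using Bsub[OF pos] unfolding singular_space_def scaleC_of_real by blast
      with t G' show ?thesis by blast
    qed
    then obtain \<tau> where \<tau>: "\<And>b. b \<in> ?U \<Longrightarrow> s \<le> \<tau> b"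
      "\<And>b. b \<in> ?U \<Longrightarrow> blinfun_apply (adj T o\<^sub>L T) b = of_real ((\<tau> b)\<^sup>2) *\<^sub>C b"
      by metis
    have cc: "cinner (c b *\<^sub>C b) x = of_real ((cmod (c b))\<^sup>2)" for b
      by (simp add: cinner_scaleC_left c_def mult.commute complex_norm_square[symmetric])
    have TT: "adj T o\<^sub>L T \<in> bounded_ops" using Tb bounded_ops_adj[OF Tb] by blast
    have "cinner (blinfun_apply T x) (blinfun_apply T x)
        = cinner (blinfun_apply (adj T o\<^sub>L T) (\<Sum>b\<in>?U. c b *\<^sub>C b)) x"
      unfolding x[symmetric] cinner_adj_compose[OF Tb] cinner_adj_compose'[OF Tb] ..
    also have "blinfun_apply (adj T o\<^sub>L T) (\<Sum>b\<in>?U. c b *\<^sub>C b)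
        = (\<Sum>b\<in>?U. of_real ((\<tau> b)\<^sup>2) *\<^sub>C (c b *\<^sub>C b))"
      unfolding blinfun.sum_right
      by (intro sum.cong refl)
        (simp only: bounded_opsD[OF TT] \<tau>(2) scaleC_scaleC mult.commute)
    also have "cinner \<dots> x = (\<Sum>b\<in>?U. of_real ((\<tau> b)\<^sup>2 * (cmod (c b))\<^sup>2))"
      unfolding cinner_sum_left
      by (intro sum.cong refl)
        (simp only: cinner_scaleC_left[of "of_real _"] cc complex_cnj_complex_of_real of_real_mult)
    finally have "complex_of_real ((norm (blinfun_apply T x))\<^sup>2)
        = of_real (\<Sum>b\<in>?U. (\<tau> b)\<^sup>2 * (cmod (c b))\<^sup>2)"
      by (simp add: cinner_self)
    then have e1: "(norm (blinfun_apply T x))\<^sup>2 = (\<Sum>b\<in>?U. (\<tau> b)\<^sup>2 * (cmod (c b))\<^sup>2)"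
      by (simp only: of_real_eq_iff)
    have "cinner x x = (\<Sum>b\<in>?U. cinner (c b *\<^sub>C b) x)"
      by (subst (1) x) (simp only: cinner_sum_left)
    then have "complex_of_real ((norm x)\<^sup>2) = of_real (\<Sum>b\<in>?U. (cmod (c b))\<^sup>2)"
      unfolding cc by (simp add: cinner_self)
    then have e2: "(norm x)\<^sup>2 = (\<Sum>b\<in>?U. (cmod (c b))\<^sup>2)"
      by (simp only: of_real_eq_iff)
    have "(s * norm x)\<^sup>2 \<le> (norm (blinfun_apply T x))\<^sup>2"
      unfolding power_mult_distrib e1 e2 sum_distrib_left
      using \<tau>(1) G'(3) by (intro sum_mono mult_right_mono power_mono) auto
    then show ?thesis by (rule power2_le_imp_le) simp
  qed
  show ?thesis using that[of B] B(3) G low by metis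
qed

text \<open>Each singular value contributes at least one basis vector, and \<open>T\<close> is
  bounded below by \<open>s\<close> on their joint span.\<close>

lemma finite_singular_values_ge:
  fixes T :: "'a::complex_hilbert \<Rightarrow>\<^sub>L 'a"
  assumes T: "T \<in> compact_ops" and s: "s > 0"
  shows "finite {t \<in> singular_values T. s \<le> t}"
proof -
  obtain B where B: "\<And>G. finite G \<Longrightarrow> G \<subseteq> {0<..} \<Longrightarrow> finite (\<Union>t\<in>G. B t) \<and> orthonormal (\<Union>t\<in>G. B t)
      \<and> card (\<Union>t\<in>G. B t) = (\<Sum>t\<in>G. cdim (singular_space T t))"
    "\<And>G s x. finite G \<Longrightarrow> G \<subseteq> {s..} \<Longrightarrow> 0 < s \<Longrightarrow> x \<in> cspan (\<Union>t\<in>G. B t) \<Longrightarrow>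
      s * norm x \<le> norm (blinfun_apply T x)"
    using singular_orthonormal_family[OF T] by metis
  obtain k where k: "\<And>B. orthonormal B \<Longrightarrow>
      (\<And>x. x \<in> cspan B \<Longrightarrow> s * norm x \<le> norm (blinfun_apply T x)) \<Longrightarrow> finite B \<and> card B \<le> k"
    using compact_op_card_bound[OF T s] by blast
  have "card G \<le> k" if G: "G \<subseteq> {t \<in> singular_values T. s \<le> t}" "finite G" for G
  proof -
    have Gs: "G \<subseteq> {s..}" "G \<subseteq> {0<..}" using G s by auto
    have "card G = (\<Sum>t\<in>G. 1)" by simp
    also have "\<dots> \<le> (\<Sum>t\<in>G. cdim (singular_space T t))"
    proof (rule sum_mono)
      fix t assume t: "t \<in> G"
      then obtain x where x: "x \<in> singular_space T t" "x \<noteq> 0" "t > 0"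
        using G Gs by (auto simp: singular_values_def)
      obtain C where C: "finite C" "singular_space T t = cspan C" "card C = cdim (singular_space T t)"
        using orthonormal_basis[OF subspace_singular_space[OF compact_ops_bounded[OF T]]
            finite_cdim_singular_space[OF T x(3)]] by metis
      with x have "C \<noteq> {}" by auto
      then show "1 \<le> cdim (singular_space T t)" using C by (metis One_nat_def Suc_leI card_gt_0_iff)
    qed
    also have "\<dots> = card (\<Union>t\<in>G. B t)" using B(1)[OF G(2) Gs(2)] by simp
    also have "\<dots> \<le> k" using k B G(2) Gs s by blast
    finally show ?thesis .
  qed
  then show ?thesis using finite_if_finite_subsets_card_bdd by blast
qed

text \<open>Maximise the norm of \<open>T x\<close> over the unit ball of \<open>M\<close>.
  Near-maximisers are almost eigenvectors of \<open>T* T\<close>, and compactness makes a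
  subsequence converge to a true one. Invariance of \<open>M\<close> lets the maximal value
  \<open>\<sigma>\<close> also bound \<open>T\<close> at \<open>T* T x\<close>.\<close>

lemma singular_vector_in_invariant_subspace:
  fixes T :: "'a::complex_hilbert \<Rightarrow>\<^sub>L 'a"
  assumes T: "T \<in> compact_ops" and M: "closed M" "complex_vector.subspace M"
    and inv: "\<And>x. x \<in> M \<Longrightarrow> blinfun_apply (adj T o\<^sub>L T) x \<in> M"
    and s: "s > 0" and x0: "x0 \<in> M" "x0 \<noteq> 0" "s * norm x0 \<le> norm (blinfun_apply T x0)"
  obtains t x where "s \<le> t" "x \<in> M" "x \<noteq> 0" "x \<in> singular_space T t"
proof -
  note Tb = compact_ops_bounded[OF T]
  have MR: "r *\<^sub>R x \<in> M" if "x \<in> M" for r x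
    using complex_vector.subspace_scale[OF M(2) that, of "of_real r"] by (simp add: scaleC_of_real)
  define D where "D = (\<lambda>x. norm (blinfun_apply T x)) ` (M \<inter> cball 0 1)"
  have D0: "D \<noteq> {}" using complex_vector.subspace_0[OF M(2)] by (auto simp: D_def)
  have bdd: "bdd_above D"
  proof (rule bdd_aboveI)
    fix d assume "d \<in> D"
    then obtain x where x: "norm x \<le> 1" "d = norm (blinfun_apply T x)" by (auto simp: D_def)
    have "d \<le> norm T * norm x" unfolding x(2) by (rule norm_blinfun)
    also have "\<dots> \<le> norm T" using x(1) by (simp add: mult_left_le)
    finally show "d \<le> norm T" .
  qed
  define \<sigma> where "\<sigma> = Sup D"
  have le1: "norm (blinfun_apply T x) \<le> \<sigma>" if "x \<in> M" "norm x \<le> 1" for x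
    unfolding \<sigma>_def by (rule cSup_upper[OF _ bdd]) (use that in \<open>auto simp: D_def\<close>)
  have le: "norm (blinfun_apply T x) \<le> \<sigma> * norm x" if x: "x \<in> M" for x
  proof (cases "x = 0")
    case False
    have "norm (blinfun_apply T (inverse (norm x) *\<^sub>R x)) \<le> \<sigma>"
      by (rule le1[OF MR[OF x]]) (use False in simp)
    then show ?thesis using False by (simp add: blinfun.scaleR_right field_simps)
  qed simp
  have "s * norm x0 \<le> \<sigma> * norm x0" using x0(3) le[OF x0(1)] by linarith
  then have s\<sigma>: "s \<le> \<sigma>" using x0(2) by simp
  have \<sigma>: "\<sigma> > 0" using s s\<sigma> by simp
  have "\<exists>x. x \<in> M \<and> norm x \<le> 1 \<and> \<sigma> - 1 / real (Suc n) < norm (blinfun_apply T x)" for n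
    using less_cSupD[OF D0, of "\<sigma> - 1 / real (Suc n)"] by (auto simp: \<sigma>_def D_def)
  then obtain X where X: "\<And>n. X n \<in> M" "\<And>n. norm (X n) \<le> 1"
    "\<And>n. \<sigma> - 1 / real (Suc n) < norm (blinfun_apply T (X n))"
    by metis
  have normlim: "(\<lambda>n. norm (blinfun_apply T (X n))) \<longlonglongrightarrow> \<sigma>"
  proof (rule tendsto_sandwich[OF _ _ _ tendsto_const])
    show "\<forall>\<^sub>F n in sequentially. \<sigma> - 1 / real (Suc n) \<le> norm (blinfun_apply T (X n))"
      using less_imp_le[OF X(3)] by (intro always_eventually allI)
    show "\<forall>\<^sub>F n in sequentially. norm (blinfun_apply T (X n)) \<le> \<sigma>"
      using le1[OF X(1,2)] by simp
    have "(\<lambda>n. \<sigma> - 1 / real (Suc n)) \<longlonglongrightarrow> \<sigma> - 0"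
      by (intro tendsto_intros LIMSEQ_Suc lim_const_over_n)
    then show "(\<lambda>n. \<sigma> - 1 / real (Suc n)) \<longlonglongrightarrow> \<sigma>" by simp
  qed
  \<comment> \<open>Expand the square. The bound by \<open>\<sigma>\<close> applied at
    \<open>?y\<close> gives \<open>norm ?y\<close> \<le> \<open>\<sigma> * norm (T x)\<close>, while
    the cross term is \<open>norm (T x)^2\<close>; both sides of the final estimate vanish as
    \<open>norm (T x)\<close> tends to \<open>\<sigma>\<close>.\<close>
  have defect: "(norm (blinfun_apply (adj T o\<^sub>L T) x - \<sigma>\<^sup>2 *\<^sub>R x))\<^sup>2
      \<le> \<sigma>\<^sup>2 * (\<sigma>\<^sup>2 - (norm (blinfun_apply T x))\<^sup>2)" if x: "x \<in> M" "norm x \<le> 1" for x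
  proof -
    let ?y = "blinfun_apply (adj T o\<^sub>L T) x"
    have "cinner ?y x = of_real ((norm (blinfun_apply T x))\<^sup>2)"
      unfolding cinner_adj_compose'[OF Tb] cinner_adj_compose[OF Tb, symmetric] by (rule cinner_self)
    then have c1: "inner ?y x = (norm (blinfun_apply T x))\<^sup>2"
      by (simp only: Re_cinner[symmetric] Re_complex_of_real)
    have "cinner (blinfun_apply T ?y) (blinfun_apply T x) = of_real ((norm ?y)\<^sup>2)"
      unfolding cinner_adj_compose[OF Tb] by (rule cinner_self)
    then have "(norm ?y)\<^sup>2 = inner (blinfun_apply T ?y) (blinfun_apply T x)"
      by (simp only: Re_cinner[symmetric] Re_complex_of_real)
    also have "\<dots> \<le> norm (blinfun_apply T ?y) * norm (blinfun_apply T x)"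
      by (rule norm_cauchy_schwarz)
    also have "\<dots> \<le> (\<sigma> * norm ?y) * norm (blinfun_apply T x)"
      by (intro mult_right_mono le inv x) simp
    finally have "norm ?y * norm ?y \<le> norm ?y * (\<sigma> * norm (blinfun_apply T x))"
      by (simp add: power2_eq_square mult_ac)
    then have "norm ?y \<le> \<sigma> * norm (blinfun_apply T x)"
      using \<sigma> by (cases "norm ?y = 0") (simp_all add: mult_le_cancel_left)
    then have c2: "(norm ?y)\<^sup>2 \<le> \<sigma>\<^sup>2 * (norm (blinfun_apply T x))\<^sup>2"
      unfolding power_mult_distrib[symmetric] by (rule power_mono) simp
    have c3: "\<sigma>\<^sup>2 * \<sigma>\<^sup>2 * (norm x)\<^sup>2 \<le> \<sigma>\<^sup>2 * \<sigma>\<^sup>2 * 1"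
      using x(2) by (intro mult_left_mono) (simp_all add: power_le_one)
    have "(norm (?y - \<sigma>\<^sup>2 *\<^sub>R x))\<^sup>2 = (norm ?y)\<^sup>2 - 2 * \<sigma>\<^sup>2 * inner ?y x + \<sigma>\<^sup>2 * \<sigma>\<^sup>2 * (norm x)\<^sup>2"
      by (simp add: power2_norm_eq_inner inner_diff_left inner_diff_right inner_commute algebra_simps)
    then show ?thesis using c2 c3 unfolding c1 by (simp add: algebra_simps)
  qed
  have "\<forall>n. blinfun_apply T (X n) \<in> closure (blinfun_apply T ` cball 0 1)"
    using X(2) closure_subset[of "blinfun_apply T ` cball 0 1"] by auto
  then obtain y r where r: "strict_mono r" "((\<lambda>n. blinfun_apply T (X n)) \<circ> r) \<longlonglongrightarrow> y"
    using T unfolding compact_ops_def mem_Collect_eq compact_def by metis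
  define Y where "Y = X \<circ> r"
  have TY: "(\<lambda>n. blinfun_apply T (Y n)) \<longlonglongrightarrow> y" using r(2) by (simp add: Y_def o_def)
  have nY: "(\<lambda>n. norm (blinfun_apply T (Y n))) \<longlonglongrightarrow> \<sigma>"
    using LIMSEQ_subseq_LIMSEQ[OF normlim r(1)] by (simp add: Y_def o_def)
  have TTY: "(\<lambda>n. blinfun_apply (adj T o\<^sub>L T) (Y n)) \<longlonglongrightarrow> blinfun_apply (adj T) y"
    using blinfun.tendsto[OF tendsto_const TY, of "adj T"] by simp
  have "(\<lambda>n. (norm (blinfun_apply (adj T o\<^sub>L T) (Y n) - \<sigma>\<^sup>2 *\<^sub>R Y n))\<^sup>2) \<longlonglongrightarrow> 0"
  proof (rule tendsto_sandwich[OF _ _ tendsto_const])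
    have "(\<lambda>n. \<sigma>\<^sup>2 * (\<sigma>\<^sup>2 - (norm (blinfun_apply T (Y n)))\<^sup>2)) \<longlonglongrightarrow> \<sigma>\<^sup>2 * (\<sigma>\<^sup>2 - \<sigma>\<^sup>2)"
      by (intro tendsto_intros nY)
    then show "(\<lambda>n. \<sigma>\<^sup>2 * (\<sigma>\<^sup>2 - (norm (blinfun_apply T (Y n)))\<^sup>2)) \<longlonglongrightarrow> 0" by simp
    show "\<forall>\<^sub>F n in sequentially. (norm (blinfun_apply (adj T o\<^sub>L T) (Y n) - \<sigma>\<^sup>2 *\<^sub>R Y n))\<^sup>2
        \<le> \<sigma>\<^sup>2 * (\<sigma>\<^sup>2 - (norm (blinfun_apply T (Y n)))\<^sup>2)"
      using defect[OF X(1,2)] by (simp add: Y_def)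
  qed simp
  from tendsto_real_sqrt[OF this]
  have "(\<lambda>n. norm (blinfun_apply (adj T o\<^sub>L T) (Y n) - \<sigma>\<^sup>2 *\<^sub>R Y n)) \<longlonglongrightarrow> 0"
    by (simp del: blinfun_apply_blinfun_compose)
  then have "(\<lambda>n. blinfun_apply (adj T o\<^sub>L T) (Y n) - \<sigma>\<^sup>2 *\<^sub>R Y n) \<longlonglongrightarrow> 0"
    by (rule tendsto_norm_zero_cancel)
  \<comment> \<open>Compactness makes only the images under \<open>T\<close> converge. Since the
    defect vanishes and \<open>\<sigma>\<close> is positive, the vectors \<open>Y n\<close>
    themselves converge.\<close>
  from tendsto_scaleR[OF tendsto_const tendsto_diff[OF TTY this], of "inverse (\<sigma>\<^sup>2)"]
  have Ylim: "Y \<longlonglongrightarrow> inverse (\<sigma>\<^sup>2) *\<^sub>R blinfun_apply (adj T) y" using \<sigma> by simp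
  define x where "x = inverse (\<sigma>\<^sup>2) *\<^sub>R blinfun_apply (adj T) y"
  have Yx: "Y \<longlonglongrightarrow> x" using Ylim by (simp add: x_def)
  have "x \<in> M"
    by (rule closed_sequentially[OF M(1) _ Yx]) (use X in \<open>simp add: Y_def\<close>)
  moreover have "norm (blinfun_apply T x) = \<sigma>"
    using LIMSEQ_unique[OF tendsto_norm[OF blinfun.tendsto[OF tendsto_const Yx, of T]] nY] .
  then have "x \<noteq> 0" using \<sigma> by auto
  moreover have "blinfun_apply (adj T o\<^sub>L T) x = blinfun_apply (adj T) y"
    using LIMSEQ_unique[OF blinfun.tendsto[OF tendsto_const Yx, of "adj T o\<^sub>L T"] TTY] .
  then have "x \<in> singular_space T \<sigma>"
    using \<sigma> by (simp add: singular_space_def x_def)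
  ultimately show ?thesis using that s\<sigma> by blast
qed

section \<open>Counting singular values under finite rank perturbation\<close>

text \<open>A special case of Weyl's inequality for singular values.\<close>

lemma singular_count_finite_rank:
  fixes S T :: "'a::complex_hilbert \<Rightarrow>\<^sub>L 'a"
  assumes S: "S \<in> compact_ops" and T: "T \<in> compact_ops"
    and R: "finite R" "\<And>x. blinfun_apply (T - S) x \<in> cspan R"
    and s: "s > 0" and G: "finite G" "G \<subseteq> {s..}"
  shows "(\<Sum>t\<in>G. cdim (singular_space T t))
    \<le> (\<Sum>t | t \<in> singular_values S \<and> s \<le> t. cdim (singular_space S t)) + card R"
proof (rule ccontr)
  note Sb = compact_ops_bounded[OF S] and Tb = compact_ops_bounded[OF T]
  let ?H = "{t. t \<in> singular_values S \<and> s \<le> t}"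
  assume neg: "\<not> ?thesis"
  obtain B where B: "\<And>t. t > 0 \<Longrightarrow> cspan (B t) = singular_space S t"
    "\<And>G. finite G \<Longrightarrow> G \<subseteq> {0<..} \<Longrightarrow> finite (\<Union>t\<in>G. B t) \<and> orthonormal (\<Union>t\<in>G. B t)
      \<and> card (\<Union>t\<in>G. B t) = (\<Sum>t\<in>G. cdim (singular_space S t))"
    using singular_orthonormal_family[OF S] by metis
  obtain C where C:
    "\<And>G. finite G \<Longrightarrow> G \<subseteq> {0<..} \<Longrightarrow> finite (\<Union>t\<in>G. C t) \<and> orthonormal (\<Union>t\<in>G. C t)
      \<and> card (\<Union>t\<in>G. C t) = (\<Sum>t\<in>G. cdim (singular_space T t))"
    "\<And>G s x. finite G \<Longrightarrow> G \<subseteq> {s..} \<Longrightarrow> 0 < s \<Longrightarrow> x \<in> cspan (\<Union>t\<in>G. C t) \<Longrightarrow>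
      s * norm x \<le> norm (blinfun_apply T x)"
    using singular_orthonormal_family[OF T] by metis
  define U where "U = (\<Union>t\<in>?H. B t)"
  define W where "W = (\<Union>t\<in>G. C t)"
  have H: "finite ?H" "?H \<subseteq> {0<..}" using finite_singular_values_ge[OF S s] s by auto
  have U: "finite U" "orthonormal U" "card U = (\<Sum>t\<in>?H. cdim (singular_space S t))"
    using B(2)[OF H] by (auto simp: U_def)
  have "G \<subseteq> {0<..}" using G s by auto
  then have W: "finite W" "orthonormal W" "card W = (\<Sum>t\<in>G. cdim (singular_space T t))"
    using C(1)[OF G(1)] by (auto simp: W_def)
  let ?F = "blinfun_apply (T - S)"
  have F: "Vector_Spaces.linear scaleC scaleC ?F" using Sb Tb by (intro bounded_ops_linear) blast
  define V where "V = cspan W \<inter> {x. ?F x = 0}"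
  have V: "complex_vector.subspace V" "finite_cdim V"
    unfolding V_def
    by (intro complex_vector.subspace_inter complex_vector.subspace_span
        complex_vector_pair.linear_subspace_kernel[OF F])
      (rule finite_cdim_subset[OF finite_cdim_cspan[OF W(1)]], simp)
  \<comment> \<open>Agreement of \<open>T\<close> and \<open>S\<close> costs at most
    \<open>card R\<close> dimensions of \<open>cspan W\<close>, orthogonality to \<open>U\<close> at
    most \<open>card U\<close>. Under the negated claim a nonzero vector remains.\<close>
  have "card W = cdim V + cdim (?F ` cspan W)"
    using rank_nullity[OF F complex_vector.subspace_span finite_cdim_cspan[OF W(1)]]
    unfolding V_def cdim_cspan_orthonormal[OF W(2)] .
  moreover have "cdim (?F ` cspan W) \<le> card R"
    using R by (intro complex_vector.dim_le_card) auto
  moreover have "cdim V = cdim (V \<inter> {x. ortho_proj U x = 0}) + cdim (ortho_proj U ` V)"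
    by (rule rank_nullity[OF linear_ortho_proj V])
  moreover have "cdim (ortho_proj U ` V) \<le> card U"
    using U ortho_proj_in_span by (intro complex_vector.dim_le_card) auto
  ultimately have "cdim (V \<inter> {x. ortho_proj U x = 0}) > 0"
    using neg U(3) W(3) by linarith
  then have "\<not> V \<inter> {x. ortho_proj U x = 0} \<subseteq> cspan {}"
    using complex_vector.dim_le_card[of "V \<inter> {x. ortho_proj U x = 0}" "{}"] by auto
  then obtain x where x: "x \<noteq> 0" "x \<in> cspan W" "?F x = 0" "ortho_proj U x = 0"
    by (auto simp: V_def)
  have TS: "blinfun_apply T x = blinfun_apply S x" using x(3) by (simp add: blinfun.diff_left)
  have sx: "s * norm x \<le> norm (blinfun_apply S x)"
    using C(2)[OF G s x(2)[unfolded W_def]] unfolding TS .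
  \<comment> \<open>\<open>U\<close> spans all eigenspaces of \<open>S* S\<close> at levels from
    \<open>s\<close> on. Its complement is closed and invariant and contains \<open>x\<close>, where
    \<open>S\<close> stretches by at least \<open>s\<close>; so it would contain a further such
    eigenvector.\<close>
  have "closed (ortho_compl U)"
  proof -
    have "ortho_compl U = ortho_proj U -` {0}" using ortho_proj_eq_0_iff[OF U(2,1)] by auto
    moreover have "closed (ortho_proj U -` {0})"
      by (intro continuous_closed_vimage linear_continuous_at bounded_linear_ortho_proj) simp
    ultimately show ?thesis by simp
  qed
  moreover have "blinfun_apply (adj S o\<^sub>L S) y \<in> ortho_compl U" if y: "y \<in> ortho_compl U" for y
    unfolding ortho_compl_def
  proof (intro CollectI ballI)
    fix b assume b: "b \<in> U"
    then obtain t where t: "t \<in> ?H" "b \<in> B t" by (auto simp: U_def)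
    then have "b \<in> singular_space S t" using B(1)[of t] H(2) complex_vector.span_base by blast
    then have "blinfun_apply (adj S o\<^sub>L S) b = t\<^sup>2 *\<^sub>R b" by (simp add: singular_space_def)
    then have "cinner b (blinfun_apply (adj S o\<^sub>L S) y) = of_real (t\<^sup>2) * cinner b y"
      using cinner_adj_compose'[OF Sb, of b y] by (simp add: cinner_scaleR_left)
    then show "cinner b (blinfun_apply (adj S o\<^sub>L S) y) = 0" using y b by (simp add: ortho_compl_def)
  qed
  moreover have "x \<in> ortho_compl U" using x(4) ortho_proj_eq_0_iff[OF U(2,1)] by simp
  ultimately obtain t y where ty: "s \<le> t" "y \<in> ortho_compl U" "y \<noteq> 0" "y \<in> singular_space S t"
    using singular_vector_in_invariant_subspace[OF S _ subspace_ortho_compl _ s _ x(1) sx] by metis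
  have "t \<in> ?H" using ty s by (auto simp: singular_values_def)
  then have "B t \<subseteq> U" by (auto simp: U_def)
  then have "y \<in> cspan U"
    using B(1)[of t] ty s complex_vector.span_mono[of "B t" U] by auto
  moreover have "y \<in> ortho_compl (cspan U)" using ty(2) by (simp add: ortho_compl_cspan)
  ultimately have "cinner y y = 0" by (simp add: ortho_compl_def)
  with ty(3) show False by (simp add: cinner_self)
qed

section \<open>From counting functions to weighted sums\<close>

text \<open>
  Discrete layer cake: \<open>f\<close> restricted to a finite set is a sum of nonnegative step functions, which
  turns an estimate for counting functions into one for weighted sums.
\<close>

lemma layer_cake:
  fixes f :: "'a::linorder \<Rightarrow> real"
  assumes "finite G" and f: "\<And>x y. x \<in> P \<Longrightarrow> y \<in> P \<Longrightarrow> x \<le> y \<Longrightarrow> f x \<le> f y"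
    and f0: "\<And>x. x \<in> P \<Longrightarrow> 0 \<le> f x" and "G \<subseteq> P"
  shows "\<exists>g. (\<forall>u\<in>G. 0 \<le> g u) \<and> (\<forall>t\<in>G. (\<Sum>u | u \<in> G \<and> u \<le> t. g u) = f t)
    \<and> (\<forall>t\<in>P. (\<Sum>u | u \<in> G \<and> u \<le> t. g u) \<le> f t)"
  using assms(1,4)
proof (induction G rule: finite_linorder_max_induct)
  case empty
  then show ?case using f0 by simp
next
  case (insert b G)
  then obtain g where g: "\<forall>u\<in>G. 0 \<le> g u" "\<forall>t\<in>G. (\<Sum>u | u \<in> G \<and> u \<le> t. g u) = f t"
    "\<forall>t\<in>P. (\<Sum>u | u \<in> G \<and> u \<le> t. g u) \<le> f t"
    by auto
  have bP: "b \<in> P" using insert.prems by simp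
  have bG: "b \<notin> G" using insert.hyps by auto
  \<comment> \<open>The new top point receives the missing increment. It is nonnegative by the third
    claim at \<open>b\<close>, which is why that claim ranges over \<open>P\<close> and not only
    over \<open>G\<close>.\<close>
  define h where "h = g(b := f b - sum g G)"
  have all: "{u. u \<in> G \<and> u \<le> b} = G" using insert.hyps by (auto intro: less_imp_le)
  have below: "(\<Sum>u | u \<in> insert b G \<and> u \<le> t. h u) = (\<Sum>u | u \<in> G \<and> u \<le> t. g u)" if "t < b" for t
    using that bG by (intro sum.cong) (auto simp: h_def)
  have above: "(\<Sum>u | u \<in> insert b G \<and> u \<le> t. h u) = f b" if t: "b \<le> t" for t
  proof -
    have "{u. u \<in> insert b G \<and> u \<le> t} = insert b G" using t insert.hyps by force
    moreover have "sum h G = sum g G" using bG by (intro sum.cong) (auto simp: h_def)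
    ultimately show ?thesis using insert.hyps(1) bG by (simp add: h_def)
  qed
  have "\<forall>u\<in>insert b G. 0 \<le> h u"
    using g(1) g(3)[rule_format, OF bP] unfolding all by (auto simp: h_def)
  moreover have "(\<Sum>u | u \<in> insert b G \<and> u \<le> t. h u) = f t" if "t \<in> insert b G" for t
    using that above[of b] below[of t] g(2) insert.hyps by auto
  moreover have "(\<Sum>u | u \<in> insert b G \<and> u \<le> t. h u) \<le> f t" if t: "t \<in> P" for t
    using above[of t] below[of t] g(3) f[OF bP t] t by (cases "t < b") auto
  ultimately show ?case by blast
qed

text \<open>Write \<open>f\<close> as a sum of steps \<open>g u\<close> and exchange summations, so
  that each level \<open>u\<close> meets only the counts above it. The excess \<open>r\<close> per
  level adds up to \<open>r * sum g G\<close>, at most \<open>r * f b\<close>.\<close>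

lemma weighted_sum_le:
  fixes m n :: "'a::linorder \<Rightarrow> real" and f :: "'a \<Rightarrow> real"
  assumes G: "finite G" "G \<subseteq> P" "\<And>t. t \<in> G \<Longrightarrow> t \<le> b" and b: "b \<in> P"
    and f: "\<And>x y. x \<in> P \<Longrightarrow> y \<in> P \<Longrightarrow> x \<le> y \<Longrightarrow> f x \<le> f y"
    and f0: "\<And>x. x \<in> P \<Longrightarrow> 0 \<le> f x"
    and H: "finite H" "H \<subseteq> P" "\<And>t. t \<in> H \<Longrightarrow> 0 \<le> m t" and r: "0 \<le> r"
    and count: "\<And>u. u \<in> G \<Longrightarrow> (\<Sum>t | t \<in> G \<and> u \<le> t. n t) \<le> (\<Sum>t | t \<in> H \<and> u \<le> t. m t) + r"
  shows "(\<Sum>t\<in>G. n t * f t) \<le> (\<Sum>t\<in>H. m t * f t) + r * f b"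
proof -
  have "\<exists>g. (\<forall>u\<in>G. 0 \<le> g u) \<and> (\<forall>t\<in>G. (\<Sum>u | u \<in> G \<and> u \<le> t. g u) = f t)
      \<and> (\<forall>t\<in>P. (\<Sum>u | u \<in> G \<and> u \<le> t. g u) \<le> f t)"
    by (rule layer_cake[OF G(1) f f0 G(2)])
  then obtain g where g: "\<forall>u\<in>G. 0 \<le> g u"
    "\<forall>t\<in>G. (\<Sum>u | u \<in> G \<and> u \<le> t. g u) = f t"
    "\<forall>t\<in>P. (\<Sum>u | u \<in> G \<and> u \<le> t. g u) \<le> f t"
    by (elim exE conjE)
  note g = g[rule_format]
  have "(\<Sum>t\<in>G. n t * f t) = (\<Sum>t\<in>G. \<Sum>u | u \<in> G \<and> u \<le> t. n t * g u)"
    unfolding sum_distrib_left[symmetric] by (intro sum.cong refl) (simp add: g(2))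
  also have "\<dots> = (\<Sum>u\<in>G. \<Sum>t | t \<in> G \<and> u \<le> t. n t * g u)"
    by (rule sum.swap_restrict[OF G(1) G(1)])
  also have "\<dots> = (\<Sum>u\<in>G. (\<Sum>t | t \<in> G \<and> u \<le> t. n t) * g u)"
    by (simp only: sum_distrib_right)
  also have "\<dots> \<le> (\<Sum>u\<in>G. ((\<Sum>t | t \<in> H \<and> u \<le> t. m t) + r) * g u)"
    using count g(1) by (intro sum_mono mult_right_mono)
  also have "\<dots> = (\<Sum>u\<in>G. \<Sum>t | t \<in> H \<and> u \<le> t. m t * g u) + r * sum g G"
    by (simp add: distrib_right sum.distrib sum_distrib_right sum_distrib_left)
  also have "(\<Sum>u\<in>G. \<Sum>t | t \<in> H \<and> u \<le> t. m t * g u) = (\<Sum>t\<in>H. \<Sum>u | u \<in> G \<and> u \<le> t. m t * g u)"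
    by (rule sum.swap_restrict[OF G(1) H(1)])
  also have "\<dots> = (\<Sum>t\<in>H. m t * (\<Sum>u | u \<in> G \<and> u \<le> t. g u))"
    by (simp only: sum_distrib_left)
  also have "\<dots> \<le> (\<Sum>t\<in>H. m t * f t)"
    using H g(3) by (intro sum_mono mult_left_mono) auto
  also have "sum g G \<le> f b"
  proof -
    have "{u. u \<in> G \<and> u \<le> b} = G" using G(3) by auto
    with g(3)[OF b] show ?thesis by simp
  qed
  finally show ?thesis using r by (simp add: mult_left_mono)
qed

text \<open>The terms are nonnegative, so it suffices to bound finite partial sums. The counting
  estimate, weighted with the monotone function \<open>s powr p\<close>, bounds them by the full sum
  for \<open>T\<close> plus a constant independent of \<open>G\<close>.\<close>

lemma schatten_ops_add_finite_rank:
  fixes T F :: "'a::complex_hilbert \<Rightarrow>\<^sub>L 'a"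
  assumes T: "T \<in> schatten_ops p" and F: "F \<in> finite_rank_ops" and p: "p \<ge> 0"
  shows "T + F \<in> schatten_ops p"
proof -
  let ?m = "\<lambda>T s. real (cdim (singular_space T s)) * s powr p"
  have Tc: "T \<in> compact_ops" and Tsum: "?m T summable_on singular_values T"
    using T by (auto simp: schatten_ops_def)
  have TFc: "T + F \<in> compact_ops"
    by (rule compact_ops_add[OF Tc finite_rank_ops_compact[OF F]])
  obtain R where R: "finite R" "\<And>x. blinfun_apply (T + F - T) x \<in> cspan R"
    using finite_rank_opsE[OF F] by (metis add_diff_cancel_left')
  \<comment> \<open>Bounds all singular values of \<open>T + F\<close>; the added \<open>1\<close>
    keeps it in \<open>{0<..}\<close> even if the norm is \<open>0\<close>.\<close>
  let ?b = "norm (T + F) + 1"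
  have "?m (T + F) summable_on singular_values (T + F)"
  proof (rule nonneg_bdd_above_summable_on)
    show "bdd_above (sum (?m (T + F)) ` {G. G \<subseteq> singular_values (T + F) \<and> finite G})"
    proof (rule bdd_aboveI2)
      fix G assume "G \<in> {G. G \<subseteq> singular_values (T + F) \<and> finite G}"
      then have G: "G \<subseteq> singular_values (T + F)" "finite G" by auto
      have Gpos: "G \<subseteq> {0<..}" using G by (auto simp: singular_values_def)
      \<comment> \<open>Cutting at \<open>Min G\<close> keeps \<open>H\<close> finite, as
        \<open>T\<close> is compact, and loses nothing: for \<open>u\<close> in \<open>G\<close>,
        all singular values of \<open>T\<close> from \<open>u\<close> on lie in \<open>H\<close>.
        The empty \<open>G\<close> is set apart because it has no minimum.\<close>
      define H where "H = (if G = {} then {} else {t \<in> singular_values T. Min G \<le> t})"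
      have H: "finite H" "H \<subseteq> singular_values T"
      proof -
        have "Min G > 0" if "G \<noteq> {}" using Min_in[OF G(2) that] Gpos by auto
        then show "finite H" using finite_singular_values_ge[OF Tc] by (simp add: H_def)
      qed (auto simp: H_def)
      have Hpos: "H \<subseteq> {0<..}" using H(2) by (auto simp: singular_values_def)
      have "(\<Sum>t\<in>G. ?m (T + F) t) \<le> (\<Sum>t\<in>H. ?m T t) + real (card R) * ?b powr p"
      proof (rule weighted_sum_le[where P = "{0<..}"])
        show "t \<le> ?b" if "t \<in> G" for t
          using singular_values_le_norm[OF compact_ops_bounded[OF TFc], of t] that G(1) by force
        show "?b \<in> {0<..}" by (simp add: add_nonneg_pos)
        show "x powr p \<le> y powr p" if "x \<in> {0<..}" "y \<in> {0<..}" "x \<le> y" for x y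
          using that p by (intro powr_mono2) auto
        fix u assume u: "u \<in> G"
        then have upos: "u > 0" using Gpos by auto
        have HU: "{t. t \<in> H \<and> u \<le> t} = {t. t \<in> singular_values T \<and> u \<le> t}"
          using u Min_le[OF G(2) u] by (auto simp: H_def)
        have "(\<Sum>t | t \<in> G \<and> u \<le> t. cdim (singular_space (T + F) t))
            \<le> (\<Sum>t | t \<in> singular_values T \<and> u \<le> t. cdim (singular_space T t)) + card R"
          using G(2) by (intro singular_count_finite_rank[OF Tc TFc R upos]) auto
        then show "(\<Sum>t | t \<in> G \<and> u \<le> t. real (cdim (singular_space (T + F) t)))
            \<le> (\<Sum>t | t \<in> H \<and> u \<le> t. real (cdim (singular_space T t))) + real (card R)"
          unfolding HU of_nat_sum[symmetric] of_nat_add[symmetric] by (rule of_nat_mono)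
      qed (use G Gpos H Hpos in auto)
      also have "(\<Sum>t\<in>H. ?m T t) \<le> infsum (?m T) (singular_values T)"
        by (rule finite_sum_le_infsum[OF Tsum H]) simp
      finally show "sum (?m (T + F)) G
          \<le> infsum (?m T) (singular_values T) + real (card R) * ?b powr p"
        by simp
    qed
  qed simp
  with TFc show ?thesis by (simp add: schatten_ops_def)
qed

section \<open>Splitting off a factor at the pole\<close>

text \<open>The two minus signs cancel on the range of \<open>P\<close>, so \<open>a * b = 1\<close>
  makes the factors mutually inverse.\<close>

lemma projection_factor_compose:
  fixes P :: "'a::complex_normed_vector \<Rightarrow>\<^sub>L 'a"
  assumes P: "P \<in> bounded_ops" "P o\<^sub>L P = P" and Q: "Q = id_blinfun - P"
  shows "(Q - a *\<^sub>C P) o\<^sub>L (Q - b *\<^sub>C P) = Q + (a * b) *\<^sub>C P"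
proof (rule blinfun_eqI)
  fix x
  have PP: "blinfun_apply P (blinfun_apply P x) = blinfun_apply P x" for x
    using arg_cong[OF P(2), of "\<lambda>T. blinfun_apply T x"] by simp
  show "blinfun_apply ((Q - a *\<^sub>C P) o\<^sub>L (Q - b *\<^sub>C P)) x = blinfun_apply (Q + (a * b) *\<^sub>C P) x"
    by (simp add: Q blinfun.diff_left blinfun.diff_right blinfun.add_left scaleC_blinfun.rep_eq
        bounded_opsD[OF P(1)] PP complex_vector.scale_right_diff_distrib scaleC_scaleC)
qed

lemma fredholm_compose_invertible:
  fixes T W W' :: "'a::complex_hilbert \<Rightarrow>\<^sub>L 'a"
  assumes T: "T \<in> fredholm_ops" and W: "W \<in> bounded_ops"
    and inv: "W o\<^sub>L W' = id_blinfun" "W' o\<^sub>L W = id_blinfun"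
  shows "T o\<^sub>L W \<in> fredholm_ops"
proof -
  have WW: "blinfun_apply W (blinfun_apply W' x) = x" "blinfun_apply W' (blinfun_apply W x) = x" for x
    using arg_cong[OF inv(1), of "\<lambda>T. blinfun_apply T x"]
      arg_cong[OF inv(2), of "\<lambda>T. blinfun_apply T x"] by simp_all
  have Tb: "T \<in> bounded_ops" using T by (simp add: fredholm_ops_iff)
  have TW: "T o\<^sub>L W \<in> bounded_ops" using Tb W by blast
  have "surj (blinfun_apply W)" by (metis WW(1) surjI)
  then have ran: "op_ran (T o\<^sub>L W) = op_ran T"
    by (auto simp: op_ran_def) (metis surjE rangeI)
  have "blinfun_apply W ` op_ker (T o\<^sub>L W) \<subseteq> op_ker T" by (auto simp: op_ker_def)
  then have "finite_cdim (blinfun_apply W ` op_ker (T o\<^sub>L W))"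
    using T finite_cdim_subset by (auto simp: fredholm_ops_iff)
  then have "finite_cdim (op_ker (T o\<^sub>L W))"
    using WW(2) by (intro finite_cdim_inj_image[OF bounded_ops_linear[OF W] subspace_op_ker[OF TW]])
      (metis blinfun.zero_right)+
  with T TW show ?thesis by (simp add: fredholm_ops_iff ran)
qed

text \<open>The last three conclusions are there for later use: the index at \<open>z0\<close> for
  the descent, the finite rank difference for the ideals, and the formula for the inverse for the
  order of the pole.\<close>

lemma fredholm_factor_at_kernel:
  fixes A :: "complex \<Rightarrow> ('a::complex_hilbert \<Rightarrow>\<^sub>L 'a)"
  assumes S: "open S" "z0 \<in> S" and A: "analytic_fun A S" and fred: "\<And>z. z \<in> S \<Longrightarrow> A z \<in> fredholm_ops"
    and P: "projection_onto P (op_ker (A z0))" and Q: "Q = id_blinfun - P"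
  obtains A1 where
    "\<And>z. z \<in> S \<Longrightarrow> A z = A1 z o\<^sub>L (Q - (z - z0) *\<^sub>C P)"
    "analytic_fun A1 S"
    "\<And>z. z \<in> S \<Longrightarrow> A1 z \<in> fredholm_ops"
    "def_op (A1 z0) \<le> def_op (A z0)"
    "ind (A1 z0) = ind (A z0)"
    "\<And>z. z \<in> S \<Longrightarrow> A z - A1 z \<in> finite_rank_ops"
    "\<And>z. z \<in> S \<Longrightarrow> z \<noteq> z0 \<Longrightarrow> invertible_op (A z) \<Longrightarrow>
      invertible_op (A1 z) \<and> op_inverse (A1 z) = (Q - (z - z0) *\<^sub>C P) o\<^sub>L op_inverse (A z)"
proof -
  obtain D where D: "has_cderiv A D z0" using analytic_funD[OF A S(2)] by blast
  define q where "q = (\<lambda>z. if z = z0 then D else inverse (z - z0) *\<^sub>C (A z - A z0))"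
  define A1 where "A1 = (\<lambda>z. (A z o\<^sub>L Q) - (q z o\<^sub>L P))"
  have Pb: "P \<in> bounded_ops" and PP: "P o\<^sub>L P = P"
    using P by (auto simp: projection_onto_def)
  have Qb: "Q \<in> bounded_ops" using Pb by (auto simp: Q)
  have Ab: "A z \<in> bounded_ops" if "z \<in> S" for z using fred[OF that] by (simp add: fredholm_ops_iff)
  have AP: "A z0 o\<^sub>L P = 0"
    using projection_ontoD(2)[OF P] by (intro blinfun_eqI) (simp add: op_ker_def)
  have Db: "D \<in> bounded_ops"
  proof (rule bounded_ops_lim[OF D])
    have "\<forall>\<^sub>F z in at z0. z \<in> S" using S by (auto simp: eventually_at_topological)
    then show "\<forall>\<^sub>F z in at z0. inverse (z - z0) *\<^sub>C (A z - A z0) \<in> bounded_ops"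
      by eventually_elim (intro bounded_ops_scaleC bounded_ops_diff Ab S(2))
  qed simp
  have qb: "q z \<in> bounded_ops" if "z \<in> S" for z
    using Db Ab[OF that] Ab[OF S(2)] by (auto simp: q_def)
  define W where "W z = Q - (z - z0) *\<^sub>C P" for z
  define W' where "W' z = Q - inverse (z - z0) *\<^sub>C P" for z
  have Wb: "W z \<in> bounded_ops" "W' z \<in> bounded_ops" for z
    using Pb Qb by (auto simp: W_def W'_def)
  have WW: "W z o\<^sub>L W' z = id_blinfun" "W' z o\<^sub>L W z = id_blinfun" if "z \<noteq> z0" for z
    unfolding W_def W'_def projection_factor_compose[OF Pb PP Q] using that by (simp_all add: Q)
  have A1_z0: "A1 z0 = A z0 - (D o\<^sub>L P)"
    by (simp add: A1_def q_def Q op_compose_distribs AP)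
  have A1_W': "A1 z = A z o\<^sub>L W' z" if "z \<in> S" "z \<noteq> z0" for z
    using that by (simp add: A1_def q_def W'_def op_compose_distribs op_compose_scaleC_left
        op_compose_scaleC_right Ab AP)
  have fac: "A z = A1 z o\<^sub>L W z" if "z \<in> S" for z
  proof (cases "z = z0")
    case True
    then show ?thesis by (simp add: A1_z0 W_def Q op_compose_distribs op_compose_assoc PP AP)
  next
    case False
    then show ?thesis using that by (simp add: A1_W' op_compose_assoc WW)
  qed
  have anal: "analytic_fun A1 S"
  proof (rule analytic_funI)
    fix z assume z: "z \<in> S"
    obtain E where E: "has_cderiv A E z" using analytic_funD[OF A z] by blast
    obtain E' where E': "has_cderiv q E' z"
      using analytic_funD[OF analytic_difference_quotient[OF S A D] z] unfolding q_def by blast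
    have "bounded_linear (\<lambda>T. T o\<^sub>L R)" for R :: "'a \<Rightarrow>\<^sub>L 'a"
      by (rule bounded_bilinear.bounded_linear_left[OF bounded_bilinear_blinfun_compose])
    then have "has_cderiv A1 ((E o\<^sub>L Q) - (E' o\<^sub>L P)) z"
      unfolding A1_def
      by (intro has_cderiv_diff has_cderiv_linear[OF E] has_cderiv_linear[OF E'] op_compose_scaleC_left)
    then show "\<exists>D. has_cderiv A1 D z" by blast
  qed
  note pert = fredholm_perturb_on_kernel[OF fred[OF S(2)] Db P]
  have A1_fred: "A1 z \<in> fredholm_ops" if z: "z \<in> S" for z
  proof (cases "z = z0")
    case True
    then show ?thesis using pert(1) by (simp add: A1_z0)
  next
    case False
    then show ?thesis
      using fredholm_compose_invertible[OF fred[OF z] Wb(2) WW(2,1)] A1_W'[OF z] by simp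
  qed
  have fin: "A z - A1 z \<in> finite_rank_ops" if z: "z \<in> S" for z
  proof -
    \<comment> \<open>Both terms end in \<open>P\<close>, whose range is finite-dimensional because
      \<open>A z0\<close> is Fredholm.\<close>
    have "A z - A1 z = (A z + q z) o\<^sub>L P" by (simp add: A1_def Q op_compose_distribs)
    moreover have "(A z + q z) o\<^sub>L P \<in> finite_rank_ops"
      by (rule finite_rank_ops_compose[OF _ P])
        (use Ab[OF z] qb[OF z] fred[OF S(2)] in \<open>auto simp: fredholm_ops_iff\<close>)
    ultimately show ?thesis by simp
  qed
  have inv: "invertible_op (A1 z) \<and> op_inverse (A1 z) = W z o\<^sub>L op_inverse (A z)"
    if z: "z \<in> S" "z \<noteq> z0" and i: "invertible_op (A z)" for z
  proof -
    note I = op_inverse[OF i]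
    have "(W z o\<^sub>L op_inverse (A z)) o\<^sub>L A1 z = W z o\<^sub>L ((op_inverse (A z) o\<^sub>L A z) o\<^sub>L W' z)"
      unfolding A1_W'[OF z] op_compose_assoc ..
    also have "\<dots> = id_blinfun" by (simp add: I WW z)
    finally have 1: "(W z o\<^sub>L op_inverse (A z)) o\<^sub>L A1 z = id_blinfun" .
    have "A1 z o\<^sub>L (W z o\<^sub>L op_inverse (A z)) = (A1 z o\<^sub>L W z) o\<^sub>L op_inverse (A z)"
      by (simp add: op_compose_assoc)
    also have "\<dots> = id_blinfun" by (simp add: fac[OF z(1), symmetric] I)
    finally have 2: "A1 z o\<^sub>L (W z o\<^sub>L op_inverse (A z)) = id_blinfun" .
    have "W z o\<^sub>L op_inverse (A z) \<in> bounded_ops" using Wb I by blast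
    from op_inverse_eqI[OF this 1 2] show ?thesis by simp
  qed
  show ?thesis
    using fac inv pert(2,3) unfolding A1_z0[symmetric] W_def
    by (intro that[of A1] anal A1_fred fin)
qed

lemma inverse_pole_factor:
  fixes A A1 :: "complex \<Rightarrow> ('a::complex_hilbert \<Rightarrow>\<^sub>L 'a)"
  assumes S: "open S" "z0 \<in> S" and A: "analytic_fun A S" and A1: "analytic_fun A1 S"
    and P: "projection_onto P (op_ker (A z0))" and Q: "Q = id_blinfun - P"
    and Ab: "\<And>z. z \<in> S \<Longrightarrow> A z \<in> bounded_ops"
    and inv: "\<And>z. z \<in> S \<Longrightarrow> z \<noteq> z0 \<Longrightarrow> invertible_op (A z) \<Longrightarrow>
      invertible_op (A1 z) \<and> op_inverse (A1 z) = (Q - (z - z0) *\<^sub>C P) o\<^sub>L op_inverse (A z)"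
    and n: "n \<ge> 1" and pole: "inverse_pole_of_order A z0 n"
  shows "inverse_pole_of_order A1 z0 (n - 1)"
proof -
  have ev: "\<forall>\<^sub>F z in at z0. invertible_op (A z)" and "pole_of_order (\<lambda>z. op_inverse (A z)) z0 n"
    using pole by (auto simp: inverse_pole_of_order_def)
  then obtain r0 C where r0: "r0 > 0" and C0: "C 0 \<noteq> 0"
    and sums0: "\<And>z. z \<in> ball z0 r0 - {z0} \<Longrightarrow>
      (\<lambda>k. (z - z0) ^ k *\<^sub>C C k) sums ((z - z0) ^ n *\<^sub>C op_inverse (A z))"
    using n pole_of_order_iff[of n "\<lambda>z. op_inverse (A z)" z0] by auto
  obtain r1 where r1: "r1 > 0" "\<And>z. z \<noteq> z0 \<Longrightarrow> dist z z0 < r1 \<Longrightarrow> invertible_op (A z)"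
    using ev unfolding eventually_at by auto
  obtain r2 where r2: "r2 > 0" "ball z0 r2 \<subseteq> S" using S openE by blast
  define r where "r = min r0 (min r1 r2)"
  have r: "r > 0" using r0 r1 r2 by (simp add: r_def)
  have ball: "z \<in> S" "z \<noteq> z0" "z \<in> ball z0 r0 - {z0}" "invertible_op (A z)"
    if "z \<in> ball z0 r - {z0}" for z
    using that r1(2)[of z] r2(2) by (auto simp: r_def dist_commute)
  have ev_r: "\<forall>\<^sub>F z in at z0. z \<in> ball z0 r - {z0}"
    using r by (auto simp: eventually_at dist_commute intro!: exI[of _ r])
  define F where "F = (\<lambda>z. (z - z0) ^ n *\<^sub>C op_inverse (A z))"
  have sums: "(\<lambda>k. (z - z0) ^ k *\<^sub>C C k) sums F z" if "z \<in> ball z0 r - {z0}" for z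
    using sums0 ball(3)[OF that] by (simp add: F_def)
  have Flim: "(F \<longlongrightarrow> C 0) (at z0)" by (rule power_series_tendsto[OF r sums])
  have Pb: "P \<in> bounded_ops" and PP: "P o\<^sub>L P = P" using P by (auto simp: projection_onto_def)
  have Qb: "Q \<in> bounded_ops" using Pb by (auto simp: Q)
  obtain D where D: "has_cderiv A D z0" using analytic_funD[OF A S(2)] by blast
  \<comment> \<open>Off \<open>z0\<close> the product of \<open>A z\<close> and \<open>F z\<close>
    is \<open>(z - z0) ^ n\<close> times the identity, which tends to \<open>0\<close> as
    \<open>n\<close> is positive. So \<open>C 0\<close> takes its values in the kernel of
    \<open>A z0\<close>.\<close>
  have AC: "A z0 o\<^sub>L C 0 = 0"
  proof (rule tendsto_unique[OF trivial_limit_at])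
    show "((\<lambda>z. A z o\<^sub>L F z) \<longlongrightarrow> A z0 o\<^sub>L C 0) (at z0)"
      by (intro tendsto_op_compose has_cderiv_continuous[OF D] Flim)
    have "((\<lambda>z. (z - z0) ^ n *\<^sub>C (id_blinfun :: 'a \<Rightarrow>\<^sub>L 'a)) \<longlongrightarrow> (z0 - z0) ^ n *\<^sub>C id_blinfun) (at z0)"
      by (intro tendsto_scaleC tendsto_intros)
    then have "((\<lambda>z. (z - z0) ^ n *\<^sub>C (id_blinfun :: 'a \<Rightarrow>\<^sub>L 'a)) \<longlongrightarrow> 0) (at z0)"
      using n by (simp add: power_0_left)
    moreover have "\<forall>\<^sub>F z in at z0. (z - z0) ^ n *\<^sub>C id_blinfun = A z o\<^sub>L F z"
      using ev_r by eventually_elim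
        (use ball in \<open>simp add: F_def op_compose_scaleC_right Ab op_inverse\<close>)
    ultimately show "((\<lambda>z. A z o\<^sub>L F z) \<longlongrightarrow> 0) (at z0)"
      by (rule Lim_transform_eventually)
  qed
  have PC: "P o\<^sub>L C 0 = C 0"
  proof (rule blinfun_eqI)
    fix x
    have "blinfun_apply (A z0) (blinfun_apply (C 0) x) = 0"
      using arg_cong[OF AC, of "\<lambda>T. blinfun_apply T x"] by simp
    then show "blinfun_apply (P o\<^sub>L C 0) x = blinfun_apply (C 0) x"
      using projection_ontoD(3)[OF P] by (simp add: op_ker_def)
  qed
  then have QC: "Q o\<^sub>L C 0 = 0" by (simp add: Q op_compose_distribs)
  \<comment> \<open>The coefficients of \<open>(Q - t P) F / t\<close>. Division by \<open>t\<close>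
    is harmless because \<open>Q\<close> annihilates the constant term \<open>C 0\<close>; this
    gains one order.\<close>
  define G where "G k = (Q o\<^sub>L C (Suc k)) - (P o\<^sub>L C k)" for k
  \<comment> \<open>\<open>P\<close> annihilates the part with \<open>Q\<close> and fixes
    \<open>C 0\<close>. Hence \<open>G 0\<close> is nonzero, and the order drops by no more than
    one.\<close>
  have "P o\<^sub>L G 0 = - C 0"
    by (simp add: G_def Q op_compose_distribs op_compose_assoc[symmetric] PP PC)
  then have G0: "G 0 \<noteq> 0" using C0 by (auto simp: op_compose_distribs)
  have sumsG: "(\<lambda>k. (z - z0) ^ k *\<^sub>C G k) sums ((z - z0) ^ (n - 1) *\<^sub>C op_inverse (A1 z))"
    if z: "z \<in> ball z0 r - {z0}" for z
  proof -
    define t where "t = z - z0"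
    have t: "t \<noteq> 0" using z by (simp add: t_def)
    have lin: "bounded_linear (\<lambda>T. R o\<^sub>L T)" for R :: "'a \<Rightarrow>\<^sub>L 'a"
      by (rule bounded_bilinear.bounded_linear_right[OF bounded_bilinear_blinfun_compose])
    have linC: "bounded_linear (\<lambda>T :: 'a \<Rightarrow>\<^sub>L 'a. c *\<^sub>C T)" for c
      by (rule bounded_bilinear.bounded_linear_right[OF bounded_bilinear_scaleC])
    have sP: "(\<lambda>k. t ^ k *\<^sub>C (P o\<^sub>L C k)) sums (P o\<^sub>L F z)"
      using bounded_linear.sums[OF lin sums[OF z], of P]
      by (simp add: op_compose_scaleC_right[OF Pb] t_def)
    have "(\<lambda>k. t ^ k *\<^sub>C (Q o\<^sub>L C k)) sums (Q o\<^sub>L F z)"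
      using bounded_linear.sums[OF lin sums[OF z], of Q]
      by (simp add: op_compose_scaleC_right[OF Qb] t_def)
    then have "(\<lambda>k. t ^ Suc k *\<^sub>C (Q o\<^sub>L C (Suc k))) sums (Q o\<^sub>L F z)"
      by (subst sums_Suc_iff) (simp add: QC)
    from bounded_linear.sums[OF linC this, of "inverse t"]
    have "(\<lambda>k. t ^ k *\<^sub>C (Q o\<^sub>L C (Suc k))) sums (inverse t *\<^sub>C (Q o\<^sub>L F z))"
      using t by (simp add: scaleC_scaleC field_simps)
    from sums_diff[OF this sP]
    have "(\<lambda>k. t ^ k *\<^sub>C G k) sums (inverse t *\<^sub>C (Q o\<^sub>L F z) - (P o\<^sub>L F z))"
      by (simp add: G_def complex_vector.scale_right_diff_distrib)
    also have "inverse t *\<^sub>C (Q o\<^sub>L F z) - (P o\<^sub>L F z) = inverse t *\<^sub>C ((Q - t *\<^sub>C P) o\<^sub>L F z)"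
      using t by (simp add: op_compose_distribs complex_vector.scale_right_diff_distrib
          op_compose_scaleC_left scaleC_scaleC)
    also have "(Q - t *\<^sub>C P) o\<^sub>L F z = t ^ n *\<^sub>C op_inverse (A1 z)"
    proof -
      have "Q - t *\<^sub>C P \<in> bounded_ops" using Pb Qb by blast
      then show ?thesis
        using inv[OF ball(1,2,4)[OF z]] by (simp add: F_def op_compose_scaleC_right t_def)
    qed
    also have "inverse t *\<^sub>C (t ^ n *\<^sub>C op_inverse (A1 z)) = t ^ (n - 1) *\<^sub>C op_inverse (A1 z)"
      using t n by (cases n) (simp_all add: scaleC_scaleC field_simps)
    finally show ?thesis by (simp add: t_def)
  qed
  have ev1: "\<forall>\<^sub>F z in at z0. invertible_op (A1 z)"
    using ev_r by eventually_elim (use inv ball in blast)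
  have "pole_of_order (\<lambda>z. op_inverse (A1 z)) z0 (n - 1)"
  proof (cases "n = 1")
    case False
    then have "n - 1 \<noteq> 0" using n by simp
    then show ?thesis unfolding pole_of_order_iff[OF \<open>n - 1 \<noteq> 0\<close>] using r G0 sumsG by blast
  next
    case True
    \<comment> \<open>Order \<open>0\<close> asks for an analytic extension through
      \<open>z0\<close>. The limit \<open>G 0\<close> makes \<open>A1 z0\<close> invertible, so
      \<open>op_inverse (A1 z)\<close> itself is analytic on the whole ball.\<close>
    have "((\<lambda>z. op_inverse (A1 z)) \<longlongrightarrow> G 0) (at z0)"
      by (rule power_series_tendsto[OF r]) (use sumsG True in simp)
    moreover obtain E where "has_cderiv A1 E z0" using analytic_funD[OF A1 S(2)] by blast
    ultimately have "invertible_op (A1 z0)"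
      using op_inverse_limit[OF has_cderiv_continuous ev1] by blast
    then have "invertible_op (A1 z)" if "z \<in> ball z0 r" for z
      using inv ball[of z] that by (cases "z = z0") auto
    moreover have "analytic_fun A1 (ball z0 r)"
      using A1 r2(2) by (auto simp: analytic_fun_def r_def subset_iff)
    ultimately have "analytic_fun (\<lambda>z. op_inverse (A1 z)) (ball z0 r)"
      by (intro analytic_op_inverse) auto
    then show ?thesis using True r unfolding pole_of_order_def by auto
  qed
  with ev1 show ?thesis by (simp add: inverse_pole_of_order_def)
qed

text \<open>
  Each factor split off lowers the order of the pole and preserves the index at \<open>z0\<close>; at order
  \<open>0\<close> the operator is invertible.
\<close>

lemma ind_zero_at_inverse_pole:
  fixes A :: "complex \<Rightarrow> ('a::complex_hilbert \<Rightarrow>\<^sub>L 'a)"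
  assumes S: "open S" "z0 \<in> S" and "analytic_fun A S" and "\<And>z. z \<in> S \<Longrightarrow> A z \<in> fredholm_ops"
    and "inverse_pole_of_order A z0 n"
  shows "ind (A z0) = 0"
  using assms(3-)
proof (induction n arbitrary: A)
  case 0
  then have ev: "\<forall>\<^sub>F z in at z0. invertible_op (A z)"
    and "pole_of_order (\<lambda>z. op_inverse (A z)) z0 0"
    by (auto simp: inverse_pole_of_order_def)
  then obtain r g where r: "r > 0" "analytic_fun g (ball z0 r)"
    "\<And>z. z \<in> ball z0 r - {z0} \<Longrightarrow> g z = op_inverse (A z)"
    by (auto simp: pole_of_order_def)
  have "z0 \<in> ball z0 r" using r(1) by simp
  \<comment> \<open>Only continuity of the extension \<open>g\<close> at \<open>z0\<close> is taken
    from its analyticity; it provides the limit of the inverses.\<close>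
  then obtain D where D: "has_cderiv g D z0" using analytic_funD[OF r(2)] by blast
  have "\<forall>\<^sub>F z in at z0. z \<in> ball z0 r - {z0}"
    using r by (auto simp: eventually_at dist_commute intro!: exI[of _ r])
  then have "\<forall>\<^sub>F z in at z0. g z = op_inverse (A z)" by eventually_elim (rule r(3))
  with has_cderiv_continuous[OF D] have lim: "((\<lambda>z. op_inverse (A z)) \<longlongrightarrow> g z0) (at z0)"
    by (rule Lim_transform_eventually)
  obtain E where E: "has_cderiv A E z0" using analytic_funD[OF 0(1) S(2)] by blast
  have "invertible_op (A z0)" by (rule op_inverse_limit[OF has_cderiv_continuous[OF E] ev lim])
  then show ?case using 0(2)[OF S(2)] by (intro ind_invertible) (auto simp: fredholm_ops_iff)
next
  case (Suc n)
  have A0: "A z \<in> bounded_ops" "finite_cdim (op_ker (A z))" if "z \<in> S" for z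
    using Suc.prems(2)[OF that] by (auto simp: fredholm_ops_iff)
  obtain P where P: "projection_onto P (op_ker (A z0))"
    using projection_onto_exists[OF subspace_op_ker] A0[OF S(2)] by metis
  define Q where "Q = id_blinfun - P"
  obtain A1 where A1: "analytic_fun A1 S" "\<And>z. z \<in> S \<Longrightarrow> A1 z \<in> fredholm_ops"
    "ind (A1 z0) = ind (A z0)"
    and inv: "\<And>z. z \<in> S \<Longrightarrow> z \<noteq> z0 \<Longrightarrow> invertible_op (A z) \<Longrightarrow>
      invertible_op (A1 z) \<and> op_inverse (A1 z) = (Q - (z - z0) *\<^sub>C P) o\<^sub>L op_inverse (A z)"
    by (rule fredholm_factor_at_kernel[OF S Suc.prems(1,2) P Q_def]) blast+
  have "inverse_pole_of_order A1 z0 (Suc n - 1)"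
    by (rule inverse_pole_factor[OF S Suc.prems(1) A1(1) P Q_def A0(1) inv _ Suc.prems(3)]) simp_all
  with Suc.IH[OF A1(1,2)] A1(3) show ?case by simp
qed

theorem theorem3p7:
  fixes A :: "complex \<Rightarrow> ('h::complex_hilbert \<Rightarrow>\<^sub>L 'h)"
    and \<Omega> :: "complex set" and z0 :: complex and P1 Q1 :: "'h \<Rightarrow>\<^sub>L 'h"
  assumes "separable_space (euclidean :: 'h topology)"
    and "open \<Omega>" and "connected \<Omega>"
    and "analytic_fun A \<Omega>" and "\<forall>z\<in>\<Omega>. A z \<in> fredholm_ops"
    and "z0 \<in> \<Omega>" and "inverse_has_pole A z0"
    and "projection_onto P1 (op_ker (A z0))"
    and "Q1 = id_blinfun - P1"
  shows "\<exists>A1 :: complex \<Rightarrow> ('h \<Rightarrow>\<^sub>L 'h).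
      (\<forall>z\<in>\<Omega>. A z = A1 z o\<^sub>L (Q1 - (z - z0) *\<^sub>C P1))
    \<and> analytic_fun A1 \<Omega>
    \<and> (\<forall>z\<in>\<Omega>. A1 z \<in> fredholm_ops)
    \<and> def_op (A1 z0) \<le> def_op (A z0)
    \<and> (\<exists>\<epsilon>>0. \<forall>z\<in>\<Omega>. cmod (z - z0) < \<epsilon> \<longrightarrow> ind (A z) = 0 \<and> ind (A1 z) = 0)
    \<and> (\<forall>n0\<ge>1. inverse_pole_of_order A z0 n0 \<longrightarrow> inverse_pole_of_order A1 z0 (n0 - 1))
    \<and> ((\<forall>z\<in>\<Omega>. id_blinfun - A z \<in> finite_rank_ops) \<longleftrightarrow>
       (\<forall>z\<in>\<Omega>. id_blinfun - A1 z \<in> finite_rank_ops))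
    \<and> (\<forall>p\<ge>1. (\<forall>z\<in>\<Omega>. id_blinfun - A z \<in> schatten_ops p) \<longleftrightarrow>
              (\<forall>z\<in>\<Omega>. id_blinfun - A1 z \<in> schatten_ops p))
    \<and> ((\<forall>z\<in>\<Omega>. id_blinfun - A z \<in> compact_ops) \<longleftrightarrow>
       (\<forall>z\<in>\<Omega>. id_blinfun - A1 z \<in> compact_ops))"
proof -
  have fred: "\<And>z. z \<in> \<Omega> \<Longrightarrow> A z \<in> fredholm_ops" using assms(5) by blast
  then have Ab: "\<And>z. z \<in> \<Omega> \<Longrightarrow> A z \<in> bounded_ops" by (simp add: fredholm_ops_iff)
  obtain A1 where fac: "\<And>z. z \<in> \<Omega> \<Longrightarrow> A z = A1 z o\<^sub>L (Q1 - (z - z0) *\<^sub>C P1)"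
    and A1: "analytic_fun A1 \<Omega>" "\<And>z. z \<in> \<Omega> \<Longrightarrow> A1 z \<in> fredholm_ops"
    and def: "def_op (A1 z0) \<le> def_op (A z0)" and ind: "ind (A1 z0) = ind (A z0)"
    and fin: "\<And>z. z \<in> \<Omega> \<Longrightarrow> A z - A1 z \<in> finite_rank_ops"
    and inv: "\<And>z. z \<in> \<Omega> \<Longrightarrow> z \<noteq> z0 \<Longrightarrow> invertible_op (A z) \<Longrightarrow>
      invertible_op (A1 z) \<and> op_inverse (A1 z) = (Q1 - (z - z0) *\<^sub>C P1) o\<^sub>L op_inverse (A z)"
    by (rule fredholm_factor_at_kernel[OF assms(2,6,4) fred assms(8,9)]) blast+
  have A1b: "\<And>z. z \<in> \<Omega> \<Longrightarrow> A1 z \<in> bounded_ops" using A1(2) by (simp add: fredholm_ops_iff)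
  obtain n where n: "n \<ge> 1" "inverse_pole_of_order A z0 n"
    using assms(7) by (auto simp: inverse_has_pole_def)
  have ind0: "ind (A z0) = 0"
    by (rule ind_zero_at_inverse_pole[OF assms(2,6,4) fred n(2)])
  have "\<forall>\<^sub>F z in at z0. invertible_op (A z)" using n(2) by (simp add: inverse_pole_of_order_def)
  then obtain \<epsilon> where \<epsilon>: "\<epsilon> > 0" "\<And>z. z \<noteq> z0 \<Longrightarrow> dist z z0 < \<epsilon> \<Longrightarrow> invertible_op (A z)"
    unfolding eventually_at by auto
  \<comment> \<open>Near \<open>z0\<close> the operators are invertible except possibly at
    \<open>z0\<close> itself; only there does the index need the descent.\<close>
  have indices: "ind (A z) = 0 \<and> ind (A1 z) = 0" if z: "z \<in> \<Omega>" "cmod (z - z0) < \<epsilon>" for z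
  proof (cases "z = z0")
    case True
    with ind0 ind show ?thesis by simp
  next
    case False
    then have "invertible_op (A z)" using \<epsilon>(2) z by (simp add: dist_norm)
    with inv[OF z(1) False] show ?thesis using ind_invertible Ab A1b z(1) by blast
  qed
  \<comment> \<open>One argument for all the ideals: \<open>A z\<close> and \<open>A1 z\<close>
    differ by a finite rank operator, and each class absorbs such summands.\<close>
  have transfer: "(\<forall>z\<in>\<Omega>. id_blinfun - A z \<in> I) \<longleftrightarrow> (\<forall>z\<in>\<Omega>. id_blinfun - A1 z \<in> I)"
    if I: "\<And>T F. T \<in> I \<Longrightarrow> F \<in> finite_rank_ops \<Longrightarrow> T + F \<in> I" for I
  proof -
    have "id_blinfun - A z \<in> I \<longleftrightarrow> id_blinfun - A1 z \<in> I" if z: "z \<in> \<Omega>" for z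
      using I[of "id_blinfun - A z" "A z - A1 z"]
        I[of "id_blinfun - A1 z" "- (A z - A1 z)"] fin[OF z] finite_rank_ops_uminus[OF fin[OF z]]
      by auto
    then show ?thesis by blast
  qed
  show ?thesis
  proof (intro exI[of _ A1] conjI ballI allI impI)
    show "\<exists>\<epsilon>>0. \<forall>z\<in>\<Omega>. cmod (z - z0) < \<epsilon> \<longrightarrow> ind (A z) = 0 \<and> ind (A1 z) = 0"
      using \<epsilon>(1) indices by blast
    show "inverse_pole_of_order A1 z0 (n0 - 1)" if "n0 \<ge> 1" "inverse_pole_of_order A z0 n0" for n0
      by (rule inverse_pole_factor[OF assms(2,6,4) A1(1) assms(8,9) Ab inv that])
    show "(\<forall>z\<in>\<Omega>. id_blinfun - A z \<in> finite_rank_ops) \<longleftrightarrow>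
       (\<forall>z\<in>\<Omega>. id_blinfun - A1 z \<in> finite_rank_ops)"
      by (rule transfer) (rule finite_rank_ops_add)
    show "(\<forall>z\<in>\<Omega>. id_blinfun - A z \<in> schatten_ops p) \<longleftrightarrow>
       (\<forall>z\<in>\<Omega>. id_blinfun - A1 z \<in> schatten_ops p)" if "p \<ge> 1" for p
      using that by (intro transfer schatten_ops_add_finite_rank) simp_all
    show "(\<forall>z\<in>\<Omega>. id_blinfun - A z \<in> compact_ops) \<longleftrightarrow>
       (\<forall>z\<in>\<Omega>. id_blinfun - A1 z \<in> compact_ops)"
      by (rule transfer) (rule compact_ops_add[OF _ finite_rank_ops_compact])
  qed (use fac A1 def in auto)
qed

end
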